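(* Let $\Gamma$ be a limit cycle of $\dot u=F(u)$ at a fold-flip (LPPD) bifurcation, with the critical center manifold near $\Gamma$ parametrized by $(\tau,\xi_1,\xi_2)$ as in the context, so that the restricted dynamics has the LPPD periodic normal form with coefficients $\alpha_{ij},a_{ij},b_{ij}$. Let $v_1,v_2,\varphi^*,v_1^*,v_2^*$ be as in the context. Then $$a_{20}=\frac12\int_0^T\langle\varphi^*,B(\tau;v_1,v_1)+2Av_1\rangle d\tau,\quad b_{11}=\int_0^T\langle v_2^*,B(\tau;v_1,v_2)+Av_2\rangle d\tau,\quad a_{02}=\frac12\int_0^T\langle\varphi^*,B(\tau;v_2,v_2)\rangle d\tau;$$ $h_{20},h_{11},h_{02}$ are the unique solutions on $[0,T]$ of, respectively, $$\dot h_{20}-Ah_{20}-B(\tau;v_1,v_1)+2a_{20}v_1+2\alpha_{20}F(u_0)-2Av_1-2F(u_0)=0,\ h_{20}(T)-h_{20}(0)=0,\ \int_0^T\langle v_1^*,h_{20}\rangle d\tau=0,$$ $$\dot h_{11}-Ah_{11}-B(\tau;v_1,v_2)+b_{11}v_2-Av_2=0,\ h_{11}(T)+h_{11}(0)=0,\ \int_0^T\langle v_2^*,h_{11}\rangle d\tau=0,$$ $$\dot h_{02}-Ah_{02}-B(\tau;v_2,v_2)+2a_{02}v_1+2\alpha_{02}F(u_0)=0,\ h_{02}(T)-h_{02}(0)=0,\ \int_0^T\langle v_1^*,h_{02}\rangle d\tau=0;$$ and $$\begin{aligned}a_{30}=\frac16\int_0^T\langle\varphi^*,\;&C(\tau;v_1,v_1,v_1)+3B(\tau;h_{20},v_1)-6a_{20}h_{20}+3(Ah_{20}+B(\tau;v_1,v_1))+6(1-\alpha_{20})Av_1\rangle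 d\tau-a_{20},\end{aligned}$$ $$\begin{aligned}b_{21}=\frac12\int_0^T\langle v_2^*,\;&C(\tau;v_1,v_1,v_2)+B(\tau;h_{20},v_2)+2B(\tau;h_{11},v_1)-2a_{20}h_{11}-2b_{11}h_{11}\\&+2(Ah_{11}+B(\tau;v_1,v_2))+2(1-\alpha_{20})Av_2\rangle d\tau-b_{11},\end{aligned}$$ $$\begin{aligned}a_{12}=\frac12\int_0^T\langle\varphi^*,\;&C(\tau;v_1,v_2,v_2)+B(\tau;h_{02},v_1)+2B(\tau;h_{11},v_2)-2b_{11}h_{02}-2a_{02}h_{20}\\&+Ah_{02}+B(\tau;v_2,v_2)-2\alpha_{02}Av_1\rangle d\tau-a_{02},\end{aligned}$$ $$b_{03}=\frac16\int_0^T\langle v_2^*,C(\tau;v_2,v_2,v_2)+3B(\tau;h_{02},v_2)-6a_{02}h_{11}-6\alpha_{02}Av_2\rangle d\tau .$$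
   Context: Setting. $F:\mathbb R^n\to\mathbb R^n$ is sufficiently smooth and $u_0$ is a nonconstant periodic solution of $\dot u=F(u)$ with minimal period $T>0$; $\Gamma$ is its orbit. $A=A(\tau)=F_u(u_0(\tau))$, and $B(\tau;\cdot,\cdot)$, $C(\tau;\cdot,\cdot,\cdot)$ are the symmetric multilinear forms of second and third derivatives of $F$ at $u_0(\tau)$. Dots over functions of $\tau$ denote $d/d\tau$; $\langle a,b\rangle=a^{\rm T}b$. Let $Y$ solve $\dot Y=A(\tau)Y$, $Y(0)=I_n$; the eigenvalues of $Y(T)$ are the multipliers, critical if of modulus 1. LPPD bifurcation: the multiplier $1$ is double and non-semisimple, and the only other critical multiplier is $-1$, which is simple. The three-dimensional critical center manifold near $\Gamma$ is parametrized as $u(\tau,\xi)=u_0(\tau)+\xi_1v_1(\tau)+\xi_2v_2(\tau)+H(\tau,\xi)$, $\xi=(\xi_1,\xi_2)\in\mathbb R^2$ small, $H$ smooth and $2T$-periodic in $\tau$, $$H=\sum_{2\le i+j\le3}\frac1{i!\,j!}h_{ij}(\tau)\xi_1^i\xi_2^j+O(\|\xi\|^4),$$ with $u(\tau,\xi_1,\xi_2)=u(\tau+T,\xi_1,-\xi_2)$ (so $h_{ij}(\tau)=(-1)^jh_{ij}(\tau+T)$), and with the remaining freedom fixed by $\int_0^T\langle v_1^*,h_{20}\rangle d\tau=\int_0^T\langle v_2^*,h_{11}\rangle d\tau=\int_0^T\langle v_1^*,h_{02}\rangle d\tau=0$. The dynamics restricted to it is $$\begin{aligned}\frac{d\tau}{dt}&=1-\xi_1+\alpha_{20}\xi_1^2+\alpha_{02}\xi_2^2+\alpha_{30}\xi_1^3+\alpha_{12}\xi_1\xi_2^2+\dots,\\\frac{d\xi_1}{dt}&=a_{20}\xi_1^2+a_{02}\xi_2^2+a_{30}\xi_1^3+a_{12}\xi_1\xi_2^2+\dots,\\\frac{d\xi_2}{dt}&=b_{11}\xi_1\xi_2+b_{21}\xi_1^2\xi_2+b_{03}\xi_2^3+\dots,\end{aligned}$$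 with real coefficients and dots denoting $O(\|\xi\|^4)$ terms $2T$-periodic in $\tau$; that is, if $(\tau(t),\xi(t))$ solves this system then $u(\tau(t),\xi(t))$ solves $\dot u=F(u)$. (The coefficients $\alpha_{20},\alpha_{02}$ may be chosen freely; the paper takes them to be $0$.) The following are on $[0,T]$: $\dot v_1-Av_1-F(u_0)=0$, $v_1(T)=v_1(0)$, $\int_0^T\langle v_1,F(u_0)\rangle d\tau=0$; $\dot v_2-Av_2=0$, $v_2(T)=-v_2(0)$, $\int_0^T\langle v_2,v_2\rangle d\tau=1$ (extended by $v_1(\tau+T)=v_1(\tau)$, $v_2(\tau+T)=-v_2(\tau)$); $\dot\varphi^*+A^{\rm T}\varphi^*=0$, $\varphi^*(T)=\varphi^*(0)$, $\int_0^T\langle\varphi^*,v_1\rangle d\tau=1$; $\dot v_1^*+A^{\rm T}v_1^*+\varphi^*=0$, $v_1^*(T)=v_1^*(0)$, $\int_0^T\langle v_1^*,v_1\rangle d\tau=0$; $\dot v_2^*+A^{\rm T}v_2^*=0$, $v_2^*(T)=-v_2^*(0)$, $\int_0^T\langle v_2^*,v_2\rangle d\tau=1$. *)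

theory Defs
  imports
    "HOL-Analysis.Analysis"
    "HOL-Computational_Algebra.Polynomial"
    "HOL-Library.Landau_Symbols"
begin

text \<open>Maps of class C^k. Intended for open \<open>S\<close>; the domain is finite-dimensional, so continuity of
  the iterated derivative in each tuple of fixed directions is continuity of the k-th derivative.\<close>

primrec C_k_on :: "nat \<Rightarrow> ('a::euclidean_space \<Rightarrow> 'b::real_normed_vector) \<Rightarrow> 'a set \<Rightarrow> bool" where
  "C_k_on 0 f S \<longleftrightarrow> continuous_on S f"
| "C_k_on (Suc k) f S \<longleftrightarrow> (\<forall>x\<in>S. f differentiable (at x)) \<and>
     (\<forall>v. C_k_on k (\<lambda>x. frechet_derivative f (at x) v) S)"

definition D2 :: "('a::real_normed_vector \<Rightarrow> 'b::real_normed_vector) \<Rightarrow> 'a \<Rightarrow> 'a \<Rightarrow> 'a \<Rightarrow> 'b" where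
  "D2 f x p q = frechet_derivative (\<lambda>y. frechet_derivative f (at y) p) (at x) q"

definition D3 :: "('a::real_normed_vector \<Rightarrow> 'b::real_normed_vector) \<Rightarrow> 'a \<Rightarrow> 'a \<Rightarrow> 'a \<Rightarrow> 'a \<Rightarrow> 'b" where
  "D3 f x p q r = frechet_derivative (\<lambda>y. D2 f y p q) (at x) r"

definition minimal_period :: "(real \<Rightarrow> 'a) \<Rightarrow> real \<Rightarrow> bool" where
  "minimal_period f T \<longleftrightarrow> T > 0 \<and> (\<forall>t. f (t + T) = f t) \<and>
     (\<forall>S. 0 < S \<and> S < T \<longrightarrow> \<not> (\<forall>t. f (t + S) = f t))"

text \<open>Eigenvalues of a real matrix are taken over the complex numbers.\<close>

definition complexify :: "real^'n^'m \<Rightarrow> complex^'n^'m" where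
  "complexify M = map_matrix complex_of_real M"

definition charpoly :: "'a::comm_ring_1^'n^'n \<Rightarrow> 'a poly" where
  "charpoly M = det (mat [:0, 1:] - map_matrix (\<lambda>c. [:c:]) M)"

definition eigenspace :: "real^'n^'n \<Rightarrow> complex \<Rightarrow> (complex^'n) set" where
  "eigenspace M \<mu> = {x. complexify M *v x = \<mu> *s x}"

definition eigenvalue :: "real^'n^'n \<Rightarrow> complex \<Rightarrow> bool" where
  "eigenvalue M \<mu> \<longleftrightarrow> (\<exists>x\<in>eigenspace M \<mu>. x \<noteq> 0)"

definition alg_mult :: "real^'n^'n \<Rightarrow> complex \<Rightarrow> nat" where
  "alg_mult M \<mu> = order \<mu> (charpoly (complexify M))"

definition geom_mult :: "real^'n^'n \<Rightarrow> complex \<Rightarrow> nat" where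
  "geom_mult M \<mu> = vec.dim (eigenspace M \<mu>)"

definition semisimple :: "real^'n^'n \<Rightarrow> complex \<Rightarrow> bool" where
  "semisimple M \<mu> \<longleftrightarrow> geom_mult M \<mu> = alg_mult M \<mu>"

text \<open>The condition on the monodromy matrix of a limit cycle at an LPPD (fold-flip) bifurcation.\<close>

definition LPPD_monodromy :: "real^'n^'n \<Rightarrow> bool" where
  "LPPD_monodromy M \<longleftrightarrow>
     alg_mult M 1 = 2 \<and> \<not> semisimple M 1 \<and> alg_mult M (-1) = 1 \<and>
     (\<forall>\<mu>. eigenvalue M \<mu> \<and> cmod \<mu> = 1 \<longrightarrow> \<mu> = 1 \<or> \<mu> = -1)"

definition unique_solution_on :: "'a set \<Rightarrow> (('a \<Rightarrow> 'b) \<Rightarrow> bool) \<Rightarrow> ('a \<Rightarrow> 'b) \<Rightarrow> bool" where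
  "unique_solution_on S P h \<longleftrightarrow> P h \<and> (\<forall>g. P g \<longrightarrow> (\<forall>s\<in>S. g s = h s))"

end

(* Every point of the domain of the restricted system lies on one of its solutions (Picard-Lindelof),
   so the assumption that solutions are mapped to solutions is the pointwise invariance equation
     u_tau * tau' + u_xi1 * xi1' + u_xi2 * xi2' = F(u).
   Along a ray xi = s c both sides have third-order expansions in s; comparing the coefficients of
   s^2 and s^3 for all c gives the linear equations for the h_ij.  Pairing these with the adjoint
   solution phi*, respectively v2*, and integrating over a period kills the term h_ij' - A h_ij, and the
   normal form coefficient remains because phi* is orthogonal to F(u0) and normalized against v1.
   Uniqueness of h_20, h_11, h_02: a difference of two solutions solves z' = A z with multiplier 1 or -1;
   as the geometric multiplicity is 1, it is a multiple of F(u0), respectively v2, and the integral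
   condition makes this multiple vanish, because the pairing of v1* with F(u0) equals that of phi* with v1. *)

theory Submission
  imports Defs
begin

section \<open>Iterated directional derivatives and Taylor expansion\<close>

text \<open>Several gaps shape the proof. The expansion of \<open>H\<close> is assumed for each time
  separately, without uniformity and without any regularity of \<open>h i j\<close> in time, so it
  cannot be differentiated termwise. The coefficients are instead identified with derivatives of
  \<open>H\<close> at \<open>\<xi> = 0\<close>, and symmetry of mixed derivatives yields the
  expansion of the time derivative; a cubic coefficient plus one time derivative make the four
  orders of C^4. \<open>C_k_on\<close> speaks of iterated derivatives in fixed directions, so their
  symmetry and Taylor's formula are derived in that form. The equations for \<open>v1\<close> and
  \<open>v2\<close> are one-sided at the ends of \<open>{0..T}\<close>, whereas the invariance
  equation uses two-sided derivatives; (anti)periodicity closes this gap. Rays keep every expansion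
  one-dimensional, and the dependence on the direction \<open>c\<close> is a polynomial identity
  that finitely many values of \<open>c\<close> resolve. The multiplicities prescribed by the LPPD
  condition are algebraic while uniqueness concerns eigenspaces, hence the comparison of geometric
  and algebraic multiplicity.\<close>

definition dirderiv :: "('a::real_normed_vector \<Rightarrow> 'b::real_normed_vector) \<Rightarrow> 'a \<Rightarrow> 'a \<Rightarrow> 'b" where
  "dirderiv f v = (\<lambda>x. frechet_derivative f (at x) v)"

lemma C_k_on_Suc_iff:
  "C_k_on (Suc k) f S \<longleftrightarrow> (\<forall>x\<in>S. f differentiable (at x)) \<and> (\<forall>v. C_k_on k (dirderiv f v) S)"
  by (simp add: dirderiv_def)

lemma D2_eq: "D2 f x p q = dirderiv (dirderiv f p) q x"
  by (simp add: D2_def dirderiv_def)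

lemma D3_eq: "D3 f x p q r = dirderiv (dirderiv (dirderiv f p) q) r x"
  by (simp add: D3_def D2_def dirderiv_def)

lemma D3_eq_D2: "D3 f x p q r = D2 (dirderiv f p) x q r"
  by (simp add: D3_eq D2_eq)

lemma C_k_on_dirderiv: "C_k_on (Suc k) f S \<Longrightarrow> C_k_on k (dirderiv f v) S"
  unfolding C_k_on_Suc_iff by blast

lemma C_k_on_SucD: "C_k_on (Suc k) f S \<Longrightarrow> C_k_on k f S"
proof (induction k arbitrary: f)
  case 0
  then show ?case
    by (auto intro!: continuous_at_imp_continuous_on differentiable_imp_continuous_within)
next
  case (Suc k)
  then show ?case unfolding C_k_on_Suc_iff[of "Suc k"] C_k_on_Suc_iff[of k] by blast
qed

lemma C_k_on_mono: "C_k_on m f S \<Longrightarrow> k \<le> m \<Longrightarrow> C_k_on k f S"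
  by (induction m) (auto simp: le_Suc_eq dest: C_k_on_SucD simp del: C_k_on.simps)

lemma C_k_on_differentiable:
  assumes "C_k_on k f S" "0 < k" "x \<in> S"
  shows "f differentiable (at x)"
  using assms by (cases k) auto

lemma has_derivative_dirderiv:
  "f differentiable (at x) \<Longrightarrow> (f has_derivative (\<lambda>v. dirderiv f v x)) (at x)"
  by (simp add: dirderiv_def flip: frechet_derivative_works)

lemma bounded_linear_dirderiv: "f differentiable (at x) \<Longrightarrow> bounded_linear (\<lambda>v. dirderiv f v x)"
  using has_derivative_dirderiv has_derivative_bounded_linear by blast

lemma linear_dirderiv: "f differentiable (at x) \<Longrightarrow> linear (\<lambda>v. dirderiv f v x)"
  unfolding dirderiv_def by (rule linear_frechet_derivative)

lemma dirderiv_unique: "(f has_derivative f') (at x) \<Longrightarrow> dirderiv f v x = f' v"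
  unfolding dirderiv_def using frechet_derivative_at by metis

text \<open>Functions that agree near \<open>x\<close> have the same candidate derivatives at
  \<open>x\<close>, so the choice inside \<open>frechet_derivative\<close> returns the same value,
  whether or not a derivative exists.\<close>

lemma dirderiv_cong:
  assumes "open S" "x \<in> S" "\<And>y. y \<in> S \<Longrightarrow> f y = g y"
  shows "dirderiv f v x = dirderiv g v x"
proof -
  have "(f has_derivative D) (at x) \<longleftrightarrow> (g has_derivative D) (at x)" for D
    using has_derivative_transform_within_open[OF _ assms(1,2), of f D UNIV g]
      has_derivative_transform_within_open[OF _ assms(1,2), of g D UNIV f] assms(3) by auto
  then show ?thesis unfolding dirderiv_def frechet_derivative_def by simp
qed

text \<open>Linearity in the inner direction \<open>p\<close> is an identity between functions of
  the base point; it must hold near \<open>x\<close> before it can be differentiated along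
  \<open>q\<close>, hence the open set.\<close>

lemma linear_dirderiv_dirderiv:
  assumes "open S" "x \<in> S" and f: "\<And>y. y \<in> S \<Longrightarrow> f differentiable (at y)"
    and f2: "\<And>p. dirderiv f p differentiable (at x)"
  shows "linear (\<lambda>p. dirderiv (dirderiv f p) q x)"
proof (rule linearI)
  fix p p' and c :: real
  have "dirderiv (dirderiv f (p + p')) q x = dirderiv (\<lambda>y. dirderiv f p y + dirderiv f p' y) q x"
    by (intro dirderiv_cong[OF assms(1,2)] linear_add[OF linear_dirderiv] f)
  also have "\<dots> = dirderiv (dirderiv f p) q x + dirderiv (dirderiv f p') q x"
    by (intro dirderiv_unique has_derivative_add has_derivative_dirderiv f2)
  finally show "dirderiv (dirderiv f (p + p')) q x
      = dirderiv (dirderiv f p) q x + dirderiv (dirderiv f p') q x" .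
  have "dirderiv (dirderiv f (c *\<^sub>R p)) q x = dirderiv (\<lambda>y. c *\<^sub>R dirderiv f p y) q x"
    by (intro dirderiv_cong[OF assms(1,2)] linear_scale[OF linear_dirderiv] f)
  also have "\<dots> = c *\<^sub>R dirderiv (dirderiv f p) q x"
    by (intro dirderiv_unique has_derivative_scaleR_right has_derivative_dirderiv f2)
  finally show "dirderiv (dirderiv f (c *\<^sub>R p)) q x = c *\<^sub>R dirderiv (dirderiv f p) q x" .
qed

lemma bilinear_D2:
  assumes "C_k_on 2 f S" "open S" "x \<in> S"
  shows "bilinear (D2 f x)"
proof -
  have f: "C_k_on (Suc (Suc 0)) f S" using assms(1) by (simp add: numeral_2_eq_2)
  note f1 = C_k_on_dirderiv[OF f]
  show ?thesis unfolding bilinear_def D2_eq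
    by (intro conjI allI linear_dirderiv linear_dirderiv_dirderiv[OF assms(2,3)]
        C_k_on_differentiable[OF f1] C_k_on_differentiable[OF f]) (use assms in auto)
qed

text \<open>Both mixed derivatives are the limit of the same second difference quotient.\<close>

lemma second_difference_limit:
  fixes f :: "'a::real_normed_vector \<Rightarrow> 'b::real_normed_vector"
  assumes S: "open S" "x \<in> S" and f: "\<And>y. y \<in> S \<Longrightarrow> f differentiable (at y)"
    and f2: "dirderiv f p differentiable (at x)"
  shows "((\<lambda>t. (f (x + t *\<^sub>R p + t *\<^sub>R q) - f (x + t *\<^sub>R p) - f (x + t *\<^sub>R q) + f x) /\<^sub>R t\<^sup>2)
            \<longlongrightarrow> dirderiv (dirderiv f p) q x) (at_right 0)"
proof (rule tendstoI)
  fix e :: real assume "e > 0"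
  define a where "a = dirderiv (dirderiv f p) q x"
  define D where "D v = dirderiv (dirderiv f p) v x" for v
  define n where "n = norm p + norm q"
  have n: "n \<ge> 0" "norm p \<le> n" by (auto simp: n_def)
  \<comment> \<open>The factor \<open>4 * n + 1\<close> gives \<open>2 * e' * n < e\<close> at the
    end, also when \<open>n = 0\<close>.\<close>
  define e' where "e' = e / (4 * n + 1)"
  have e': "e' > 0" using \<open>e > 0\<close> n by (simp add: e'_def)
  have D: "linear D" unfolding D_def by (rule linear_dirderiv[OF f2])
  obtain d1 where d1: "d1 > 0" "ball x d1 \<subseteq> S" using S openE by blast
  obtain d2 where d2: "d2 > 0"
    "\<And>y. norm (y - x) < d2 \<Longrightarrow> norm (dirderiv f p y - dirderiv f p x - D (y - x)) \<le> e' * norm (y - x)"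
    using has_derivative_dirderiv[OF f2] e' unfolding has_derivative_at_alt D_def by blast
  \<comment> \<open>For \<open>t < d\<close> all points used below lie within
    \<open>t * n < min d1 d2\<close> of \<open>x\<close>: inside \<open>S\<close>, and where the
    first-order estimate for \<open>dirderiv f p\<close> holds.\<close>
  define d where "d = min d1 d2 / (n + 1)"
  have d: "d > 0" using d1 d2 n by (simp add: d_def)
  have "dist ((f (x + t *\<^sub>R p + t *\<^sub>R q) - f (x + t *\<^sub>R p) - f (x + t *\<^sub>R q) + f x) /\<^sub>R t\<^sup>2) a < e"
    if t: "0 < t" "t < d" for t
  proof -
    have tn: "t * n < min d1 d2"
    proof -
      have "t * n \<le> t * (n + 1)" using t by simp
      also have "\<dots> < d * (n + 1)" using t n by (intro mult_strict_right_mono) auto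
      finally show ?thesis using n by (simp add: d_def)
    qed
    have b: "norm (s *\<^sub>R t *\<^sub>R p + c *\<^sub>R q) \<le> t * n"
      if "s \<in> {0..1}" "c = 0 \<or> c = t" for s c
    proof -
      have "norm (s *\<^sub>R t *\<^sub>R p + c *\<^sub>R q) \<le> s * (t * norm p) + \<bar>c\<bar> * norm q"
        using norm_triangle_ineq[of "s *\<^sub>R t *\<^sub>R p" "c *\<^sub>R q"] that t by simp
      also have "\<dots> \<le> t * norm p + t * norm q"
        using that t by (intro add_mono mult_left_le_one_le mult_right_mono) auto
      finally show ?thesis by (simp add: n_def algebra_simps)
    qed
    \<comment> \<open>\<open>\<phi>\<close> compares \<open>f\<close> on two segments in direction
      \<open>t *\<^sub>R p\<close> that differ by the shift \<open>t *\<^sub>R q\<close>, minus the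
      expected value; its increment over \<open>{0..1}\<close> is the second difference minus
      \<open>t\<^sup>2 *\<^sub>R a\<close>. Keeping \<open>0 *\<^sub>R q\<close> makes both segments
      instances, \<open>c = t\<close> and \<open>c = 0\<close>, of the same estimates.\<close>
    define \<phi> where "\<phi> s = f (x + (s *\<^sub>R t *\<^sub>R p + t *\<^sub>R q)) - f (x + (s *\<^sub>R t *\<^sub>R p + 0 *\<^sub>R q)) - s *\<^sub>R t\<^sup>2 *\<^sub>R a" for s
    define \<phi>' where "\<phi>' s = t *\<^sub>R dirderiv f p (x + (s *\<^sub>R t *\<^sub>R p + t *\<^sub>R q))
        - t *\<^sub>R dirderiv f p (x + (s *\<^sub>R t *\<^sub>R p + 0 *\<^sub>R q)) - t\<^sup>2 *\<^sub>R a" for s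
    have fd: "((\<lambda>s. f (x + (s *\<^sub>R t *\<^sub>R p + c *\<^sub>R q))) has_vector_derivative
        t *\<^sub>R dirderiv f p (x + (s *\<^sub>R t *\<^sub>R p + c *\<^sub>R q))) (at s)"
      if "s \<in> {0..1}" "c = 0 \<or> c = t" for s c
    proof -
      let ?y = "x + (s *\<^sub>R t *\<^sub>R p + c *\<^sub>R q)"
      have "dist x ?y = norm (s *\<^sub>R t *\<^sub>R p + c *\<^sub>R q)"
        using dist_add_cancel[of x 0] by simp
      then have "?y \<in> ball x d1" using b[OF that] tn by (simp del: scaleR_scaleR)
      then have "?y \<in> S" using d1 by blast
      then have "(f has_derivative (\<lambda>v. dirderiv f v ?y)) (at ?y)"
        by (intro has_derivative_dirderiv f)
      moreover have "((\<lambda>s. x + (s *\<^sub>R t *\<^sub>R p + c *\<^sub>R q)) has_vector_derivative t *\<^sub>R p) (at s)"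
        by (auto intro!: derivative_eq_intros)
      ultimately have "((f \<circ> (\<lambda>s. x + (s *\<^sub>R t *\<^sub>R p + c *\<^sub>R q))) has_vector_derivative
          dirderiv f (t *\<^sub>R p) ?y) (at s)"
        by (intro vector_derivative_diff_chain_within[where f="\<lambda>s. x + (s *\<^sub>R t *\<^sub>R p + c *\<^sub>R q)"])
          (auto intro: has_derivative_at_withinI)
      moreover have "dirderiv f (t *\<^sub>R p) ?y = t *\<^sub>R dirderiv f p ?y"
        by (intro linear_scale[OF linear_dirderiv] f \<open>?y \<in> S\<close>)
      ultimately show ?thesis by (simp add: o_def)
    qed
    have \<phi>': "(\<phi> has_vector_derivative \<phi>' s) (at s)" if "s \<in> {0..1}" for s
      unfolding \<phi>_def \<phi>'_def
      by (intro has_vector_derivative_diff fd that)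
        (auto intro!: derivative_eq_intros)
    have est: "norm (\<phi>' s) \<le> t\<^sup>2 * (2 * e' * n)" if s: "s \<in> {0..1}" for s
    proof -
      define r where "r c = dirderiv f p (x + (s *\<^sub>R t *\<^sub>R p + c *\<^sub>R q)) - dirderiv f p x
          - D (s *\<^sub>R t *\<^sub>R p + c *\<^sub>R q)" for c
      have r: "norm (r c) \<le> e' * (t * n)" if "c = 0 \<or> c = t" for c
      proof -
        have "norm (r c) \<le> e' * norm (s *\<^sub>R t *\<^sub>R p + c *\<^sub>R q)"
          unfolding r_def using d2(2)[of "x + (s *\<^sub>R t *\<^sub>R p + c *\<^sub>R q)"] b[OF s that] tn by simp
        then show ?thesis using b[OF s that] e'
          by (meson mult_left_mono order_trans less_imp_le)
      qed
      have "D (s *\<^sub>R t *\<^sub>R p + t *\<^sub>R q) = D (s *\<^sub>R t *\<^sub>R p + 0 *\<^sub>R q) + t *\<^sub>R a"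
        using linear_add[OF D, of "s *\<^sub>R t *\<^sub>R p" "t *\<^sub>R q"] linear_scale[OF D, of t q]
        by (simp add: a_def D_def)
      \<comment> \<open>The linear parts on the two segments differ by exactly
        \<open>t *\<^sub>R a\<close>, so only the remainders survive.\<close>
      then have "\<phi>' s = t *\<^sub>R (r t - r 0)"
        by (simp add: \<phi>'_def r_def algebra_simps power2_eq_square)
      then have "norm (\<phi>' s) = t * norm (r t - r 0)" using t by simp
      also have "norm (r t - r 0) \<le> e' * (t * n) + e' * (t * n)"
        by (rule order_trans[OF norm_triangle_ineq4 add_mono[OF r r]]) auto
      then have "t * norm (r t - r 0) \<le> t * (e' * (t * n) + e' * (t * n))"
        using t by (intro mult_left_mono) auto
      finally show ?thesis by (simp add: power2_eq_square algebra_simps)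
    qed
    have "norm (\<phi> 1 - \<phi> 0) \<le> (\<lambda>s. t\<^sup>2 * (2 * e' * n) * s) 1 - (\<lambda>s. t\<^sup>2 * (2 * e' * n) * s) 0"
    proof (rule differentiable_bound_general[where f=\<phi> and f'=\<phi>' and \<phi>'="\<lambda>_. t\<^sup>2 * (2 * e' * n)"])
      show "continuous_on {0..1} \<phi>"
        by (intro continuous_at_imp_continuous_on ballI)
          (use \<phi>' has_vector_derivative_continuous in blast)
    qed (use \<phi>' est in \<open>auto intro!: continuous_intros derivative_eq_intros simp: has_vector_derivative_def\<close>)
    moreover have "\<phi> 1 - \<phi> 0 = f (x + t *\<^sub>R p + t *\<^sub>R q) - f (x + t *\<^sub>R p) - f (x + t *\<^sub>R q) + f x - t\<^sup>2 *\<^sub>R a"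
      by (simp add: \<phi>_def algebra_simps)
    moreover have "(f (x + t *\<^sub>R p + t *\<^sub>R q) - f (x + t *\<^sub>R p) - f (x + t *\<^sub>R q) + f x) /\<^sub>R t\<^sup>2 - a
      = (f (x + t *\<^sub>R p + t *\<^sub>R q) - f (x + t *\<^sub>R p) - f (x + t *\<^sub>R q) + f x - t\<^sup>2 *\<^sub>R a) /\<^sub>R t\<^sup>2"
      using t by (simp add: scaleR_diff_right)
    ultimately have "dist ((f (x + t *\<^sub>R p + t *\<^sub>R q) - f (x + t *\<^sub>R p) - f (x + t *\<^sub>R q) + f x) /\<^sub>R t\<^sup>2) a
        \<le> 2 * e' * n"
      using t by (simp add: dist_norm divide_simps mult.commute)
    also have "\<dots> < e" using \<open>e > 0\<close> n by (simp add: e'_def divide_simps)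
    finally show ?thesis .
  qed
  then show "\<forall>\<^sub>F t in at_right 0. dist ((f (x + t *\<^sub>R p + t *\<^sub>R q) - f (x + t *\<^sub>R p) - f (x + t *\<^sub>R q) + f x) /\<^sub>R t\<^sup>2)
      (dirderiv (dirderiv f p) q x) < e"
    using d unfolding eventually_at_right_field a_def by (intro exI[of _ d]) auto
qed

lemma dirderiv_commute:
  assumes "open S" "x \<in> S" "C_k_on 2 f S"
  shows "dirderiv (dirderiv f p) q x = dirderiv (dirderiv f q) p x"
proof -
  have f: "C_k_on (Suc (Suc 0)) f S" using assms(3) by (simp add: numeral_2_eq_2)
  note d = C_k_on_differentiable[OF f] C_k_on_differentiable[OF C_k_on_dirderiv[OF f]]
  have "((\<lambda>t. (f (x + t *\<^sub>R p + t *\<^sub>R q) - f (x + t *\<^sub>R p) - f (x + t *\<^sub>R q) + f x) /\<^sub>R t\<^sup>2)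
            \<longlongrightarrow> dirderiv (dirderiv f p) q x) (at_right 0)"
    by (intro second_difference_limit[OF assms(1,2)] d) (use assms in auto)
  moreover have "((\<lambda>t. (f (x + t *\<^sub>R p + t *\<^sub>R q) - f (x + t *\<^sub>R p) - f (x + t *\<^sub>R q) + f x) /\<^sub>R t\<^sup>2)
            \<longlongrightarrow> dirderiv (dirderiv f q) p x) (at_right 0)"
    using second_difference_limit[OF assms(1,2) d, of q p] assms by (simp add: algebra_simps)
  ultimately show ?thesis using tendsto_unique trivial_limit_at_right_real by blast
qed


lemma D2_commute:
  assumes "open S" "x \<in> S" "C_k_on 2 f S"
  shows "D2 f x p q = D2 f x q p"
  unfolding D2_eq by (rule dirderiv_commute[OF assms])

lemma C_k_on_dirderiv_2: "C_k_on 3 f S \<Longrightarrow> C_k_on 2 (dirderiv f p) S"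
  using C_k_on_dirderiv[of 2 f S p] by (simp add: eval_nat_numeral del: C_k_on.simps)

text \<open>The first exchange is the symmetry of the second derivative at all nearby points,
  differentiated once more; the second is the symmetry for \<open>dirderiv f p\<close>. Together the
  two transpositions generate all permutations.\<close>

lemma D3_commute:
  assumes "open S" "x \<in> S" "C_k_on 3 f S"
  shows "D3 f x p q r = D3 f x q p r" "D3 f x p q r = D3 f x p r q"
proof -
  have f: "C_k_on 2 f S" using assms(3) by (rule C_k_on_mono) simp
  show "D3 f x p q r = D3 f x q p r"
    unfolding D3_eq using dirderiv_commute[OF assms(1) _ f] by (intro dirderiv_cong[OF assms(1,2)])
  show "D3 f x p q r = D3 f x p r q"
    unfolding D3_eq_D2 by (rule D2_commute[OF assms(1,2) C_k_on_dirderiv_2[OF assms(3)]])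
qed

text \<open>Symmetry moves \<open>p\<close> out of the innermost slot into an argument of
  \<open>D2 (dirderiv f r)\<close>, where bilinearity is known.\<close>

lemma linear_D3_1:
  assumes "open S" "x \<in> S" "C_k_on 3 f S"
  shows "linear (\<lambda>p. D3 f x p q r)"
proof -
  have "bilinear (D2 (dirderiv f r) x)"
    by (rule bilinear_D2[OF C_k_on_dirderiv_2 assms(1,2)]) (rule assms(3))
  moreover have "D3 f x p q r = D2 (dirderiv f r) x p q" for p
    using D3_commute[OF assms] unfolding D3_eq_D2 by metis
  ultimately show ?thesis by (simp add: bilinear_def)
qed

lemma trilinear_D3:
  assumes "open S" "x \<in> S" "C_k_on 3 f S"
  shows "bilinear (D3 f x p)" "linear (\<lambda>p. D3 f x p q r)"
proof -
  have "D3 f x p = D2 (dirderiv f p) x" by (simp add: D3_eq_D2 fun_eq_iff)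
  then show "bilinear (D3 f x p)"
    using bilinear_D2[OF C_k_on_dirderiv_2[OF assms(3)] assms(1,2)] by simp
qed (rule linear_D3_1[OF assms])

text \<open>Expanding the first argument in the basis turns the cubic form into a finite sum of
  coordinates times bilinear forms, to which the product rules apply.\<close>

lemma has_derivative_trilinear_diag:
  fixes t :: "'a::euclidean_space \<Rightarrow> 'a \<Rightarrow> 'a \<Rightarrow> 'b::real_normed_vector"
  assumes t: "\<And>p. bilinear (t p)" "\<And>q r. linear (\<lambda>p. t p q r)"
  shows "((\<lambda>p. t p p p) has_derivative (\<lambda>v. t v p p + t p v p + t p p v)) (at p)"
proof -
  have rep: "t p q r = (\<Sum>b\<in>Basis. (p \<bullet> b) *\<^sub>R t b q r)" for p q r
    using linear_sum[OF t(2), of "\<lambda>b. (p \<bullet> b) *\<^sub>R b" Basis q r]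
    by (simp add: euclidean_representation linear_scale[OF t(2)])
  have "((\<lambda>p. \<Sum>b\<in>Basis. (p \<bullet> b) *\<^sub>R t b p p) has_derivative
      (\<lambda>v. \<Sum>b\<in>Basis. (p \<bullet> b) *\<^sub>R (t b p v + t b v p) + (v \<bullet> b) *\<^sub>R t b p p)) (at p)"
    by (intro has_derivative_sum has_derivative_scaleR has_derivative_inner_left has_derivative_ident
        bounded_bilinear.FDERIV[OF t(1)[unfolded bilinear_conv_bounded_bilinear]])
  moreover have "(\<lambda>p. t p p p) = (\<lambda>p. \<Sum>b\<in>Basis. (p \<bullet> b) *\<^sub>R t b p p)"
    by (intro ext rep)
  moreover have "(\<Sum>b\<in>Basis. (p \<bullet> b) *\<^sub>R (t b p v + t b v p) + (v \<bullet> b) *\<^sub>R t b p p)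
      = t v p p + t p v p + t p p v" for v
    unfolding rep[of v] rep[of p] by (simp add: sum.distrib scaleR_add_right)
  ultimately show ?thesis by simp
qed

text \<open>This is what raises the order of a Taylor remainder by one: the mean value inequality on
  the ball of radius \<open>norm p\<close> contributes the extra factor \<open>norm p\<close>.
  Smallness in each fixed direction becomes a bound on the operator norm because finitely many basis
  directions span, and \<open>?e\<close> shares \<open>c\<close> among them.\<close>

lemma smallo_of_derivative:
  fixes r :: "'a::euclidean_space \<Rightarrow> 'b::real_normed_vector"
  assumes r: "\<forall>\<^sub>F p in nhds 0. (r has_derivative r' p) (at p)" and r0: "r 0 = 0"
    and r': "\<And>v. (\<lambda>p. norm (r' p v)) \<in> o[nhds 0](\<lambda>p. norm p ^ k)"
  shows "(\<lambda>p. norm (r p)) \<in> o[nhds 0](\<lambda>p. norm p ^ Suc k)"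
proof (rule landau_o.smallI)
  fix c :: real assume c: "c > 0"
  have B: "0 < real (card (Basis :: 'a set))" by simp
  let ?e = "c / card (Basis :: 'a set)"
  have "\<forall>\<^sub>F p in nhds 0. \<forall>b\<in>(Basis :: 'a set). norm (norm (r' p b)) \<le> ?e * norm (norm p ^ k)"
    by (intro eventually_ball_finite ballI landau_o.smallD[OF r']) (use c in auto)
  with r have "\<forall>\<^sub>F p in nhds 0. (r has_derivative r' p) (at p) \<and>
      (\<forall>b\<in>(Basis :: 'a set). norm (norm (r' p b)) \<le> ?e * norm (norm p ^ k))"
    by (rule eventually_conj)
  then obtain d where d: "d > 0" and dd: "\<And>p. p \<in> ball 0 d \<Longrightarrow> (r has_derivative r' p) (at p)"
    "\<And>p b. p \<in> ball 0 d \<Longrightarrow> b \<in> (Basis :: 'a set) \<Longrightarrow> norm (r' p b) \<le> ?e * norm p ^ k"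
    unfolding eventually_nhds_metric by (auto simp: dist_norm norm_minus_commute)
  have on: "onorm (r' p) \<le> c * norm p ^ k" if "p \<in> ball 0 d" for p
  proof (rule onorm_le)
    fix v
    have lin: "linear (r' p)" using dd(1)[OF that] has_derivative_linear by blast
    have "r' p v = (\<Sum>b\<in>Basis. (v \<bullet> b) *\<^sub>R r' p b)"
      using linear_sum[OF lin, of "\<lambda>b. (v \<bullet> b) *\<^sub>R b" Basis]
      by (simp add: euclidean_representation linear_scale[OF lin])
    also have "norm \<dots> \<le> (\<Sum>b\<in>(Basis :: 'a set). norm v * (?e * norm p ^ k))"
      by (intro sum_norm_le, unfold norm_scaleR, intro mult_mono Basis_le_norm dd that) auto
    also have "\<dots> = c * norm p ^ k * norm v" using B by simp
    finally show "norm (r' p v) \<le> c * norm p ^ k * norm v" .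
  qed
  have "norm (norm (r p)) \<le> c * norm (norm p ^ Suc k)" if p: "p \<in> ball 0 d" for p
  proof -
    have sub: "cball 0 (norm p) \<subseteq> ball (0::'a) d" using p by auto
    have "norm (r p - r 0) \<le> c * norm p ^ k * norm (p - 0)"
    proof (rule differentiable_bound[where S="cball 0 (norm p)" and f'=r'])
      fix q :: 'a assume q: "q \<in> cball 0 (norm p)"
      then show "(r has_derivative r' q) (at q within cball 0 (norm p))"
        using dd(1) sub by (blast intro: has_derivative_at_withinI)
      have "onorm (r' q) \<le> c * norm q ^ k" using on q sub by blast
      also have "\<dots> \<le> c * norm p ^ k" using q c by (intro mult_left_mono power_mono) auto
      finally show "onorm (r' q) \<le> c * norm p ^ k" .
    qed auto
    then show ?thesis by (simp add: r0 mult_ac)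
  qed
  then show "\<forall>\<^sub>F p in nhds 0. norm (norm (r p)) \<le> c * norm (norm p ^ Suc k)"
    using d unfolding eventually_nhds_metric by (intro exI[of _ d]) (auto simp: dist_norm)
qed

lemma taylor_1:
  assumes "f differentiable (at x)"
  shows "(\<lambda>p. norm (f (x + p) - f x - dirderiv f p x)) \<in> o[nhds 0](\<lambda>p. norm p ^ 1)"
proof (rule landau_o.smallI)
  fix c :: real assume "c > 0"
  then obtain d where "d > 0"
    "\<And>y. norm (y - x) < d \<Longrightarrow> norm (f y - f x - dirderiv f (y - x) x) \<le> c * norm (y - x)"
    using has_derivative_dirderiv[OF assms] unfolding has_derivative_at_alt by blast
  then have "\<And>p. norm p < d \<Longrightarrow> norm (f (x + p) - f x - dirderiv f p x) \<le> c * norm p"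
    by (metis add_diff_cancel_left')
  then show "\<forall>\<^sub>F p in nhds 0. norm (norm (f (x + p) - f x - dirderiv f p x)) \<le> c * norm (norm p ^ 1)"
    using \<open>d > 0\<close> unfolding eventually_nhds_metric by (intro exI[of _ d]) (auto simp: dist_norm)
qed

lemma eventually_translate_in_open:
  fixes x :: "'a::real_normed_vector"
  assumes "open S" "x \<in> S"
  shows "\<forall>\<^sub>F p in nhds 0. x + p \<in> S"
proof -
  have "((\<lambda>p. x + p) \<longlongrightarrow> x + 0) (nhds 0)" by (intro tendsto_intros filterlim_ident)
  then show ?thesis using assms topological_tendstoD by fastforce
qed

lemma has_derivative_translate:
  assumes "f differentiable (at (x + p))"
  shows "((\<lambda>p. f (x + p)) has_derivative (\<lambda>v. dirderiv f v (x + p))) (at p)"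
proof -
  have "((\<lambda>p. x + p) has_derivative (\<lambda>v. v)) (at p)" by (auto intro!: derivative_eq_intros)
  then show ?thesis using has_derivative_compose has_derivative_dirderiv[OF assms] by blast
qed

text \<open>The derivative of the remainder along \<open>v\<close> is the \<open>taylor_1\<close>
  remainder of \<open>dirderiv f v\<close>, once symmetry of \<open>D2\<close> merges the two terms
  of the product rule; \<open>smallo_of_derivative\<close> gains the order. The cubic case climbs
  from this one in the same way.\<close>

lemma taylor_2:
  fixes f :: "'a::euclidean_space \<Rightarrow> 'b::real_normed_vector"
  assumes S: "open S" "x \<in> S" and f: "C_k_on 2 f S"
  shows "(\<lambda>p. norm (f (x + p) - f x - dirderiv f p x - (1/2) *\<^sub>R D2 f x p p)) \<in> o[nhds 0](\<lambda>p. norm p ^ 2)"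
proof -
  have f': "C_k_on (Suc (Suc 0)) f S" using f by (simp add: numeral_2_eq_2)
  note d = C_k_on_differentiable[OF f'] C_k_on_differentiable[OF C_k_on_dirderiv[OF f']]
  note bl = bilinear_D2[OF f S]
  have "(\<lambda>p. norm (f (x + p) - f x - dirderiv f p x - (1/2) *\<^sub>R D2 f x p p)) \<in> o[nhds 0](\<lambda>p. norm p ^ Suc 1)"
  proof (rule smallo_of_derivative)
    have "((\<lambda>p. f (x + p) - f x - dirderiv f p x - (1/2) *\<^sub>R D2 f x p p) has_derivative
        (\<lambda>v. dirderiv f v (x + p) - 0 - dirderiv f v x - (1/2) *\<^sub>R (D2 f x p v + D2 f x v p))) (at p)"
      if "x + p \<in> S" for p
      by (intro has_derivative_diff has_derivative_const has_derivative_scaleR_right has_derivative_translate d that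
          bounded_bilinear.FDERIV[OF bl[unfolded bilinear_conv_bounded_bilinear]] has_derivative_ident
          bounded_linear_imp_has_derivative bounded_linear_dirderiv) (use S in auto)
    moreover have "D2 f x p v = D2 f x v p" for p v by (rule D2_commute[OF S f])
    ultimately show "\<forall>\<^sub>F p in nhds 0. ((\<lambda>p. f (x + p) - f x - dirderiv f p x - (1/2) *\<^sub>R D2 f x p p) has_derivative
        (\<lambda>v. dirderiv f v (x + p) - dirderiv f v x - D2 f x v p)) (at p)"
      using eventually_translate_in_open[OF S] by (auto elim!: eventually_mono simp flip: scaleR_2)
    show "(\<lambda>p. norm (dirderiv f v (x + p) - dirderiv f v x - D2 f x v p)) \<in> o[nhds 0](\<lambda>p. norm p ^ 1)" for v
      unfolding D2_eq by (rule taylor_1) (use d S in auto)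
    show "f (x + 0) - f x - dirderiv f 0 x - (1 / 2) *\<^sub>R D2 f x 0 0 = 0"
      using linear_0[OF linear_dirderiv[OF d(1)]] bilinear_lzero[OF bl] S by simp
  qed
  then show ?thesis by (simp add: numeral_2_eq_2)
qed

lemma taylor_3:
  fixes f :: "'a::euclidean_space \<Rightarrow> 'b::real_normed_vector"
  assumes S: "open S" "x \<in> S" and f: "C_k_on 3 f S"
  shows "(\<lambda>p. norm (f (x + p) - f x - dirderiv f p x - (1/2) *\<^sub>R D2 f x p p - (1/6) *\<^sub>R D3 f x p p p))
    \<in> o[nhds 0](\<lambda>p. norm p ^ 3)"
proof -
  have f2: "C_k_on 2 f S" using f by (rule C_k_on_mono) simp
  note d = C_k_on_differentiable[OF f]
  note bl = bilinear_D2[OF f2 S]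
  note tl = trilinear_D3[OF S f]
  have "(\<lambda>p. norm (f (x + p) - f x - dirderiv f p x - (1/2) *\<^sub>R D2 f x p p - (1/6) *\<^sub>R D3 f x p p p))
      \<in> o[nhds 0](\<lambda>p. norm p ^ Suc 2)"
  proof (rule smallo_of_derivative)
    have raw: "((\<lambda>p. f (x + p) - f x - dirderiv f p x - (1/2) *\<^sub>R D2 f x p p - (1/6) *\<^sub>R D3 f x p p p) has_derivative
        (\<lambda>v. dirderiv f v (x + p) - 0 - dirderiv f v x - (1/2) *\<^sub>R (D2 f x p v + D2 f x v p)
          - (1/6) *\<^sub>R (D3 f x v p p + D3 f x p v p + D3 f x p p v))) (at p)"
      if "x + p \<in> S" for p
      by (intro has_derivative_diff has_derivative_const has_derivative_scaleR_right has_derivative_translate d that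
          bounded_bilinear.FDERIV[OF bl[unfolded bilinear_conv_bounded_bilinear]] has_derivative_ident
          has_derivative_trilinear_diag[OF tl]
          bounded_linear_imp_has_derivative bounded_linear_dirderiv) (use S in auto)
    have eq: "dirderiv f v (x + p) - 0 - dirderiv f v x - (1/2) *\<^sub>R (D2 f x p v + D2 f x v p)
          - (1/6) *\<^sub>R (D3 f x v p p + D3 f x p v p + D3 f x p p v)
        = dirderiv f v (x + p) - dirderiv f v x - D2 f x v p - (1/2) *\<^sub>R D3 f x v p p" for p v
    proof -
      have "D2 f x p v = D2 f x v p" by (rule D2_commute[OF S f2])
      moreover have "D3 f x p v p = D3 f x v p p" "D3 f x p p v = D3 f x v p p"
        using D3_commute[OF S f] by metis+
      moreover have "(1/6) *\<^sub>R (y + y + y) = (1/2) *\<^sub>R y" for y :: 'b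
      proof -
        have "y + y + y = 3 *\<^sub>R y" using scaleR_add_left[of 2 1 y] by (simp flip: scaleR_2)
        then show ?thesis by (simp only:) simp
      qed
      ultimately show ?thesis by (simp flip: scaleR_2)
    qed
    show "\<forall>\<^sub>F p in nhds 0. ((\<lambda>p. f (x + p) - f x - dirderiv f p x - (1/2) *\<^sub>R D2 f x p p
          - (1/6) *\<^sub>R D3 f x p p p) has_derivative
        (\<lambda>v. dirderiv f v (x + p) - dirderiv f v x - D2 f x v p - (1/2) *\<^sub>R D3 f x v p p)) (at p)"
      using eventually_translate_in_open[OF S] by (rule eventually_mono) (rule raw[unfolded eq])
    show "(\<lambda>p. norm (dirderiv f v (x + p) - dirderiv f v x - D2 f x v p - (1/2) *\<^sub>R D3 f x v p p))
        \<in> o[nhds 0](\<lambda>p. norm p ^ 2)" for v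
      using taylor_2[OF S C_k_on_dirderiv_2[OF f], of v] by (simp add: D2_eq D3_eq_D2)
    show "f (x + 0) - f x - dirderiv f 0 x - (1 / 2) *\<^sub>R D2 f x 0 0 - (1 / 6) *\<^sub>R D3 f x 0 0 0 = 0"
      using linear_0[OF linear_dirderiv[OF d]] bilinear_lzero[OF bl] bilinear_lzero[OF tl(1)] S by simp
  qed
  then show ?thesis by simp
qed

section \<open>Third-order jets of curves\<close>

text \<open>The vanishing error sits inside the cubic coefficient, so this is an expansion up to
  o(s^3). It asks for no derivatives of \<open>f\<close> and ignores \<open>f 0\<close>, which lets
  it apply to remainders known only through Landau bounds.\<close>

definition jet3 :: "(real \<Rightarrow> 'a::real_normed_vector) \<Rightarrow> 'a \<Rightarrow> 'a \<Rightarrow> 'a \<Rightarrow> 'a \<Rightarrow> bool" where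
  "jet3 f a b c d \<longleftrightarrow> (\<exists>e. (e \<longlongrightarrow> 0) (at 0) \<and>
     (\<forall>\<^sub>F s in at 0. f s = a + s *\<^sub>R b + s^2 *\<^sub>R c + s^3 *\<^sub>R (d + e s)))"

text \<open>With a convergent function in the place of the cubic coefficient, the closure rules for
  jets reduce to limit rules.\<close>

lemma jet3I:
  assumes "(e \<longlongrightarrow> d) (at 0)" "\<forall>\<^sub>F s in at 0. f s = a + s *\<^sub>R b + s^2 *\<^sub>R c + s^3 *\<^sub>R e s"
  shows "jet3 f a b c d"
  unfolding jet3_def
  by (rule exI[of _ "\<lambda>s. e s - d"]) (use assms tendsto_diff[OF assms(1) tendsto_const, of d] in auto)

lemma jet3E:
  assumes "jet3 f a b c d"
  obtains e where "(e \<longlongrightarrow> d) (at 0)" "\<forall>\<^sub>F s in at 0. f s = a + s *\<^sub>R b + s^2 *\<^sub>R c + s^3 *\<^sub>R e s"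
proof -
  from assms obtain e where e: "(e \<longlongrightarrow> 0) (at 0)"
    "\<forall>\<^sub>F s in at 0. f s = a + s *\<^sub>R b + s^2 *\<^sub>R c + s^3 *\<^sub>R (d + e s)" unfolding jet3_def by blast
  then show ?thesis using tendsto_add[OF tendsto_const e(1), of d] by (intro that[of "\<lambda>s. d + e s"]) auto
qed

lemma jet3_poly: "jet3 (\<lambda>s. a + s *\<^sub>R b + s^2 *\<^sub>R c + s^3 *\<^sub>R d) a b c d"
  by (rule jet3I[of "\<lambda>_. d"]) auto

lemma jet3_cong:
  assumes "jet3 f a b c d" "\<forall>\<^sub>F s in at 0. f s = g s"
  shows "jet3 g a b c d"
  using assms(1)
proof (rule jet3E)
  fix e assume "(e \<longlongrightarrow> d) (at 0)" "\<forall>\<^sub>F s in at 0. f s = a + s *\<^sub>R b + s^2 *\<^sub>R c + s^3 *\<^sub>R e s"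
  with assms(2) show ?thesis by (intro jet3I[of e]) (auto elim: eventually_elim2)
qed

lemma jet3_add:
  assumes "jet3 f a b c d" "jet3 g a' b' c' d'"
  shows "jet3 (\<lambda>s. f s + g s) (a + a') (b + b') (c + c') (d + d')"
proof -
  obtain e where e: "(e \<longlongrightarrow> d) (at 0)" "\<forall>\<^sub>F s in at 0. f s = a + s *\<^sub>R b + s^2 *\<^sub>R c + s^3 *\<^sub>R e s"
    using assms(1) by (rule jet3E)
  obtain e' where e': "(e' \<longlongrightarrow> d') (at 0)" "\<forall>\<^sub>F s in at 0. g s = a' + s *\<^sub>R b' + s^2 *\<^sub>R c' + s^3 *\<^sub>R e' s"
    using assms(2) by (rule jet3E)
  show ?thesis
    by (rule jet3I[OF tendsto_add[OF e(1) e'(1)]])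
      (use e(2) e'(2) in eventually_elim, simp add: algebra_simps)
qed

lemma jet3_linear:
  assumes "bounded_linear T" "jet3 f a b c d"
  shows "jet3 (\<lambda>s. T (f s)) (T a) (T b) (T c) (T d)"
proof -
  interpret bounded_linear T by fact
  obtain e where e: "(e \<longlongrightarrow> d) (at 0)" "\<forall>\<^sub>F s in at 0. f s = a + s *\<^sub>R b + s^2 *\<^sub>R c + s^3 *\<^sub>R e s"
    using assms(2) by (rule jet3E)
  show ?thesis
    by (rule jet3I[OF tendsto[OF e(1)]]) (use e(2) in eventually_elim, simp add: add scaleR)
qed

lemma jet3_bilinear:
  assumes "bounded_bilinear m" "jet3 f a b c d" "jet3 g a' b' c' d'"
  shows "jet3 (\<lambda>s. m (f s) (g s)) (m a a') (m a b' + m b a') (m a c' + m b b' + m c a')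
    (m a d' + m b c' + m c b' + m d a')"
proof -
  interpret bounded_bilinear m by fact
  obtain e where e: "(e \<longlongrightarrow> d) (at 0)" "\<forall>\<^sub>F s in at 0. f s = a + s *\<^sub>R b + s^2 *\<^sub>R c + s^3 *\<^sub>R e s"
    using assms(2) by (rule jet3E)
  obtain e' where e': "(e' \<longlongrightarrow> d') (at 0)" "\<forall>\<^sub>F s in at 0. g s = a' + s *\<^sub>R b' + s^2 *\<^sub>R c' + s^3 *\<^sub>R e' s"
    using assms(3) by (rule jet3E)
  \<comment> \<open>\<open>?r\<close> collects everything of order at least three in the product,
    divided by \<open>s^3\<close>.\<close>
  let ?r = "\<lambda>s. m a (e' s) + m b c' + m c b' + m (e s) a'
      + s *\<^sub>R (m b (e' s) + m c c' + m (e s) b') + s^2 *\<^sub>R (m c (e' s) + m (e s) c') + s^3 *\<^sub>R m (e s) (e' s)"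
  have "(?r \<longlongrightarrow> m a d' + m b c' + m c b' + m d a'
      + 0 *\<^sub>R (m b d' + m c c' + m d b') + 0^2 *\<^sub>R (m c d' + m d c') + 0^3 *\<^sub>R m d d') (at 0)"
    by (intro tendsto_intros tendsto e(1) e'(1))
  then have "(?r \<longlongrightarrow> m a d' + m b c' + m c b' + m d a') (at 0)" by simp
  then show ?thesis
  proof (rule jet3I)
    show "\<forall>\<^sub>F s in at 0. m (f s) (g s) = m a a' + s *\<^sub>R (m a b' + m b a')
        + s^2 *\<^sub>R (m a c' + m b b' + m c a') + s^3 *\<^sub>R ?r s"
      using e(2) e'(2)
      by eventually_elim (simp add: add_left add_right scaleR_left scaleR_right scaleR_add_right
          power2_eq_square power3_eq_cube mult.assoc add_ac)
  qed
qed

lemma tendsto_of_ev_poly_zero: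
  assumes "(e \<longlongrightarrow> (d :: 'a::real_normed_vector)) (at (0::real))" "\<forall>\<^sub>F s in at 0. e s = 0"
  shows "d = 0"
proof -
  have "(e \<longlongrightarrow> 0) (at 0)" by (rule tendsto_eventually[OF assms(2)])
  then show ?thesis using assms(1) tendsto_unique by (metis trivial_limit_at)
qed

text \<open>The coefficients are peeled off one at a time: the limit at 0 shows that the lowest one
  vanishes, and division by the nonzero \<open>s\<close> exposes the next.\<close>

lemma jet3_zero:
  assumes "jet3 (\<lambda>_. 0 :: 'a::real_normed_vector) a b c d"
  shows "a = 0" "b = 0" "c = 0" "d = 0"
proof -
  obtain e where e: "(e \<longlongrightarrow> d) (at 0)" "\<forall>\<^sub>F s in at 0. 0 = a + s *\<^sub>R b + s^2 *\<^sub>R c + s^3 *\<^sub>R e s"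
    using assms by (rule jet3E)
  have ne: "\<forall>\<^sub>F s in at 0. s \<noteq> (0::real)" by (simp add: eventually_at_filter)
  have t: "((\<lambda>s. a + s *\<^sub>R b + s^2 *\<^sub>R c + s^3 *\<^sub>R e s) \<longlongrightarrow> a + 0 *\<^sub>R b + 0^2 *\<^sub>R c + 0^3 *\<^sub>R d) (at 0)" for a b c
    by (intro tendsto_intros e(1))
  show a: "a = 0" using tendsto_of_ev_poly_zero[OF t[of a b c]] e(2) by (simp add: eq_commute[of 0])
  have 2: "\<forall>\<^sub>F s in at 0. b + s *\<^sub>R c + s^2 *\<^sub>R e s = 0"
    using e(2) ne
  proof eventually_elim
    fix s :: real assume "0 = a + s *\<^sub>R b + s^2 *\<^sub>R c + s^3 *\<^sub>R e s" "s \<noteq> 0"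
    then have "s *\<^sub>R (b + s *\<^sub>R c + s^2 *\<^sub>R e s) = 0"
      using a by (simp add: scaleR_add_right power2_eq_square power3_eq_cube mult.assoc)
    with \<open>s \<noteq> 0\<close> show "b + s *\<^sub>R c + s^2 *\<^sub>R e s = 0" by simp
  qed
  have "((\<lambda>s. b + s *\<^sub>R c + s^2 *\<^sub>R e s) \<longlongrightarrow> b + 0 *\<^sub>R c + 0^2 *\<^sub>R d) (at 0)"
    by (intro tendsto_intros e(1))
  from tendsto_of_ev_poly_zero[OF this 2] show b: "b = 0" by simp
  have 3: "\<forall>\<^sub>F s in at 0. c + s *\<^sub>R e s = 0"
    using 2 ne
  proof eventually_elim
    fix s :: real assume "b + s *\<^sub>R c + s^2 *\<^sub>R e s = 0" "s \<noteq> 0"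
    then have "s *\<^sub>R (c + s *\<^sub>R e s) = 0"
      using b by (simp add: scaleR_add_right power2_eq_square)
    with \<open>s \<noteq> 0\<close> show "c + s *\<^sub>R e s = 0" by simp
  qed
  have "((\<lambda>s. c + s *\<^sub>R e s) \<longlongrightarrow> c + 0 *\<^sub>R d) (at 0)"
    by (intro tendsto_intros e(1))
  from tendsto_of_ev_poly_zero[OF this 3] show c: "c = 0" by simp
  have "\<forall>\<^sub>F s in at 0. e s = 0" using 3 ne by eventually_elim (use c in simp)
  from tendsto_of_ev_poly_zero[OF e(1) this] show "d = 0" .
qed

lemma jet3_unique:
  assumes "jet3 f a b c d" "jet3 f a' b' c' d'"
  shows "a = a'" "b = b'" "c = c'" "d = d'"
proof -
  have "jet3 (\<lambda>s. f s + - f s) (a + - a') (b + - b') (c + - c') (d + - d')"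
    by (intro jet3_add assms jet3_linear[OF bounded_linear_minus[OF bounded_linear_ident]])
  then have "jet3 (\<lambda>s. 0) (a - a') (b - b') (c - c') (d - d')" by simp
  from jet3_zero[OF this] show "a = a'" "b = b'" "c = c'" "d = d'" by auto
qed

lemma eventually_elim4:
  assumes "\<forall>\<^sub>F x in F. P x" "\<forall>\<^sub>F x in F. Q x" "\<forall>\<^sub>F x in F. R x" "\<forall>\<^sub>F x in F. S x"
    and "\<And>x. P x \<Longrightarrow> Q x \<Longrightarrow> R x \<Longrightarrow> S x \<Longrightarrow> U x"
  shows "\<forall>\<^sub>F x in F. U x"
  using assms(1-4) by eventually_elim (rule assms(5))

text \<open>Since \<open>q\<close> converges, \<open>p s\<close> is of size O(s), so a remainder of
  order o(|p|^3) is o(s^3) along the curve and leaves no trace in the jet.\<close>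

lemma jet3_smallo:
  fixes r :: "'a::real_normed_vector \<Rightarrow> 'b::real_normed_vector"
  assumes r: "(\<lambda>p. norm (r p)) \<in> o[nhds 0](\<lambda>p. norm p ^ 3)" and q: "(q \<longlongrightarrow> l) (at 0)"
    and p: "\<forall>\<^sub>F s in at 0. p s = s *\<^sub>R q s"
  shows "jet3 (\<lambda>s. r (p s)) 0 0 0 0"
proof (rule jet3I)
  have ne: "\<forall>\<^sub>F s in at 0. s \<noteq> (0::real)" by (simp add: eventually_at_filter)
  then show "\<forall>\<^sub>F s in at 0. r (p s) = 0 + s *\<^sub>R 0 + s\<^sup>2 *\<^sub>R 0 + s ^ 3 *\<^sub>R (r (p s) /\<^sub>R s ^ 3)"
    by eventually_elim simp
  have "((\<lambda>s. s *\<^sub>R q s) \<longlongrightarrow> 0 *\<^sub>R l) (at 0)" by (intro tendsto_intros q)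
  then have p0: "(p \<longlongrightarrow> 0) (at 0)"
    by (simp add: tendsto_cong[OF p])
  show "((\<lambda>s. r (p s) /\<^sub>R s ^ 3) \<longlongrightarrow> 0) (at 0)"
  proof (rule tendstoI)
    fix e :: real assume e: "e > 0"
    \<comment> \<open>\<open>K\<close> eventually bounds \<open>norm (q s) ^ 3\<close>; the factor 2
      in \<open>2 * K\<close> leaves \<open>e / 2\<close> and hence a strict inequality.\<close>
    define K where "K = (norm l + 1) ^ 3"
    have K: "K > 0" by (simp add: K_def add_nonneg_pos)
    have "\<forall>\<^sub>F x in nhds 0. norm (norm (r x)) \<le> e / (2 * K) * norm (norm x ^ 3)"
      by (rule landau_o.smallD[OF r]) (use e K in auto)
    then have "\<forall>\<^sub>F s in at 0. norm (norm (r (p s))) \<le> e / (2 * K) * norm (norm (p s) ^ 3)"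
      using p0 by (rule eventually_compose_filterlim)
    moreover have "\<forall>\<^sub>F s in at 0. norm (q s) < norm l + 1"
      using tendsto_norm[OF q] by (rule order_tendstoD) simp
    moreover note p ne
    moreover have "dist (r (p s) /\<^sub>R s ^ 3) 0 < e"
      if 1: "norm (norm (r (p s))) \<le> e / (2 * K) * norm (norm (p s) ^ 3)" and 2: "norm (q s) < norm l + 1"
        and 3: "p s = s *\<^sub>R q s" and 4: "s \<noteq> 0" for s
    proof -
      have "norm (p s) ^ 3 = \<bar>s\<bar> ^ 3 * norm (q s) ^ 3"
        unfolding 3 by (simp add: power_mult_distrib)
      then have "norm (r (p s)) \<le> e / (2 * K) * (\<bar>s\<bar> ^ 3 * norm (q s) ^ 3)"
        using 1 by simp
      also have "\<dots> \<le> e / (2 * K) * (\<bar>s\<bar> ^ 3 * K)"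
      proof -
        have "norm (q s) ^ 3 \<le> K" unfolding K_def using 2 by (intro power_mono) auto
        then show ?thesis using e K by (intro mult_left_mono) auto
      qed
      also have "\<dots> = e / 2 * \<bar>s\<bar> ^ 3" using K by simp
      finally have "norm (r (p s)) \<le> e / 2 * \<bar>s\<bar> ^ 3" .
      then have "norm (r (p s)) / \<bar>s\<bar> ^ 3 \<le> e / 2"
        using 4 by (subst pos_divide_le_eq) auto
      moreover have "dist (r (p s) /\<^sub>R s ^ 3) 0 = norm (r (p s)) / \<bar>s\<bar> ^ 3"
        by (simp add: divide_inverse power_abs mult.commute)
      ultimately show ?thesis using e by linarith
    qed
    ultimately show "\<forall>\<^sub>F s in at 0. dist (r (p s) /\<^sub>R s ^ 3) 0 < e"
      by (rule eventually_elim4)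
  qed
qed

text \<open>Taylor's polynomial of \<open>f\<close> is evaluated on the jet of \<open>p\<close>. At
  order three the quadratic term meets the pair \<open>w1\<close>, \<open>w2\<close> in both orders,
  which cancels its factor 1/2.\<close>

lemma jet3_compose:
  fixes f :: "'a::euclidean_space \<Rightarrow> 'b::real_normed_vector"
  assumes S: "open S" "x \<in> S" and f: "C_k_on 3 f S" and p: "jet3 p 0 w1 w2 w3"
  shows "jet3 (\<lambda>s. f (x + p s)) (f x) (dirderiv f w1 x) (dirderiv f w2 x + (1/2) *\<^sub>R D2 f x w1 w1)
    (dirderiv f w3 x + D2 f x w1 w2 + (1/6) *\<^sub>R D3 f x w1 w1 w1)"
proof -
  have f2: "C_k_on 2 f S" using f by (rule C_k_on_mono) simp
  have bl: "bounded_bilinear (D2 f x)"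
    using bilinear_D2[OF f2 S] by (simp add: bilinear_conv_bounded_bilinear)
  have sym: "D2 f x w2 w1 = D2 f x w1 w2" by (rule D2_commute[OF S f2])
  obtain e where e: "(e \<longlongrightarrow> w3) (at 0)" "\<forall>\<^sub>F s in at 0. p s = 0 + s *\<^sub>R w1 + s^2 *\<^sub>R w2 + s^3 *\<^sub>R e s"
    using p by (rule jet3E)
  define q where "q s = w1 + s *\<^sub>R w2 + s^2 *\<^sub>R e s" for s
  have pq: "\<forall>\<^sub>F s in at 0. p s = s *\<^sub>R q s"
    using e(2) by eventually_elim (simp add: q_def scaleR_add_right power2_eq_square power3_eq_cube mult.assoc)
  have "(q \<longlongrightarrow> w1 + 0 *\<^sub>R w2 + 0^2 *\<^sub>R w3) (at 0)"
    unfolding q_def by (intro tendsto_intros e(1))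
  then have q: "(q \<longlongrightarrow> w1) (at 0)" by simp
  let ?t = "D3 f x"
  note tl = trilinear_D3[OF S f]
  have "isCont (\<lambda>p. ?t p p p) w1"
    using has_derivative_trilinear_diag[OF tl] has_derivative_continuous by blast
  then have "((\<lambda>s. ?t (q s) (q s) (q s)) \<longlongrightarrow> ?t w1 w1 w1) (at 0)"
    using q isCont_tendsto_compose by fastforce
  then have j3: "jet3 (\<lambda>s. ?t (p s) (p s) (p s)) 0 0 0 (?t w1 w1 w1)"
  proof (rule jet3I)
    show "\<forall>\<^sub>F s in at 0. ?t (p s) (p s) (p s) = 0 + s *\<^sub>R 0 + s\<^sup>2 *\<^sub>R 0 + s ^ 3 *\<^sub>R ?t (q s) (q s) (q s)"
      using pq
      by eventually_elim
        (simp add: linear_scale[OF tl(2)] bilinear_rmul[OF tl(1)] bilinear_lmul[OF tl(1)] power3_eq_cube)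
  qed
  let ?r = "\<lambda>p. f (x + p) - f x - dirderiv f p x - (1/2) *\<^sub>R D2 f x p p - (1/6) *\<^sub>R ?t p p p"
  have fx: "f differentiable (at x)" using C_k_on_differentiable[OF f] S by simp
  have const: "jet3 (\<lambda>_. f x) (f x) 0 0 0" using jet3_poly[of "f x" 0 0 0] by simp
  have "jet3 (\<lambda>s. f x + dirderiv f (p s) x + (1/2) *\<^sub>R D2 f x (p s) (p s)
        + (1/6) *\<^sub>R ?t (p s) (p s) (p s) + ?r (p s))
      (f x + dirderiv f 0 x + (1/2) *\<^sub>R D2 f x 0 0 + (1/6) *\<^sub>R 0 + 0)
      (0 + dirderiv f w1 x + (1/2) *\<^sub>R (D2 f x 0 w1 + D2 f x w1 0) + (1/6) *\<^sub>R 0 + 0)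
      (0 + dirderiv f w2 x + (1/2) *\<^sub>R (D2 f x 0 w2 + D2 f x w1 w1 + D2 f x w2 0) + (1/6) *\<^sub>R 0 + 0)
      (0 + dirderiv f w3 x + (1/2) *\<^sub>R (D2 f x 0 w3 + D2 f x w1 w2 + D2 f x w2 w1 + D2 f x w3 0)
         + (1/6) *\<^sub>R ?t w1 w1 w1 + 0)"
    by (rule jet3_add[OF jet3_add[OF jet3_add[OF jet3_add[OF const
        jet3_linear[OF bounded_linear_dirderiv[OF fx] p]]
        jet3_linear[OF bounded_linear_scaleR_right jet3_bilinear[OF bl p p]]]
        jet3_linear[OF bounded_linear_scaleR_right j3]] jet3_smallo[OF taylor_3[OF S f] q pq]])
  moreover have "dirderiv f 0 x = 0"
    by (rule linear_0[OF linear_dirderiv[OF C_k_on_differentiable[OF f]]]) (use S in auto)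
  ultimately show ?thesis
    by (simp add: bounded_bilinear.zero_left[OF bl] bounded_bilinear.zero_right[OF bl] sym flip: scaleR_2)
qed

lemma jet3_ray:
  fixes f :: "'a::euclidean_space \<Rightarrow> 'b::real_normed_vector"
  assumes S: "open S" "x \<in> S" and f: "C_k_on 3 f S"
  shows "jet3 (\<lambda>s. f (x + s *\<^sub>R c)) (f x) (dirderiv f c x) ((1/2) *\<^sub>R D2 f x c c) ((1/6) *\<^sub>R D3 f x c c c)"
proof -
  have f2: "C_k_on 2 f S" using f by (rule C_k_on_mono) simp
  have "jet3 (\<lambda>s. s *\<^sub>R c) 0 c 0 0" using jet3_poly[of 0 c 0 0] by simp
  from jet3_compose[OF S f this] show ?thesis
    using linear_0[OF linear_dirderiv[OF C_k_on_differentiable[OF f]]] S bilinear_rzero[OF bilinear_D2[OF f2 S]]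
    by simp
qed

lemma power4_smallo_power3: "(\<lambda>x. norm x ^ 4) \<in> o[nhds 0](\<lambda>x::'a::real_normed_vector. norm x ^ 3)"
proof (rule landau_o.smallI)
  fix c :: real assume "c > 0"
  then show "\<forall>\<^sub>F x::'a in nhds 0. norm (norm x ^ 4) \<le> c * norm (norm x ^ 3)"
    unfolding eventually_nhds_metric
    by (intro exI[of _ c]) (auto simp: eval_nat_numeral intro!: mult_right_mono)
qed

lemma jet3_bigo_4:
  fixes r :: "'a::real_normed_vector \<Rightarrow> 'b::real_normed_vector"
  assumes "(\<lambda>p. norm (r p)) \<in> O[nhds 0](\<lambda>p. norm p ^ 4)"
  shows "jet3 (\<lambda>s. r (s *\<^sub>R c)) 0 0 0 0"
  by (rule jet3_smallo[OF landau_o.big_small_trans[OF assms power4_smallo_power3], of "\<lambda>_. c" c]) auto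

section \<open>Local solutions of Lipschitz differential equations\<close>

text \<open>Picard's map is a contraction of the bounded continuous functions, with factor
  \<open>L * d < 1/2\<close>; the bound \<open>M\<close> on the field keeps its values bounded. The
  initial time is the midpoint \<open>d\<close> of \<open>{0..2 * d}\<close>, so the solution
  extends to both sides of it.\<close>

lemma lipschitz_bounded_ode_solution:
  fixes f :: "'a::euclidean_space \<Rightarrow> 'a"
  assumes L: "L-lipschitz_on UNIV f" and M: "\<And>x. norm (f x) \<le> M"
    and d: "d > 0" "2 * L * d < 1"
  obtains \<phi> where "\<phi> d = x0"
    and "\<And>t. t \<in> {0<..<2 * d} \<Longrightarrow> (\<phi> has_vector_derivative f (\<phi> t)) (at t)"
proof -
  \<comment> \<open>Clamping time to \<open>{0..2 * d}\<close> lets the Picard map act on functions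
    of the whole real line.\<close>
  define c where "c t = max 0 (min (2 * d) t)" for t :: real
  have c: "c t \<in> {0..2*d}" for t using d by (auto simp: c_def)
  have c_cont: "continuous_on UNIV c" unfolding c_def by (intro continuous_intros)
  have f_cont: "continuous_on S f" for S
    using lipschitz_on_continuous_on[OF L] continuous_on_subset by blast
  have L0: "0 \<le> L" using lipschitz_on_nonneg[OF L] .
  \<comment> \<open>The difference of the two integrals is the oriented integral from
    \<open>d\<close> to \<open>c t\<close>, on either side of \<open>d\<close>.\<close>
  define G :: "(real \<Rightarrow>\<^sub>C 'a) \<Rightarrow> real \<Rightarrow> 'a"
    where "G \<phi> t = x0 + (integral {0..c t} (\<lambda>s. f (\<phi> s)) - integral {0..d} (\<lambda>s. f (\<phi> s)))" for \<phi> t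
  have cont: "continuous_on S (\<lambda>s. f (apply_bcontfun \<phi> s))" for \<phi> and S :: "real set"
    by (intro continuous_on_compose2[OF f_cont] continuous_on_apply_bcontfun) auto
  have int: "(\<lambda>s. f (apply_bcontfun \<phi> s)) integrable_on {a..b}" for \<phi> and a b :: real
    by (intro integrable_continuous_real cont)
  have bnd: "norm (integral {0..t} g - integral {0..d} g) \<le> K * d"
    if "t \<in> {0..2*d}" and g: "\<And>a b. g integrable_on {a..b}" and K: "\<And>s. norm (g s) \<le> K"
    for t K and g :: "real \<Rightarrow> 'a"
  proof -
    have i: "norm (integral {a..b} g) \<le> K * d" if "a \<le> b" "b - a \<le> d" for a b
    proof -
      have "norm (integral {a..b} g) \<le> integral {a..b} (\<lambda>_. K)"
        by (rule integral_norm_bound_integral) (use g K in auto)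
      also have "\<dots> \<le> K * d"
        using that order_trans[OF norm_ge_zero K] by (simp add: mult_left_mono mult.commute)
      finally show ?thesis .
    qed
    show ?thesis
    proof (cases "t \<le> d")
      case True
      have "integral {0..t} g + integral {t..d} g = integral {0..d} g"
        using that(1) g True by (intro Henstock_Kurzweil_Integration.integral_combine) auto
      then show ?thesis using i[of t d] that(1) True
        by (metis add_diff_cancel_left' atLeastAtMost_iff diff_le_eq le_add_same_cancel1 norm_minus_commute)
    next
      case False
      have "integral {0..d} g + integral {d..t} g = integral {0..t} g"
        using that(1) g False d by (intro Henstock_Kurzweil_Integration.integral_combine) auto
      then show ?thesis using i[of d t] that(1) False
        by (metis add_diff_cancel_left' atLeastAtMost_iff diff_le_eq linorder_le_cases mult_2)
    qed
  qed
  have G_bcont: "G \<phi> \<in> bcontfun" for \<phi>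
  proof (rule bcontfun_normI)
    have "continuous_on {0..2*d} (\<lambda>t. integral {0..t} (\<lambda>s. f (\<phi> s)))"
      by (intro indefinite_integral_continuous_1 int)
    then show "continuous_on UNIV (G \<phi>)"
      unfolding G_def by (intro continuous_intros continuous_on_compose2[OF _ c_cont]) (use c in auto)
    fix t
    have "norm (integral {0..c t} (\<lambda>s. f (\<phi> s)) - integral {0..d} (\<lambda>s. f (\<phi> s))) \<le> M * d"
      using bnd[where g="\<lambda>s. f (\<phi> s)" and K=M and t="c t", OF c int M] .
    then show "norm (G \<phi> t) \<le> norm x0 + M * d"
      unfolding G_def using norm_triangle_ineq order_trans add_left_mono by blast
  qed
  define g where "g \<phi> = Bcontfun (G \<phi>)" for \<phi>
  have g: "apply_bcontfun (g \<phi>) = G \<phi>" for \<phi>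
    unfolding g_def using G_bcont by (simp add: Bcontfun_inverse)
  have contr: "dist (g \<phi>) (g \<psi>) \<le> 1/2 * dist \<phi> \<psi>" for \<phi> \<psi>
  proof (rule dist_bound)
    fix t
    let ?h = "\<lambda>s. f (\<phi> s) - f (\<psi> s)"
    have h: "norm (?h s) \<le> L * dist \<phi> \<psi>" for s
    proof -
      have "norm (?h s) \<le> L * dist (\<phi> s) (\<psi> s)"
        using lipschitz_onD[OF L, of "\<phi> s" "\<psi> s"] by (simp add: dist_norm)
      also have "\<dots> \<le> L * dist \<phi> \<psi>" using L0 dist_bounded by (intro mult_left_mono) auto
      finally show ?thesis .
    qed
    have "dist (g \<phi> t) (g \<psi> t) = norm (integral {0..c t} ?h - integral {0..d} ?h)"
      unfolding g G_def dist_norm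
      by (simp add: Henstock_Kurzweil_Integration.integral_diff int algebra_simps)
    also have "\<dots> \<le> (L * dist \<phi> \<psi>) * d"
      by (rule bnd[OF c _ h]) (intro integrable_diff int)
    also have "\<dots> = (L * d) * dist \<phi> \<psi>" by simp
    also have "\<dots> \<le> 1/2 * dist \<phi> \<psi>" using d by (intro mult_right_mono) auto
    finally show "dist (g \<phi> t) (g \<psi> t) \<le> 1/2 * dist \<phi> \<psi>" .
  qed
  obtain \<phi> where gp: "g \<phi> = \<phi>"
    using banach_fix_type[of "1/2" g] contr by auto
  have \<phi>: "\<phi> t = G \<phi> t" for t using g[of \<phi>] gp by simp
  show ?thesis
  proof (rule that)
    show "\<phi> d = x0" using d by (subst \<phi>) (simp add: G_def c_def)
    fix t assume t: "t \<in> {0<..<2*d}"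
    have "((\<lambda>u. integral {0..u} (\<lambda>s. f (\<phi> s))) has_vector_derivative f (\<phi> t)) (at t within {0..2*d})"
      by (rule integral_has_vector_derivative) (use t cont in auto)
    then have "((\<lambda>u. x0 + (integral {0..u} (\<lambda>s. f (\<phi> s)) - integral {0..d} (\<lambda>s. f (\<phi> s))))
        has_vector_derivative f (\<phi> t)) (at t within {0..2*d})"
      by (auto intro!: derivative_eq_intros)
    then have "((\<lambda>u. x0 + (integral {0..u} (\<lambda>s. f (\<phi> s)) - integral {0..d} (\<lambda>s. f (\<phi> s))))
        has_vector_derivative f (\<phi> t)) (at t)"
      using t by (simp add: at_within_Icc_at)
    then show "(\<phi> has_vector_derivative f (\<phi> t)) (at t)"
    proof (rule has_vector_derivative_transform_within_open[where S="{0<..<2*d}"])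
      fix u assume "u \<in> {0<..<2*d}"
      then have "c u = u" by (auto simp: c_def)
      then show "x0 + (integral {0..u} (\<lambda>s. f (\<phi> s)) - integral {0..d} (\<lambda>s. f (\<phi> s))) = \<phi> u"
        by (subst \<phi>) (simp add: G_def)
    qed (use t in auto)
  qed
qed

text \<open>Composing \<open>f\<close> with the nearest-point projection onto the ball, a map with
  Lipschitz constant 1, gives a globally Lipschitz and bounded field that agrees with
  \<open>f\<close> as long as the solution stays in the ball.\<close>

lemma local_ode_solution:
  fixes f :: "'a::euclidean_space \<Rightarrow> 'a"
  assumes L: "L-lipschitz_on (cball x0 r) f" and r: "r > 0"
  obtains \<phi> d where "d > 0" and "\<phi> 0 = x0"
    and "\<And>t. t \<in> {-d<..<d} \<Longrightarrow> \<phi> t \<in> cball x0 r"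
    and "\<And>t. t \<in> {-d<..<d} \<Longrightarrow> (\<phi> has_vector_derivative f (\<phi> t)) (at t)"
proof -
  define p where "p = closest_point (cball x0 r)"
  have p: "p x \<in> cball x0 r" for x
    unfolding p_def using r by (intro closest_point_in_set) auto
  have p1: "1-lipschitz_on UNIV p"
    unfolding p_def using r by (intro lipschitz_onI) (simp_all add: closest_point_lipschitz)
  have "(L * 1)-lipschitz_on UNIV (\<lambda>x. f (p x))"
    using p by (intro lipschitz_on_compose2[OF p1] lipschitz_on_subset[OF L]) auto
  then have fp: "L-lipschitz_on UNIV (\<lambda>x. f (p x))" by simp
  have "compact (f ` cball x0 r)"
    by (intro compact_continuous_image lipschitz_on_continuous_on[OF L]) auto
  then obtain M where M: "\<And>x. x \<in> cball x0 r \<Longrightarrow> norm (f x) \<le> M"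
    using compact_imp_bounded bounded_iff by (metis imageI)
  have L0: "0 \<le> L" using lipschitz_on_nonneg[OF L] .
  \<comment> \<open>This value satisfies \<open>2 * L * e < 1\<close> also for
    \<open>L = 0\<close>.\<close>
  define e where "e = 1 / (2 * L + 1)"
  have e: "e > 0" "2 * L * e < 1" using L0 by (auto simp: e_def divide_simps)
  obtain \<psi> where \<psi>: "\<psi> e = x0"
      "\<And>t. t \<in> {0<..<2 * e} \<Longrightarrow> (\<psi> has_vector_derivative f (p (\<psi> t))) (at t)"
    using lipschitz_bounded_ode_solution[OF fp _ e, of M x0] M[OF p] by blast
  have "isCont \<psi> e" using \<psi>(2)[of e] e has_vector_derivative_continuous by auto
  then obtain d0 where d0: "d0 > 0" "\<And>t. dist t e < d0 \<Longrightarrow> dist (\<psi> t) (\<psi> e) < r"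
    using r unfolding continuous_at_eps_delta by (metis dist_norm real_norm_def)
  \<comment> \<open>Within \<open>d\<close> of the initial time the solution has not left the ball,
    so the projection acts as the identity; shifting by \<open>e\<close> moves the initial time to
    0.\<close>
  define d where "d = min d0 e"
  have in_ball: "\<psi> (t + e) \<in> cball x0 r" if "t \<in> {-d<..<d}" for t
    using d0(2)[of "t+e"] that \<psi>(1) by (auto simp: d_def dist_norm norm_minus_commute less_imp_le)
  show ?thesis
  proof (rule that[of d "\<lambda>t. \<psi> (t + e)"])
    fix t assume t: "t \<in> {-d<..<d}"
    then have te: "t + e \<in> {0<..<2*e}" by (auto simp: d_def)
    have "p (\<psi> (t + e)) = \<psi> (t + e)"
      unfolding p_def using in_ball[OF t] by (rule closest_point_self)
    then have "(\<psi> has_vector_derivative f (\<psi> (t + e))) (at (t + e))"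
      using \<psi>(2)[OF te] by simp
    then have "(\<psi> \<circ> (\<lambda>t. t + e) has_vector_derivative 1 *\<^sub>R f (\<psi> (t + e))) (at t)"
      by (intro vector_diff_chain_at) (auto intro!: derivative_eq_intros)
    then show "((\<lambda>t. \<psi> (t + e)) has_vector_derivative f (\<psi> (t + e))) (at t)"
      by (simp add: o_def)
  qed (use in_ball d0 e \<psi>(1) in \<open>auto simp: d_def\<close>)
qed

section \<open>Geometric and algebraic multiplicity\<close>

lemma mat_vector_mult: "mat c *v v = c *s v" for c :: "'a::comm_ring_1"
  by (simp add: vec_eq_iff mat_def matrix_vector_mult_def if_distrib[of "\<lambda>x. x * _"] cong: if_cong)

lemma mult_axis_eq_column: "A *v axis j 1 = column j A" for A :: "'a::comm_ring_1^'n^'m"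
proof -
  have "(\<Sum>k\<in>UNIV. A $ i $ k * (if k = j then 1 else 0)) = A $ i $ j" for i
    using sum.delta[of UNIV j "\<lambda>k. A $ i $ k"] by (simp add: if_distrib[of "\<lambda>x. _ * x"] eq_commute cong: if_cong)
  then show ?thesis
  by (simp add: vec_eq_iff axis_def column_def matrix_vector_mult_def)
qed

lemma poly_det: "poly (det E) x = det (map_matrix (\<lambda>p. poly p x) E)"
  for E :: "'a::comm_ring_1 poly^'n^'n"
  by (simp add: det_def poly_sum poly_prod map_matrix_def)

lemma poly_charpoly: "poly (charpoly M) x = det (mat x - M)"
  unfolding charpoly_def poly_det
  by (rule arg_cong[of _ _ det]) (simp add: vec_eq_iff map_matrix_def mat_def)

text \<open>A real number above a bound \<open>K\<close> for the operator norm is no eigenvalue, so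
  the characteristic polynomial does not vanish there. This makes \<open>order\<close>, and with it
  \<open>alg_mult\<close>, meaningful.\<close>

lemma charpoly_nonzero:
  fixes M :: "complex^'n^'n"
  shows "charpoly M \<noteq> 0"
proof
  assume 0: "charpoly M = 0"
  have sc: "complex_of_real r *s v = r *\<^sub>R v" for r :: real and v :: "complex^'n"
    by (auto simp: vec_eq_iff scaleR_conv_of_real[where 'a=complex])
  have "linear (\<lambda>v. M *v v)"
    by (rule linearI)
      (simp_all add: matrix_vector_right_distrib vector_scalar_commute flip: sc)
  from linear_bounded_pos[OF this] obtain K where K: "K > 0" "\<And>v. norm (M *v v) \<le> K * norm v" by blast
  let ?x = "complex_of_real (K + 1)"
  have "det (mat ?x - M) = 0" using 0 by (simp flip: poly_charpoly)
  then have "\<not> invertible (mat ?x - M)" by (simp add: invertible_det_nz)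
  then have "\<not> (\<exists>B. B ** (mat ?x - M) = mat 1)"
    by (simp add: invertible_left_inverse)
  then obtain v where v: "v \<noteq> 0" "(mat ?x - M) *v v = 0"
    unfolding matrix_left_invertible_ker by blast
  have "mat ?x *v v = ?x *s v" by (rule mat_vector_mult)
  then have "M *v v = (K + 1) *\<^sub>R v"
    using v(2) sc[of "K + 1" v] by (metis matrix_vector_mult_diff_rdistrib eq_iff_diff_eq_0)
  then have "(K + 1) * norm v \<le> K * norm v" using K(2)[of v] K(1) by simp
  then show False using v(1) by (simp add: distrib_right)
qed

text \<open>Each term of the Leibniz formula takes exactly one entry from every column in
  \<open>J\<close>.\<close>

lemma det_dvd_of_columns:
  fixes E :: "'a::comm_ring_1^'n^'n"
  assumes "\<And>i j. j \<in> J \<Longrightarrow> d dvd E $ i $ j"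
  shows "d ^ card J dvd det E"
  unfolding det_def
proof (intro dvd_sum dvd_mult)
  fix p assume "p \<in> {p. p permutes (UNIV :: 'n set)}"
  then have p: "bij p" by (simp add: permutes_bij)
  have "card (p -` J) = card J" using p by (intro card_vimage_inj) (auto simp: bij_def)
  then have "d ^ card J = (\<Prod>i\<in>p -` J. d)" by simp
  also have "\<dots> dvd (\<Prod>i\<in>p -` J. E $ i $ p i)" by (intro prod_dvd_prod assms) auto
  also have "\<dots> dvd (\<Prod>i\<in>UNIV. E $ i $ p i)" by (intro prod_dvd_prod_subset) auto
  finally show "d ^ card J dvd (\<Prod>i\<in>UNIV. E $ i $ p i)" .
qed

lemma map_matrix_const_poly_mult:
  "map_matrix (\<lambda>c. [:c:]) (M ** N) = map_matrix (\<lambda>c. [:c:]) M ** map_matrix (\<lambda>c. [:c:]) N"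
  for M :: "'a::comm_ring_1^'n^'m" and N :: "'a^'k^'n"
proof -
  have "[:sum f A:] = (\<Sum>x\<in>A. [:f x:])" for f :: "'n \<Rightarrow> 'a" and A
  proof (induction A rule: infinite_finite_induct)
    case (insert x F)
    have "[:f x + sum f F:] = [:f x:] + [:sum f F:]" by simp
    with insert show ?case by simp
  qed auto
  then show ?thesis
    by (simp add: vec_eq_iff map_matrix_def matrix_matrix_mult_def mult.commute)
qed

text \<open>The scalar matrix \<open>mat [:0, 1:]\<close> commutes with every polynomial matrix, so
  conjugation by constant matrices passes through the determinant.\<close>

lemma charpoly_similar:
  fixes M P Q :: "'a::comm_ring_1^'n^'n"
  assumes "Q ** P = mat 1"
  shows "charpoly (Q ** M ** P) = charpoly M"
proof -
  have sub: "A ** (B - C) = A ** B - A ** C" "(A - B) ** C = A ** C - B ** C" for A B C :: "'a poly^'n^'n"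
    by (simp_all add: vec_eq_iff matrix_matrix_mult_def algebra_simps sum_subtractf)
  let ?l = "map_matrix (\<lambda>c. [:c:]) :: 'a^'n^'n \<Rightarrow> 'a poly^'n^'n"
  have l1: "?l (mat 1) = mat 1" by (simp add: vec_eq_iff map_matrix_def mat_def)
  have QP: "?l Q ** ?l P = mat 1" using assms l1 by (metis map_matrix_const_poly_mult)
  have X: "A ** mat [:0, 1:] = mat [:0, 1:] ** A" for A :: "'a poly^'n^'n"
  proof -
    have "(\<Sum>k\<in>UNIV. A $ i $ k * (if k = j then [:0, 1:] else 0)) = A $ i $ j * [:0, 1:]"
      "(\<Sum>k\<in>UNIV. (if i = k then [:0, 1:] else 0) * A $ k $ j) = [:0, 1:] * A $ i $ j" for i j
      by (simp_all add: if_distrib[of "\<lambda>x. _ * x"] if_distrib[of "\<lambda>x. x * _"] cong: if_cong del: mult_pCons_left mult_pCons_right)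
    then show ?thesis by (simp add: vec_eq_iff matrix_matrix_mult_def mat_def del: mult_pCons_left mult_pCons_right)
  qed
  have "?l Q ** (mat [:0, 1:] - ?l M) ** ?l P = mat [:0, 1:] ** (?l Q ** ?l P) - ?l Q ** ?l M ** ?l P"
    by (simp add: matrix_mul_assoc X sub)
  also have "\<dots> = mat [:0, 1:] - ?l (Q ** M ** P)"
    by (simp add: QP map_matrix_const_poly_mult)
  finally have "charpoly (Q ** M ** P) = det (?l Q ** (mat [:0, 1:] - ?l M) ** ?l P)"
    unfolding charpoly_def by (rule arg_cong[OF sym])
  also have "\<dots> = det (?l Q) * charpoly M * det (?l P)"
    unfolding charpoly_def by (simp only: det_mul)
  also have "\<dots> = det (?l Q ** ?l P) * charpoly M" by (simp add: det_mul)
  finally show ?thesis by (simp add: QP)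
qed

text \<open>In a basis extending \<open>B\<close>, the columns belonging to \<open>B\<close> are
  \<open>\<mu>\<close> times unit vectors; the corresponding columns of the characteristic matrix
  are divisible by the linear factor of \<open>\<mu>\<close>.\<close>

lemma eigenspace_power_dvd_charpoly:
  fixes M :: "'a::field^'n^'n"
  assumes B: "vec.independent B" "\<And>x. x \<in> B \<Longrightarrow> M *v x = \<mu> *s x"
  shows "[:-\<mu>, 1:] ^ card B dvd charpoly M"
proof -
  let ?B = "vec.extend_basis B"
  have ind: "vec.independent ?B" and sp: "vec.span ?B = UNIV" and sub: "B \<subseteq> ?B"
    using vec.independent_extend_basis[OF B(1)] vec.span_extend_basis[OF B(1)]
      vec.extend_basis_superset[OF B(1)] by auto
  have fin: "finite ?B" using ind vec.finiteI_independent by blast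
  have "card ?B = CARD('n)"
    using vec.dim_eq_card_independent[OF ind] vec.dim_span[of ?B] sp vec_dim_card[where 'a='a and 'n='n] by metis
  then obtain f :: "'n \<Rightarrow> 'a^'n" where f: "bij_betw f UNIV ?B"
    using finite_same_card_bij[of "UNIV :: 'n set" ?B] fin by auto
  define P where "P = (\<chi> i j. f j $ i)"
  have col: "column j P = f j" for j by (simp add: P_def column_def vec_eq_iff)
  have "columns P = ?B"
    using f by (auto simp: columns_def col bij_betw_def)
  then obtain Q where PQ: "P ** Q = mat 1"
    using sp matrix_right_invertible_span_columns[of P] by auto
  then have QP: "Q ** P = mat 1" by (simp add: matrix_left_right_inverse)
  define J where "J = f -` B"
  have "f ` J = B" using f sub by (auto simp: J_def bij_betw_def)
  moreover have "inj_on f J" using f by (auto simp: bij_betw_def intro: inj_on_subset)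
  ultimately have cJ: "card J = card B" using card_image by force
  have N: "(Q ** M ** P) $ i $ j = (if i = j then \<mu> else 0)" if "j \<in> J" for i j
  proof -
    have "(Q ** M ** P) *v axis j 1 = Q *v (M *v (P *v axis j 1))"
      by (simp only: matrix_vector_mul_assoc matrix_mul_assoc)
    then have "column j (Q ** M ** P) = Q *v (M *v column j P)"
      by (simp only: mult_axis_eq_column)
    also have "\<dots> = \<mu> *s (Q *v column j P)"
      using that by (simp add: col J_def B(2) vector_scalar_commute)
    also have "Q *v column j P = column j (Q ** P)"
      by (simp add: vec_eq_iff column_def matrix_matrix_mult_def matrix_vector_mult_def)
    finally have "column j (Q ** M ** P) $ i = (\<mu> *s column j (Q ** P)) $ i" by simp
    then show ?thesis by (simp add: QP column_def mat_def)
  qed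
  have "[:-\<mu>, 1:] ^ card J dvd charpoly (Q ** M ** P)"
    unfolding charpoly_def
  proof (rule det_dvd_of_columns)
    fix i j assume "j \<in> J"
    then show "[:-\<mu>, 1:] dvd (mat [:0, 1:] - map_matrix (\<lambda>c. [:c:]) (Q ** M ** P)) $ i $ j"
      by (auto simp: N map_matrix_def mat_def)
  qed
  then show ?thesis by (simp add: cJ charpoly_similar[OF QP])
qed

text \<open>It turns the LPPD condition into one-dimensional eigenspaces: for 1 the dimension is at
  most 2 and, by lack of semisimplicity, not 2; for -1 it is at most 1.\<close>

lemma geom_mult_le_alg_mult: "geom_mult M \<mu> \<le> alg_mult M \<mu>"
proof -
  obtain B where B: "B \<subseteq> eigenspace M \<mu>" "vec.independent B" "card B = geom_mult M \<mu>"
    unfolding geom_mult_def using vec.basis_exists by metis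
  have "[:-\<mu>, 1:] ^ card B dvd charpoly (complexify M)"
    using B by (intro eigenspace_power_dvd_charpoly) (auto simp: eigenspace_def)
  then show ?thesis
    using B(3) charpoly_nonzero[of "complexify M"] by (simp add: alg_mult_def order_divides)
qed

text \<open>\<open>geom_mult\<close> is a complex dimension, so the real vectors are embedded by
  \<open>cv\<close>. The factor \<open>k\<close> between them is complex at the outset; a coordinate
  \<open>j\<close> where \<open>f\<close> does not vanish shows that it is real.\<close>

lemma eigenvector_unique_if_geom_mult_le_1:
  fixes M :: "real^'n^'n"
  assumes 1: "geom_mult M (of_real \<mu>) \<le> 1"
    and f: "M *v f = \<mu> *\<^sub>R f" "f \<noteq> 0" and g: "M *v g = \<mu> *\<^sub>R g"
  obtains c where "g = c *\<^sub>R f"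
proof -
  define cv where "cv x = (\<chi> i. complex_of_real (x $ i))" for x :: "real^'n"
  have cv: "cv x \<in> eigenspace M (of_real \<mu>)" if "M *v x = \<mu> *\<^sub>R x" for x
  proof -
    have "complexify M *v cv x = cv (M *v x)"
      by (simp add: vec_eq_iff cv_def complexify_def map_matrix_def matrix_vector_mult_def)
    then show ?thesis by (simp add: eigenspace_def that) (simp add: cv_def vec_eq_iff)
  qed
  obtain j where j: "f $ j \<noteq> 0" using f(2) by (auto simp: vec_eq_iff)
  then have f0: "cv f \<noteq> 0" by (auto simp: cv_def vec_eq_iff)
  have "cv g \<in> vec.span {cv f}"
  proof (rule ccontr)
    assume n: "cv g \<notin> vec.span {cv f}"
    then have "vec.independent {cv g, cv f}"
      using f0 by (simp add: vec.independent_insert)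
    then have "card {cv g, cv f} \<le> geom_mult M (of_real \<mu>)"
      unfolding geom_mult_def using cv f g by (intro vec.independent_card_le_dim) auto
    moreover have "cv g \<noteq> cv f" using n vec.span_base by force
    ultimately show False using 1 by simp
  qed
  then obtain k where k: "cv g = k *s cv f" by (auto simp: vec.span_singleton)
  then have k: "complex_of_real (g $ i) = k * complex_of_real (f $ i)" for i
    by (simp add: cv_def vec_eq_iff)
  define c where "c = g $ j / f $ j"
  have "k = complex_of_real c" using k[of j] j by (simp add: c_def field_simps)
  then have "complex_of_real (g $ i) = complex_of_real (c * f $ i)" for i
    using k[of i] by simp
  then have "g $ i = c * f $ i" for i by (simp only: of_real_eq_iff)
  then have "g = c *\<^sub>R f" by (simp add: vec_eq_iff)
  then show ?thesis by (rule that)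
qed

section \<open>Invariance equation and linear periodic problems\<close>

text \<open>Continuity is available only for each fixed direction; the maxima over the finitely many
  basis directions add up to a bound uniform in \<open>v\<close>.\<close>

lemma dirderiv_bounded_on_compact:
  fixes f :: "'a::euclidean_space \<Rightarrow> 'b::real_normed_vector"
  assumes f: "C_k_on (Suc 0) f S" and K: "compact K" "K \<subseteq> S"
  shows "\<exists>M\<ge>0. \<forall>x\<in>K. \<forall>v. norm (dirderiv f v x) \<le> M * norm v"
proof -
  have "\<exists>m. \<forall>x\<in>K. norm (dirderiv f b x) \<le> m" for b
  proof -
    have "continuous_on K (dirderiv f b)"
      using C_k_on_dirderiv[OF f, of b] continuous_on_subset[OF _ K(2)] by simp
    then have "bounded (dirderiv f b ` K)"
      by (intro compact_imp_bounded compact_continuous_image K(1))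
    then show ?thesis unfolding bounded_iff by auto
  qed
  then obtain m where m: "\<And>b x. x \<in> K \<Longrightarrow> norm (dirderiv f b x) \<le> m b" by metis
  show ?thesis
  proof (intro exI[of _ "\<Sum>b\<in>Basis. \<bar>m b\<bar>"] conjI ballI allI)
    fix x v assume x: "x \<in> K"
    have lin: "linear (\<lambda>v. dirderiv f v x)"
      using C_k_on_differentiable[OF f] x K by (intro linear_dirderiv) auto
    have "dirderiv f v x = (\<Sum>b\<in>Basis. (v \<bullet> b) *\<^sub>R dirderiv f b x)"
      using linear_sum[OF lin, of "\<lambda>b. (v \<bullet> b) *\<^sub>R b" Basis]
      by (simp add: euclidean_representation linear_scale[OF lin])
    also have "norm \<dots> \<le> (\<Sum>b\<in>Basis. norm v * \<bar>m b\<bar>)"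
    proof (rule sum_norm_le)
      fix b :: 'a assume "b \<in> Basis"
      then show "norm ((v \<bullet> b) *\<^sub>R dirderiv f b x) \<le> norm v * \<bar>m b\<bar>"
        unfolding norm_scaleR using m[OF x, of b] by (intro mult_mono Basis_le_norm) auto
    qed
    finally show "norm (dirderiv f v x) \<le> (\<Sum>b\<in>Basis. \<bar>m b\<bar>) * norm v"
      by (simp add: sum_distrib_left mult.commute)
  qed (simp add: sum_nonneg)
qed

lemma C_k_on_1_lipschitz_cball:
  fixes f :: "'a::euclidean_space \<Rightarrow> 'b::real_normed_vector"
  assumes f: "C_k_on (Suc 0) f S" and S: "cball x r \<subseteq> S"
  shows "\<exists>L. L-lipschitz_on (cball x r) f"
proof -
  have "\<exists>M\<ge>0. \<forall>y\<in>cball x r. \<forall>v. norm (dirderiv f v y) \<le> M * norm v"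
    by (rule dirderiv_bounded_on_compact[OF f compact_cball S])
  then obtain M where M: "M \<ge> 0" "\<forall>y\<in>cball x r. \<forall>v. norm (dirderiv f v y) \<le> M * norm v"
    by (elim exE conjE) (rule that)
  have "M-lipschitz_on (cball x r) f"
  proof (rule bounded_derivative_imp_lipschitz)
    fix y assume y: "y \<in> cball x r"
    show "(f has_derivative (\<lambda>v. dirderiv f v y)) (at y within cball x r)"
      by (rule has_derivative_at_withinI[OF has_derivative_dirderiv[OF
          C_k_on_differentiable[OF f zero_less_Suc subsetD[OF S y]]]])
    show "onorm (\<lambda>v. dirderiv f v y) \<le> M"
      by (rule onorm_le) (rule M(2)[rule_format, OF y])
  qed (rule convex_cball, rule M(1))
  then show ?thesis by (rule exI)
qed

text \<open>The constants are hidden by existential quantifiers so that the Lipschitz property of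
  the polynomial right-hand sides can be assembled from introduction rules alone.\<close>

lemma ex_lipschitz_add:
  fixes f g :: "'a::metric_space \<Rightarrow> 'b::real_normed_vector"
  assumes "\<exists>L. L-lipschitz_on X f" "\<exists>L. L-lipschitz_on X g"
  shows "\<exists>L. L-lipschitz_on X (\<lambda>x. f x + g x)"
  using assms by (elim exE) (rule exI, rule lipschitz_on_add)

lemma ex_lipschitz_diff:
  fixes f g :: "'a::metric_space \<Rightarrow> 'b::real_normed_vector"
  assumes "\<exists>L. L-lipschitz_on X f" "\<exists>L. L-lipschitz_on X g"
  shows "\<exists>L. L-lipschitz_on X (\<lambda>x. f x - g x)"
  using assms by (elim exE) (rule exI, rule lipschitz_on_diff)

lemma ex_lipschitz_Pair:
  assumes "\<exists>L. L-lipschitz_on X f" "\<exists>L. L-lipschitz_on X g"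
  shows "\<exists>L. L-lipschitz_on X (\<lambda>x. (f x, g x))"
  using assms by (elim exE) (rule exI, rule lipschitz_on_Pair)

lemma ex_lipschitz_const: "\<exists>L. L-lipschitz_on X (\<lambda>x. c)"
  by (rule exI, rule lipschitz_on_constant)

lemma ex_lipschitz_bounded_linear: "bounded_linear f \<Longrightarrow> \<exists>L. L-lipschitz_on X f"
  by (erule bounded_linear.lipschitz_boundE[of f X]) (rule exI)

text \<open>The product estimate needs bounds for both factors, which continuity on a compact set
  supplies.\<close>

lemma ex_lipschitz_mult:
  fixes f g :: "'a::metric_space \<Rightarrow> real"
  assumes X: "compact X" and "\<exists>L. L-lipschitz_on X f" "\<exists>L. L-lipschitz_on X g"
  shows "\<exists>L. L-lipschitz_on X (\<lambda>x. f x * g x)"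
proof -
  obtain L M where L: "L-lipschitz_on X f" and M: "M-lipschitz_on X g" using assms by blast
  have bnd: "\<exists>b\<ge>0. \<forall>x\<in>X. \<bar>f x\<bar> \<le> b" if "continuous_on X f" for f :: "'a \<Rightarrow> real"
  proof -
    have "bounded (f ` X)" by (intro compact_imp_bounded compact_continuous_image X that)
    then obtain b where "\<forall>x\<in>X. norm (f x) \<le> b" unfolding bounded_iff by auto
    then show ?thesis by (intro exI[of _ "\<bar>b\<bar>"]) force
  qed
  obtain a b where a: "a \<ge> 0" "\<And>x. x \<in> X \<Longrightarrow> \<bar>f x\<bar> \<le> a" and b: "b \<ge> 0" "\<And>x. x \<in> X \<Longrightarrow> \<bar>g x\<bar> \<le> b"
    using bnd[OF lipschitz_on_continuous_on[OF L]] bnd[OF lipschitz_on_continuous_on[OF M]] by blast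
  have "(a * M + b * L)-lipschitz_on X (\<lambda>x. f x * g x)"
  proof (rule lipschitz_onI)
    fix x y assume xy: "x \<in> X" "y \<in> X"
    have "dist (f x * g x) (f y * g y) = \<bar>f x * (g x - g y) + g y * (f x - f y)\<bar>"
      by (simp add: dist_norm algebra_simps)
    also have "\<dots> \<le> \<bar>f x\<bar> * dist (g x) (g y) + \<bar>g y\<bar> * dist (f x) (f y)"
      by (simp add: dist_norm flip: abs_mult)
    also have "\<dots> \<le> a * (M * dist x y) + b * (L * dist x y)"
      using xy a b lipschitz_onD[OF L xy] lipschitz_onD[OF M xy]
      by (intro add_mono mult_mono) auto
    finally show "dist (f x * g x) (f y * g y) \<le> (a * M + b * L) * dist x y"
      by (simp add: algebra_simps)
  qed (use a b lipschitz_on_nonneg[OF L] lipschitz_on_nonneg[OF M] in auto)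
  then show ?thesis by blast
qed

text \<open>The invariance equation holds at every single point because a solution of the restricted system
  passes through it.\<close>

lemma invariance_equation:
  fixes V :: "'a::euclidean_space \<Rightarrow> 'a" and u :: "'a \<Rightarrow> 'b::real_normed_vector"
  assumes u: "(u has_derivative u') (at x0)" and V: "L-lipschitz_on (cball x0 r) V" "r > 0"
    and sol: "\<And>\<phi> d. (\<And>t. t \<in> {-d<..<d} \<Longrightarrow> \<phi> t \<in> cball x0 r) \<Longrightarrow>
      (\<And>t. t \<in> {-d<..<d} \<Longrightarrow> (\<phi> has_vector_derivative V (\<phi> t)) (at t)) \<Longrightarrow> d > 0 \<Longrightarrow>
      ((\<lambda>t. u (\<phi> t)) has_vector_derivative G (u (\<phi> 0))) (at 0)"
  shows "u' (V x0) = G (u x0)"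
proof -
  obtain \<phi> d where \<phi>: "d > 0" "\<phi> 0 = x0" "\<And>t. t \<in> {-d<..<d} \<Longrightarrow> \<phi> t \<in> cball x0 r"
    "\<And>t. t \<in> {-d<..<d} \<Longrightarrow> (\<phi> has_vector_derivative V (\<phi> t)) (at t)"
    using local_ode_solution[OF V, of thesis] by blast
  have "((u \<circ> \<phi>) has_vector_derivative u' (V x0)) (at 0)"
    by (rule vector_derivative_diff_chain_within)
      (use \<phi>(1,2) \<phi>(4)[of 0] u in \<open>auto intro: has_derivative_at_withinI\<close>)
  moreover have "((\<lambda>t. u (\<phi> t)) has_vector_derivative G (u x0)) (at 0)"
    using sol[OF \<phi>(3,4)] \<phi>(1,2) by simp
  ultimately show ?thesis unfolding o_def by (rule vector_derivative_unique_at)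
qed

text \<open>Gronwall's argument: the linear bound makes the squared norm of \<open>z\<close>, damped
  by \<open>exp (- (2 * M * s))\<close>, nonincreasing, and it starts at 0.\<close>

lemma ode_zero_of_linear_bound:
  fixes z :: "real \<Rightarrow> 'a::real_inner"
  assumes z: "\<And>t. t \<in> {0..T} \<Longrightarrow> (z has_vector_derivative z' t) (at t within {0..T})"
    and bound: "\<And>t. t \<in> {0..T} \<Longrightarrow> norm (z' t) \<le> M * norm (z t)" and z0: "z 0 = 0"
    and t: "t \<in> {0..T}"
  shows "z t = 0"
proof (cases "t = 0")
  case False
  then have t0: "0 < t" using t by simp
  define g where "g s = exp (- (2 * M * s)) * (z s \<bullet> z s)" for s
  have zc: "continuous_on {0..t} z"
    using continuous_on_subset[OF continuous_on_vector_derivative[OF z], of "{0..t}"] t by auto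
  have "g t \<le> g 0"
  proof (rule DERIV_nonpos_imp_decreasing_open[of 0 t g])
    fix s assume s: "0 < s" "s < t"
    have "(z has_vector_derivative z' s) (at s within {0..T})" using z s t by auto
    moreover have "at s within {0..T} = at s" using s t by (intro at_within_Icc_at) auto
    ultimately have zs: "(z has_derivative (\<lambda>h. h *\<^sub>R z' s)) (at s)"
      by (simp add: has_vector_derivative_def)
    have "(g has_derivative (\<lambda>h. exp (- (2 * M * s)) * (z s \<bullet> (h *\<^sub>R z' s) + (h *\<^sub>R z' s) \<bullet> z s)
        + (h * (- (2 * M)) * exp (- (2 * M * s))) * (z s \<bullet> z s))) (at s)"
      unfolding g_def
      by (intro has_derivative_mult has_derivative_inner zs)
        (auto intro!: derivative_eq_intros)
    then have "(g has_real_derivative exp (- (2 * M * s)) * (2 * (z s \<bullet> z' s) - 2 * M * (z s \<bullet> z s))) (at s)"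
      unfolding has_field_derivative_def
      by (rule has_derivative_eq_rhs) (auto simp: algebra_simps inner_commute)
    moreover have "z s \<bullet> z' s \<le> M * (z s \<bullet> z s)"
    proof -
      have "z s \<bullet> z' s \<le> norm (z s) * norm (z' s)" by (rule norm_cauchy_schwarz)
      also have "\<dots> \<le> norm (z s) * (M * norm (z s))" using bound[of s] s t by (intro mult_left_mono) auto
      also have "\<dots> = M * (z s \<bullet> z s)" by (simp add: dot_square_norm power2_eq_square)
      finally show ?thesis .
    qed
    ultimately show "\<exists>y. (g has_real_derivative y) (at s) \<and> y \<le> 0"
      by (intro exI conjI) (auto intro!: mult_nonneg_nonpos)
  qed (use t0 zc in \<open>auto simp: g_def intro!: continuous_intros\<close>)
  then have "exp (- (2 * M * t)) * (z t \<bullet> z t) \<le> 0" by (simp add: g_def z0)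
  then have "z t \<bullet> z t \<le> 0" by (simp add: mult_le_0_iff not_le)
  then show ?thesis by (metis inner_eq_zero_iff inner_ge_zero order_antisym)
qed (use z0 in simp)

lemma has_vector_derivative_within_Un:
  assumes "(f has_vector_derivative D) (at x within S)" "(f has_vector_derivative D) (at x within U)"
  shows "(f has_vector_derivative D) (at x within (S \<union> U))"
  using assms unfolding has_vector_derivative_def has_derivative_within by (auto intro: Lim_Un)

text \<open>The missing one-sided derivative at 0 is the one at \<open>T\<close> shifted by a
  period, and conversely. The factor \<open>\<sigma>\<close> is 1 for periodic and -1 for
  antiperiodic functions.\<close>

lemma has_vector_derivative_glue_periodic:
  fixes f :: "real \<Rightarrow> 'a::real_normed_vector" and \<sigma> :: real
  assumes T: "T > 0" and \<sigma>: "\<sigma> * \<sigma> = 1"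
    and f: "\<And>t. f (t + T) = \<sigma> *\<^sub>R f t" and r: "\<And>t. r (t + T) = \<sigma> *\<^sub>R r t"
    and d: "\<And>t. t \<in> {0..T} \<Longrightarrow> (f has_vector_derivative r t) (at t within {0..T})"
    and t: "t \<in> {0..T}"
  shows "(f has_vector_derivative r t) (at t)"
proof -
  have f': "f t = \<sigma> *\<^sub>R f (t + T)" for t using f[of t] \<sigma> by simp
  have left: "(f has_vector_derivative r 0) (at 0 within {-T..0})"
  proof -
    have "(f has_vector_derivative r T) (at (0 + T) within (\<lambda>t. t + T) ` {-T..0})" using d[of T] T by simp
    moreover have "((\<lambda>t. t + T) has_vector_derivative 1) (at 0 within {-T..0})"
      by (auto intro!: derivative_eq_intros)
    ultimately have "((f \<circ> (\<lambda>t. t + T)) has_vector_derivative 1 *\<^sub>R r T) (at 0 within {-T..0})"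
      by (rule vector_diff_chain_within[rotated])
    then have "((\<lambda>t. \<sigma> *\<^sub>R f (t + T)) has_vector_derivative \<sigma> *\<^sub>R r T) (at 0 within {-T..0})"
      by (auto simp: o_def intro!: derivative_eq_intros)
    moreover have "\<sigma> *\<^sub>R r T = r 0" using r[of 0] \<sigma> by simp
    moreover have "(\<lambda>t. \<sigma> *\<^sub>R f (t + T)) = f" by (intro ext) (rule f'[symmetric])
    ultimately show ?thesis by simp
  qed
  have right: "(f has_vector_derivative r T) (at T within {T..2*T})"
  proof -
    have "(f has_vector_derivative r 0) (at (T - T) within (\<lambda>t. t - T) ` {T..2*T})" using d[of 0] T by simp
    moreover have "((\<lambda>t. t - T) has_vector_derivative 1) (at T within {T..2*T})"
      by (auto intro!: derivative_eq_intros)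
    ultimately have "((f \<circ> (\<lambda>t. t - T)) has_vector_derivative 1 *\<^sub>R r 0) (at T within {T..2*T})"
      by (rule vector_diff_chain_within[rotated])
    then have "((\<lambda>t. \<sigma> *\<^sub>R f (t - T)) has_vector_derivative \<sigma> *\<^sub>R r 0) (at T within {T..2*T})"
      by (auto simp: o_def intro!: derivative_eq_intros)
    moreover have "\<sigma> *\<^sub>R r 0 = r T" using r[of 0] by simp
    moreover have "(\<lambda>t. \<sigma> *\<^sub>R f (t - T)) = f"
    proof
      show "\<sigma> *\<^sub>R f (t - T) = f t" for t using f[of "t - T"] by simp
    qed
    ultimately show ?thesis by simp
  qed
  consider "t = 0" | "t = T" | "0 < t" "t < T" using t by fastforce
  then show ?thesis
  proof cases
    case 1
    have "(f has_vector_derivative r 0) (at 0 within ({-T..0} \<union> {0..T}))"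
      using left d[of 0] T by (intro has_vector_derivative_within_Un) auto
    moreover have "{-T..0} \<union> {0..T} = {-T..T}" using T by auto
    ultimately show ?thesis using 1 T by (simp add: at_within_Icc_at)
  next
    case 2
    have "(f has_vector_derivative r T) (at T within ({0..T} \<union> {T..2*T}))"
      using right d[of T] T by (intro has_vector_derivative_within_Un) auto
    moreover have "{0..T} \<union> {T..2*T} = {0..2*T}" using T by auto
    ultimately show ?thesis using 2 T by (simp add: at_within_Icc_at)
  next
    case 3
    then show ?thesis using d[of t] by (simp add: at_within_Icc_at)
  qed
qed

text \<open>In the derivative of the pairing, \<open>A\<close> and its transpose cancel. The extra
  forcing \<open>\<psi>\<close> is 0 for \<open>\<phi>s\<close> and \<open>v2s\<close>, and is
  \<open>\<phi>s\<close> for \<open>v1s\<close>.\<close>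

lemma adjoint_has_integral:
  fixes A :: "real \<Rightarrow> real^'n^'n"
  assumes "0 \<le> T"
    and \<phi>: "\<And>t. t \<in> {0..T} \<Longrightarrow> (\<phi> has_vector_derivative - (transpose (A t) *v \<phi> t) - \<psi> t) (at t within {0..T})"
    and w: "\<And>t. t \<in> {0..T} \<Longrightarrow> (w has_vector_derivative A t *v w t + g t) (at t within {0..T})"
  shows "((\<lambda>t. \<phi> t \<bullet> g t - \<psi> t \<bullet> w t) has_integral \<phi> T \<bullet> w T - \<phi> 0 \<bullet> w 0) {0..T}"
proof (rule fundamental_theorem_of_calculus[OF assms(1)])
  fix t assume t: "t \<in> {0..T}"
  have "((\<lambda>t. \<phi> t \<bullet> w t) has_vector_derivative
      \<phi> t \<bullet> (A t *v w t + g t) + (- (transpose (A t) *v \<phi> t) - \<psi> t) \<bullet> w t) (at t within {0..T})"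
    by (rule bounded_bilinear.has_vector_derivative[OF bounded_bilinear_inner \<phi>[OF t] w[OF t]])
  moreover have "(transpose (A t) *v \<phi> t) \<bullet> w t = \<phi> t \<bullet> (A t *v w t)"
    by (simp add: dot_lmul_matrix)
  ultimately show "((\<lambda>t. \<phi> t \<bullet> w t) has_vector_derivative \<phi> t \<bullet> g t - \<psi> t \<bullet> w t) (at t within {0..T})"
    by (simp add: inner_add_right inner_diff_left)
qed

lemma jacobian_mult_eq_dirderiv:
  fixes F :: "real^'n \<Rightarrow> real^'m"
  assumes "F differentiable (at x)"
  shows "jacobian F (at x) *v w = dirderiv F w x"
  using dirderiv_unique assms unfolding jacobian_works by metis

section \<open>Taylor coefficients of the parametrization\<close>

text \<open>\<open>hom2\<close> and \<open>hom3\<close> are the homogeneous parts of the expansion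
  of \<open>H\<close> with the factorials included: precisely the coefficients of \<open>s^2\<close>
  and \<open>s^3\<close> on the ray through \<open>c\<close>.\<close>

definition hom2 :: "(nat \<Rightarrow> nat \<Rightarrow> 'a::real_vector) \<Rightarrow> real \<times> real \<Rightarrow> 'a" where
  "hom2 h c = (fst c ^ 2 / 2) *\<^sub>R h 2 0 + (fst c * snd c) *\<^sub>R h 1 1 + (snd c ^ 2 / 2) *\<^sub>R h 0 2"

definition hom3 :: "(nat \<Rightarrow> nat \<Rightarrow> 'a::real_vector) \<Rightarrow> real \<times> real \<Rightarrow> 'a" where
  "hom3 h c = (fst c ^ 3 / 6) *\<^sub>R h 3 0 + (fst c ^ 2 * snd c / 2) *\<^sub>R h 2 1
     + (fst c * snd c ^ 2 / 2) *\<^sub>R h 1 2 + (snd c ^ 3 / 6) *\<^sub>R h 0 3"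

lemma exponents_2_3:
  "{(i::nat, j::nat). 2 \<le> i + j \<and> i + j \<le> 3} = {(2,0), (1,1), (0,2), (3,0), (2,1), (1,2), (0,3)}"
proof -
  have "(i, j) \<in> {(2,0), (1,1), (0,2), (3,0), (2,1), (1,2), (0,3)}"
    if "2 \<le> i + j" "i + j \<le> 3" for i j :: nat
  proof -
    from that have "i = 0 \<or> i = 1 \<or> i = 2 \<or> i = 3" by linarith
    moreover from that have "j = 0 \<or> j = 1 \<or> j = 2 \<or> j = 3" by linarith
    ultimately show ?thesis using that by auto
  qed
  then show ?thesis by auto
qed

lemma sum_exponents_2_3:
  "(\<Sum>(i, j)\<in>{(i, j). 2 \<le> i + j \<and> i + j \<le> 3}. (1 / (fact i * fact j) * fst c ^ i * snd c ^ j) *\<^sub>R h i j)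
    = hom2 h c + hom3 h c"
  unfolding exponents_2_3 by (simp add: hom2_def hom3_def fact_numeral algebra_simps)

lemma hom2_scale: "hom2 h (s *\<^sub>R c) = s^2 *\<^sub>R hom2 h c"
  by (simp add: hom2_def scaleR_add_right power2_eq_square mult_ac)

lemma hom3_scale: "hom3 h (s *\<^sub>R c) = s^3 *\<^sub>R hom3 h c"
  by (simp add: hom3_def scaleR_add_right power2_eq_square power3_eq_cube mult_ac)

text \<open>Pulling \<open>e\<close> outermost serves to show that expanding the time derivative of
  \<open>H\<close> in space is the same as differentiating the spatial coefficients of
  \<open>H\<close> in time.\<close>

lemma D2_dirderiv_commute:
  assumes S: "open S" "x \<in> S" and f: "C_k_on 3 f S"
  shows "D2 (dirderiv f e) x c c = dirderiv (dirderiv (dirderiv f c) c) e x"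
proof -
  have f2: "C_k_on 2 f S" using f by (rule C_k_on_mono) simp
  have "D2 (dirderiv f e) x c c = dirderiv (dirderiv (dirderiv f c) e) c x"
    unfolding D2_eq by (intro dirderiv_cong[OF S] dirderiv_commute[OF S(1) _ f2])
  also have "\<dots> = dirderiv (dirderiv (dirderiv f c) c) e x"
    by (rule dirderiv_commute[OF S C_k_on_dirderiv_2[OF f]])
  finally show ?thesis .
qed

lemma C_k_on_dirderiv_3: "C_k_on 4 f S \<Longrightarrow> C_k_on 3 (dirderiv f p) S"
  using C_k_on_dirderiv[of 3 f S p] by (simp add: eval_nat_numeral del: C_k_on.simps)

lemma D3_dirderiv_commute:
  assumes S: "open S" "x \<in> S" and f: "C_k_on 4 f S"
  shows "D3 (dirderiv f e) x c c c = dirderiv (dirderiv (dirderiv (dirderiv f c) c) c) e x"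
proof -
  have f3: "C_k_on 3 f S" using f by (rule C_k_on_mono) simp
  have "D3 (dirderiv f e) x c c c = dirderiv (dirderiv (dirderiv (dirderiv f c) c) e) c x"
    unfolding D3_eq
    by (rule dirderiv_cong[OF S]) (use D2_dirderiv_commute[OF S(1) _ f3] in \<open>simp add: D2_eq\<close>)
  also have "\<dots> = dirderiv (dirderiv (dirderiv (dirderiv f c) c) c) e x"
    by (rule dirderiv_commute[OF S C_k_on_dirderiv_2[OF C_k_on_dirderiv_3[OF f]]])
  finally show ?thesis .
qed

lemma has_vector_derivative_along_fst:
  assumes "f differentiable (at (t, x))"
  shows "((\<lambda>t. f (t, x)) has_vector_derivative dirderiv f (1, 0) (t, x)) (at t)"
proof -
  have "((\<lambda>t. (t, x)) has_vector_derivative (1, 0)) (at t)"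
    by (auto intro!: has_vector_derivative_Pair derivative_eq_intros)
  from vector_derivative_diff_chain_within[OF this has_derivative_at_withinI[OF has_derivative_dirderiv[OF assms]]]
  show ?thesis by (simp add: o_def)
qed

context
  fixes H :: "real \<Rightarrow> real \<times> real \<Rightarrow> 'a::real_normed_vector" and h :: "nat \<Rightarrow> nat \<Rightarrow> real \<Rightarrow> 'a" and \<epsilon> :: real
  assumes \<epsilon>: "\<epsilon> > 0"
    and smooth: "C_k_on 4 (\<lambda>(\<tau>, \<xi>). H \<tau> \<xi>) (UNIV \<times> ball 0 \<epsilon>)"
    and expansion: "\<And>\<tau>. (\<lambda>\<xi>. norm (H \<tau> \<xi> - (\<Sum>(i, j)\<in>{(i, j). 2 \<le> i + j \<and> i + j \<le> 3}.
              (1 / (fact i * fact j) * fst \<xi> ^ i * snd \<xi> ^ j) *\<^sub>R h i j \<tau>)))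
          \<in> O[nhds 0](\<lambda>\<xi>. norm \<xi> ^ 4)"
begin

lemma center_domain: "open (UNIV \<times> ball (0 :: real \<times> real) \<epsilon> :: (real \<times> real \<times> real) set)" "(\<tau>, 0) \<in> UNIV \<times> ball (0 :: real \<times> real) \<epsilon>"
  using \<epsilon> by (auto intro: open_Times)

lemma smooth': "C_k_on 3 (case_prod H) (UNIV \<times> ball 0 \<epsilon>)" "C_k_on 2 (case_prod H) (UNIV \<times> ball 0 \<epsilon>)"
  using smooth by (auto intro: C_k_on_mono simp del: C_k_on.simps)

lemma differentiable_dirderivs:
  "(case_prod H) differentiable (at (\<tau>, 0))" "dirderiv (case_prod H) p differentiable (at (\<tau>, 0))"
  "dirderiv (dirderiv (case_prod H) p) q differentiable (at (\<tau>, 0))"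
  "dirderiv (dirderiv (dirderiv (case_prod H) p) q) r differentiable (at (\<tau>, 0))"
proof -
  have 4: "C_k_on (Suc (Suc (Suc (Suc 0)))) (case_prod H) (UNIV \<times> ball 0 \<epsilon>)" using smooth by (simp add: eval_nat_numeral del: C_k_on.simps)
  note 3 = C_k_on_dirderiv[OF 4] note 2 = C_k_on_dirderiv[OF 3] note 1 = C_k_on_dirderiv[OF 2]
  show "(case_prod H) differentiable (at (\<tau>, 0))" by (rule C_k_on_differentiable[OF 4 _ center_domain(2)]) simp
  show "dirderiv (case_prod H) p differentiable (at (\<tau>, 0))" by (rule C_k_on_differentiable[OF 3 _ center_domain(2)]) simp
  show "dirderiv (dirderiv (case_prod H) p) q differentiable (at (\<tau>, 0))"
    by (rule C_k_on_differentiable[OF 2 _ center_domain(2)]) simp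
  show "dirderiv (dirderiv (dirderiv (case_prod H) p) q) r differentiable (at (\<tau>, 0))"
    by (rule C_k_on_differentiable[OF 1 _ center_domain(2)]) simp
qed

lemma jet3_H: "jet3 (\<lambda>s. H \<tau> (s *\<^sub>R c)) 0 0 (hom2 (\<lambda>i j. h i j \<tau>) c) (hom3 (\<lambda>i j. h i j \<tau>) c)"
proof -
  let ?h = "\<lambda>i j. h i j \<tau>"
  have "jet3 (\<lambda>s. (H \<tau> (s *\<^sub>R c) - (hom2 ?h (s *\<^sub>R c) + hom3 ?h (s *\<^sub>R c)))
      + (0 + s *\<^sub>R 0 + s^2 *\<^sub>R hom2 ?h c + s^3 *\<^sub>R hom3 ?h c)) (0 + 0) (0 + 0) (0 + hom2 ?h c) (0 + hom3 ?h c)"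
    by (intro jet3_add[OF jet3_bigo_4[OF expansion[of \<tau>, unfolded sum_exponents_2_3]] jet3_poly])
  then show ?thesis by (simp add: hom2_scale hom3_scale)
qed

text \<open>At fixed \<open>\<tau>\<close> the ray has two jets, one from Taylor's formula and one
  from the assumed expansion. Uniqueness ties the coefficients \<open>h i j\<close>, about whose
  dependence on \<open>\<tau>\<close> nothing is assumed, to derivatives of the smooth function
  \<open>H\<close>.\<close>

lemma Taylor_coefficients:
  "H \<tau> 0 = 0" "dirderiv (case_prod H) (0, c) (\<tau>, 0) = 0"
  "(1/2) *\<^sub>R D2 (case_prod H) (\<tau>, 0) (0, c) (0, c) = hom2 (\<lambda>i j. h i j \<tau>) c"
  "(1/6) *\<^sub>R D3 (case_prod H) (\<tau>, 0) (0, c) (0, c) (0, c) = hom3 (\<lambda>i j. h i j \<tau>) c"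
  using jet3_unique[OF jet3_ray[OF center_domain smooth'(1), of \<tau> "(0, c)", simplified] jet3_H[of \<tau> c]] by auto

text \<open>Being a second spatial derivative of \<open>H\<close> on the line
  \<open>\<xi> = 0\<close>, the quadratic coefficient inherits a time derivative, and symmetry moves
  this derivative inside.\<close>

lemma hom2_has_vector_derivative:
  "((\<lambda>\<tau>. hom2 (\<lambda>i j. h i j \<tau>) c) has_vector_derivative
      (1/2) *\<^sub>R D2 (dirderiv (case_prod H) (1, 0)) (\<tau>, 0) (0, c) (0, c)) (at \<tau>)"
  unfolding D2_dirderiv_commute[OF center_domain smooth'(1)]
  unfolding Taylor_coefficients(3)[symmetric] D2_eq
  by (intro bounded_linear.has_vector_derivative[OF bounded_linear_scaleR_right]
      has_vector_derivative_along_fst differentiable_dirderivs)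

lemma hom3_has_vector_derivative:
  "((\<lambda>\<tau>. hom3 (\<lambda>i j. h i j \<tau>) c) has_vector_derivative
      (1/6) *\<^sub>R D3 (dirderiv (case_prod H) (1, 0)) (\<tau>, 0) (0, c) (0, c) (0, c)) (at \<tau>)"
  unfolding D3_dirderiv_commute[OF center_domain smooth]
  unfolding Taylor_coefficients(4)[symmetric] D3_eq
  by (intro bounded_linear.has_vector_derivative[OF bounded_linear_scaleR_right]
      has_vector_derivative_along_fst differentiable_dirderivs)

text \<open>Polarization: each \<open>h i j\<close> is a fixed linear combination of values of
  \<open>hom2\<close> or \<open>hom3\<close> at \<open>(1, 0)\<close>, \<open>(0, 1)\<close>,
  \<open>(1, 1)\<close> and \<open>(1, -1)\<close>.\<close>

lemma coefficient_differentiable: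
  assumes "(i, j) \<in> {(2,0), (1,1), (0,2), (3,0), (2,1), (1,2), (0,3)}"
  shows "h i j differentiable (at \<tau>)"
proof -
  have d2: "(\<lambda>\<tau>. hom2 (\<lambda>i j. h i j \<tau>) c) differentiable (at \<tau>)" for c
    using hom2_has_vector_derivative by (rule differentiableI_vector)
  have d3: "(\<lambda>\<tau>. hom3 (\<lambda>i j. h i j \<tau>) c) differentiable (at \<tau>)" for c
    using hom3_has_vector_derivative by (rule differentiableI_vector)
  have e2: "h 2 0 = (\<lambda>\<tau>. 2 *\<^sub>R hom2 (\<lambda>i j. h i j \<tau>) (1, 0))"
    "h 0 2 = (\<lambda>\<tau>. 2 *\<^sub>R hom2 (\<lambda>i j. h i j \<tau>) (0, 1))"
    "h 1 1 = (\<lambda>\<tau>. hom2 (\<lambda>i j. h i j \<tau>) (1, 1) - hom2 (\<lambda>i j. h i j \<tau>) (1, 0) - hom2 (\<lambda>i j. h i j \<tau>) (0, 1))"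
    by (auto simp: hom2_def)
  have e3: "h 3 0 = (\<lambda>\<tau>. 6 *\<^sub>R hom3 (\<lambda>i j. h i j \<tau>) (1, 0))"
    "h 0 3 = (\<lambda>\<tau>. 6 *\<^sub>R hom3 (\<lambda>i j. h i j \<tau>) (0, 1))"
    "h 2 1 = (\<lambda>\<tau>. hom3 (\<lambda>i j. h i j \<tau>) (1, 1) - hom3 (\<lambda>i j. h i j \<tau>) (1, -1) - 2 *\<^sub>R hom3 (\<lambda>i j. h i j \<tau>) (0, 1))"
    "h 1 2 = (\<lambda>\<tau>. hom3 (\<lambda>i j. h i j \<tau>) (1, 1) + hom3 (\<lambda>i j. h i j \<tau>) (1, -1) - 2 *\<^sub>R hom3 (\<lambda>i j. h i j \<tau>) (1, 0))"
    by (auto simp: hom3_def algebra_simps simp flip: scaleR_add_left)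
  have "h 2 0 differentiable (at \<tau>)" by (subst e2) (intro derivative_intros d2)
  moreover have "h 0 2 differentiable (at \<tau>)" by (subst e2) (intro derivative_intros d2)
  moreover have "h 1 1 differentiable (at \<tau>)" by (subst e2) (intro derivative_intros d2)
  moreover have "h 3 0 differentiable (at \<tau>)" by (subst e3) (intro derivative_intros d3)
  moreover have "h 0 3 differentiable (at \<tau>)" by (subst e3) (intro derivative_intros d3)
  moreover have "h 2 1 differentiable (at \<tau>)" by (subst e3) (intro derivative_intros d3)
  moreover have "h 1 2 differentiable (at \<tau>)" by (subst e3) (intro derivative_intros d3)
  ultimately show ?thesis using assms by auto
qed

lemma coefficient_has_vector_derivative:
  assumes "(i, j) \<in> {(2,0), (1,1), (0,2), (3,0), (2,1), (1,2), (0,3)}"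
  shows "(h i j has_vector_derivative vector_derivative (h i j) (at \<tau>)) (at \<tau>)"
  using coefficient_differentiable[OF assms] by (simp add: vector_derivative_works)

text \<open>This justifies termwise differentiation in time, which the Landau bound by itself does
  not. Orders zero and one vanish because \<open>H\<close> and its first spatial derivatives are
  zero on the line \<open>\<xi> = 0\<close> for every time.\<close>

lemma jet3_dirderiv_time:
  "jet3 (\<lambda>s. dirderiv (case_prod H) (1, 0) (\<tau>, s *\<^sub>R c)) 0 0
    (hom2 (\<lambda>i j. vector_derivative (h i j) (at \<tau>)) c) (hom3 (\<lambda>i j. vector_derivative (h i j) (at \<tau>)) c)"
proof -
  let ?g = "dirderiv (case_prod H) (1, 0)"
  have g: "C_k_on 3 ?g (UNIV \<times> ball 0 \<epsilon>)" using smooth by (rule C_k_on_dirderiv_3)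
  have "((\<lambda>\<tau>. hom2 (\<lambda>i j. h i j \<tau>) c) has_vector_derivative
      hom2 (\<lambda>i j. vector_derivative (h i j) (at \<tau>)) c) (at \<tau>)"
    unfolding hom2_def
    by (intro has_vector_derivative_add bounded_linear.has_vector_derivative[OF bounded_linear_scaleR_right]
        coefficient_has_vector_derivative) auto
  then have 2: "(1/2) *\<^sub>R D2 ?g (\<tau>, 0) (0, c) (0, c) = hom2 (\<lambda>i j. vector_derivative (h i j) (at \<tau>)) c"
    by (rule vector_derivative_unique_at[OF hom2_has_vector_derivative])
  have "((\<lambda>\<tau>. hom3 (\<lambda>i j. h i j \<tau>) c) has_vector_derivative
      hom3 (\<lambda>i j. vector_derivative (h i j) (at \<tau>)) c) (at \<tau>)"
    unfolding hom3_def
    by (intro has_vector_derivative_add bounded_linear.has_vector_derivative[OF bounded_linear_scaleR_right]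
        coefficient_has_vector_derivative) auto
  then have 3: "(1/6) *\<^sub>R D3 ?g (\<tau>, 0) (0, c) (0, c) (0, c) = hom3 (\<lambda>i j. vector_derivative (h i j) (at \<tau>)) c"
    by (rule vector_derivative_unique_at[OF hom3_has_vector_derivative])
  have zero: "dirderiv f (1, 0) (\<tau>, 0) = 0"
    if "f differentiable (at (\<tau>, 0))" "\<And>\<tau>. f (\<tau>, 0) = (0 :: 'a)" for f
    using has_vector_derivative_along_fst[OF that(1)] unfolding that(2)
    by (rule vector_derivative_unique_at) (rule has_vector_derivative_const)
  have 0: "?g (\<tau>, 0) = 0"
    by (rule zero[OF differentiable_dirderivs(1)]) (simp add: Taylor_coefficients(1))
  have "dirderiv ?g (0, c) (\<tau>, 0) = dirderiv (dirderiv (case_prod H) (0, c)) (1, 0) (\<tau>, 0)"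
    by (rule dirderiv_commute[OF center_domain smooth'(2)])
  also have "\<dots> = 0"
    by (rule zero[OF differentiable_dirderivs(2) Taylor_coefficients(2)])
  finally have 1: "dirderiv ?g (0, c) (\<tau>, 0) = 0" .
  show ?thesis using jet3_ray[OF center_domain g, of \<tau> "(0, c)"] unfolding 0 1 2 3 by simp
qed

text \<open>Polarization of the quadratic form \<open>hom2\<close>: its values at
  \<open>(1, 0)\<close>, \<open>(0, 1)\<close> and \<open>(1, 1)\<close> determine the symmetric
  bilinear form.\<close>

lemma mixed_coefficients:
  "D2 (case_prod H) (\<tau>, 0) (0, (1, 0)) (0, c) = fst c *\<^sub>R h 2 0 \<tau> + snd c *\<^sub>R h 1 1 \<tau>"
  "D2 (case_prod H) (\<tau>, 0) (0, (0, 1)) (0, c) = fst c *\<^sub>R h 1 1 \<tau> + snd c *\<^sub>R h 0 2 \<tau>"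
proof -
  let ?B = "\<lambda>p q. D2 (case_prod H) (\<tau>, 0) (0, p) (0, q)"
  note bl = bilinear_D2[OF smooth'(2) center_domain, of \<tau>]
  have diag: "?B c c = 2 *\<^sub>R hom2 (\<lambda>i j. h i j \<tau>) c" for c
    by (simp flip: Taylor_coefficients(3))
  have add: "?B (p + q) r = ?B p r + ?B q r" "?B r (p + q) = ?B r p + ?B r q" for p q r
    using bilinear_ladd[OF bl, of "(0, p)" "(0, q)"] bilinear_radd[OF bl, of _ "(0, p)" "(0, q)"] by auto
  have sym: "?B p q = ?B q p" for p q by (rule D2_commute[OF center_domain smooth'(2)])
  have 20: "?B (1, 0) (1, 0) = h 2 0 \<tau>" and 02: "?B (0, 1) (0, 1) = h 0 2 \<tau>"
    by (simp_all add: diag hom2_def)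
  have "?B ((1, 0) + (0, 1)) ((1, 0) + (0, 1)) = h 2 0 \<tau> + h 0 2 \<tau> + 2 *\<^sub>R h 1 1 \<tau>"
    unfolding diag by (simp add: hom2_def algebra_simps)
  then have "2 *\<^sub>R ?B (1, 0) (0, 1) = 2 *\<^sub>R h 1 1 \<tau>"
    unfolding add 20 02 sym[of "(0, 1)" "(1, 0)"] by (simp add: scaleR_2 algebra_simps)
  then have 11: "?B (1, 0) (0, 1) = h 1 1 \<tau>" by simp
  have lin: "?B p c = fst c *\<^sub>R ?B p (1, 0) + snd c *\<^sub>R ?B p (0, 1)" for p
  proof -
    have "fst c *\<^sub>R (0, (1, 0)) + snd c *\<^sub>R (0, (0, 1)) = (0 :: real, c)"
      by (cases c) (simp add: zero_prod_def)
    moreover have "D2 (case_prod H) (\<tau>, 0) (0, p) (fst c *\<^sub>R (0, (1, 0)) + snd c *\<^sub>R (0, (0, 1)))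
        = fst c *\<^sub>R ?B p (1, 0) + snd c *\<^sub>R ?B p (0, 1)"
      by (simp only: bilinear_radd[OF bl] bilinear_rmul[OF bl])
    ultimately show ?thesis by (simp only:)
  qed
  show "?B (1, 0) c = fst c *\<^sub>R h 2 0 \<tau> + snd c *\<^sub>R h 1 1 \<tau>"
    by (subst lin) (simp only: 20 11)
  show "?B (0, 1) c = fst c *\<^sub>R h 1 1 \<tau> + snd c *\<^sub>R h 0 2 \<tau>"
    by (subst lin) (simp only: 02 11 sym[of "(0, 1)" "(1, 0)"])
qed

text \<open>Only the linear coefficient is recorded: these derivatives get multiplied by the rates
  of \<xi>1 and \<xi>2, which start at order two, so \<open>p\<close> and \<open>q\<close> would
  enter beyond order three.\<close>

lemma jet3_dirderiv_space:
  "\<exists>p q. jet3 (\<lambda>s. dirderiv (case_prod H) (0, (1, 0)) (\<tau>, s *\<^sub>R c)) 0 (fst c *\<^sub>R h 2 0 \<tau> + snd c *\<^sub>R h 1 1 \<tau>) p q"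
  "\<exists>p q. jet3 (\<lambda>s. dirderiv (case_prod H) (0, (0, 1)) (\<tau>, s *\<^sub>R c)) 0 (fst c *\<^sub>R h 1 1 \<tau> + snd c *\<^sub>R h 0 2 \<tau>) p q"
proof -
  have "\<exists>p q. jet3 (\<lambda>s. dirderiv (case_prod H) (0, b) (\<tau>, s *\<^sub>R c)) 0 (D2 (case_prod H) (\<tau>, 0) (0, b) (0, c)) p q" for b
    using jet3_ray[OF center_domain C_k_on_dirderiv_3[OF smooth, of "(0, b)"], of \<tau> "(0, c)"]
    by (auto simp: Taylor_coefficients(2) simp flip: D2_eq)
  from this[of "(1, 0)"] this[of "(0, 1)"]
  show "\<exists>p q. jet3 (\<lambda>s. dirderiv (case_prod H) (0, (1, 0)) (\<tau>, s *\<^sub>R c)) 0 (fst c *\<^sub>R h 2 0 \<tau> + snd c *\<^sub>R h 1 1 \<tau>) p q"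
    "\<exists>p q. jet3 (\<lambda>s. dirderiv (case_prod H) (0, (0, 1)) (\<tau>, s *\<^sub>R c)) 0 (fst c *\<^sub>R h 1 1 \<tau> + snd c *\<^sub>R h 0 2 \<tau>) p q"
    unfolding mixed_coefficients by blast+
qed

end

section \<open>The quadratic and cubic orders of the invariance equation\<close>

text \<open>Along one ray, \<open>P\<close>, \<open>Q1\<close>, \<open>Q2\<close> stand for the
  rates of \<tau>, \<xi>1, \<xi>2; \<open>g0\<close>, \<open>g1\<close>, \<open>g2\<close> for the
  partial derivatives of \<open>H\<close>; \<open>k\<close> for \<open>H\<close> itself; and
  \<open>v\<close>, \<open>w\<close> for the linear part of the parametrization and its time
  derivative.\<close>

lemma invariance_orders:
  fixes F :: "'a::euclidean_space \<Rightarrow> 'a"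
  assumes F: "C_k_on 3 F UNIV"
    and eq: "\<forall>\<^sub>F s in at 0. P s *\<^sub>R (F x + s *\<^sub>R w + g0 s) + Q1 s *\<^sub>R (v1 + g1 s) + Q2 s *\<^sub>R (v2 + g2 s)
      = F (x + (s *\<^sub>R v + k s))"
    and P: "jet3 P 1 p1 p2 p3" and Q1: "jet3 Q1 0 0 q2 q3" and Q2: "jet3 Q2 0 0 r2 r3"
    and g0: "jet3 g0 0 0 k2' k3'" and g1: "\<exists>p q. jet3 g1 0 m1 p q" and g2: "\<exists>p q. jet3 g2 0 m2 p q"
    and k: "jet3 k 0 0 k2 k3"
  shows "k2' + p1 *\<^sub>R w + p2 *\<^sub>R F x + q2 *\<^sub>R v1 + r2 *\<^sub>R v2 = dirderiv F k2 x + (1/2) *\<^sub>R D2 F x v v"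
    "k3' + p1 *\<^sub>R k2' + p2 *\<^sub>R w + p3 *\<^sub>R F x + q2 *\<^sub>R m1 + q3 *\<^sub>R v1 + r2 *\<^sub>R m2 + r3 *\<^sub>R v2
      = dirderiv F k3 x + D2 F x v k2 + (1/6) *\<^sub>R D3 F x v v v"
proof -
  obtain e1 e1' e2 e2' where g1: "jet3 g1 0 m1 e1 e1'" and g2: "jet3 g2 0 m2 e2 e2'" using g1 g2 by blast
  have lin: "jet3 (\<lambda>s. a + s *\<^sub>R b) a b 0 0" for a b :: 'a
    using jet3_poly[of a b 0 0] by simp
  have const: "jet3 (\<lambda>s. a) a 0 0 0" for a :: 'a
    using jet3_poly[of a 0 0 0] by simp
  have sc: "jet3 (\<lambda>s. s *\<^sub>R v) 0 v 0 0" using jet3_poly[of 0 v 0 0] by simp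
  have sk: "jet3 (\<lambda>s. s *\<^sub>R v + k s) 0 v k2 k3" using jet3_add[OF sc k] by simp
  note bs = bounded_bilinear_scaleR
  note lhs = jet3_add[OF jet3_add[OF jet3_bilinear[OF bs P jet3_add[OF lin g0]]
      jet3_bilinear[OF bs Q1 jet3_add[OF const g1]]] jet3_bilinear[OF bs Q2 jet3_add[OF const g2]]]
  note rhs = jet3_compose[OF open_UNIV UNIV_I F sk, of x]
  note u = jet3_unique[OF jet3_cong[OF lhs eq] rhs]
  from u(3) show "k2' + p1 *\<^sub>R w + p2 *\<^sub>R F x + q2 *\<^sub>R v1 + r2 *\<^sub>R v2 = dirderiv F k2 x + (1/2) *\<^sub>R D2 F x v v"
    by (simp add: algebra_simps)
  from u(4) show "k3' + p1 *\<^sub>R k2' + p2 *\<^sub>R w + p3 *\<^sub>R F x + q2 *\<^sub>R m1 + q3 *\<^sub>R v1 + r2 *\<^sub>R m2 + r3 *\<^sub>R v2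
      = dirderiv F k3 x + D2 F x v k2 + (1/6) *\<^sub>R D3 F x v v v"
    by (simp add: algebra_simps)
qed

text \<open>Both sides are quadratic forms in \<open>(c1, c2)\<close>, determined by their values at
  \<open>(1, 0)\<close>, \<open>(0, 1)\<close> and \<open>(1, 1)\<close>. Pairing with an arbitrary
  \<open>z\<close> turns the extraction into real linear arithmetic.\<close>

lemma quadratic_order_equations:
  fixes A :: "'a::real_inner \<Rightarrow> 'a" and B :: "'a \<Rightarrow> 'a \<Rightarrow> 'a" and h h' :: "nat \<Rightarrow> nat \<Rightarrow> 'a"
  assumes A: "linear A" and B: "bilinear B" and sym: "\<And>p q. B p q = B q p"
    and eq: "\<And>c1 c2. hom2 h' (c1, c2) + (- c1) *\<^sub>R (c1 *\<^sub>R w1 + c2 *\<^sub>R w2) + (\<alpha>20 * c1^2 + \<alpha>02 * c2^2) *\<^sub>R f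
        + (a20 * c1^2 + a02 * c2^2) *\<^sub>R v1 + (b11 * c1 * c2) *\<^sub>R v2
      = A (hom2 h (c1, c2)) + (1/2) *\<^sub>R B (c1 *\<^sub>R v1 + c2 *\<^sub>R v2) (c1 *\<^sub>R v1 + c2 *\<^sub>R v2)"
  shows "h' 2 0 = A (h 2 0) + B v1 v1 - (2 * a20) *\<^sub>R v1 - (2 * \<alpha>20) *\<^sub>R f + 2 *\<^sub>R w1"
    "h' 1 1 = A (h 1 1) + B v1 v2 - b11 *\<^sub>R v2 + w2"
    "h' 0 2 = A (h 0 2) + B v2 v2 - (2 * a02) *\<^sub>R v1 - (2 * \<alpha>02) *\<^sub>R f"
proof -
  have BB: "B (c1 *\<^sub>R v1 + c2 *\<^sub>R v2) (c1 *\<^sub>R v1 + c2 *\<^sub>R v2)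
      = c1^2 *\<^sub>R B v1 v1 + (2 * c1 * c2) *\<^sub>R B v1 v2 + c2^2 *\<^sub>R B v2 v2" for c1 c2
    by (simp add: bilinear_ladd[OF B] bilinear_radd[OF B] bilinear_lmul[OF B] bilinear_rmul[OF B]
        sym[of v2 v1] algebra_simps power2_eq_square flip: scaleR_add_left)
  have AA: "A (hom2 h c) = hom2 (\<lambda>i j. A (h i j)) c" for c
    by (simp add: hom2_def linear_add[OF A] linear_scale[OF A])
  note E = eq[unfolded BB AA, unfolded hom2_def, simplified]
  have E10: "z \<bullet> (h' 2 0) / 2 - z \<bullet> w1 + \<alpha>20 * (z \<bullet> f) + a20 * (z \<bullet> v1) = z \<bullet> A (h 2 0) / 2 + z \<bullet> B v1 v1 / 2" for z
    using arg_cong[OF E[of 1 0], of "inner z"] by (simp add: inner_simps)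
  have E01: "z \<bullet> (h' 0 2) / 2 + \<alpha>02 * (z \<bullet> f) + a02 * (z \<bullet> v1) = z \<bullet> A (h 0 2) / 2 + z \<bullet> B v2 v2 / 2" for z
    using arg_cong[OF E[of 0 1], of "inner z"] by (simp add: inner_simps)
  have E11: "z \<bullet> (h' 2 0) / 2 + z \<bullet> (h' 1 1) + z \<bullet> (h' 0 2) / 2 - z \<bullet> w1 - z \<bullet> w2 + (\<alpha>20 + \<alpha>02) * (z \<bullet> f)
      + (a20 + a02) * (z \<bullet> v1) + b11 * (z \<bullet> v2)
    = z \<bullet> A (h 2 0) / 2 + z \<bullet> A (h 1 1) + z \<bullet> A (h 0 2) / 2 + z \<bullet> B v1 v1 / 2 + z \<bullet> B v1 v2 + z \<bullet> B v2 v2 / 2" for z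
    using arg_cong[OF E[of 1 1], of "inner z"] by (simp add: inner_simps algebra_simps)
  show "h' 2 0 = A (h 2 0) + B v1 v1 - (2 * a20) *\<^sub>R v1 - (2 * \<alpha>20) *\<^sub>R f + 2 *\<^sub>R w1"
  proof (rule vector_eq_ldot[THEN iffD1, OF allI])
    fix z show "z \<bullet> h' 2 0 = z \<bullet> (A (h 2 0) + B v1 v1 - (2 * a20) *\<^sub>R v1 - (2 * \<alpha>20) *\<^sub>R f + 2 *\<^sub>R w1)"
      using E10[of z] unfolding inner_simps mult.assoc by linarith
  qed
  show "h' 0 2 = A (h 0 2) + B v2 v2 - (2 * a02) *\<^sub>R v1 - (2 * \<alpha>02) *\<^sub>R f"
  proof (rule vector_eq_ldot[THEN iffD1, OF allI])
    fix z show "z \<bullet> h' 0 2 = z \<bullet> (A (h 0 2) + B v2 v2 - (2 * a02) *\<^sub>R v1 - (2 * \<alpha>02) *\<^sub>R f)"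
      using E01[of z] unfolding inner_simps mult.assoc by linarith
  qed
  show "h' 1 1 = A (h 1 1) + B v1 v2 - b11 *\<^sub>R v2 + w2"
  proof (rule vector_eq_ldot[THEN iffD1, OF allI])
    fix z show "z \<bullet> h' 1 1 = z \<bullet> (A (h 1 1) + B v1 v2 - b11 *\<^sub>R v2 + w2)"
      using E10[of z] E01[of z] E11[of z] unfolding inner_simps distrib_right by linarith
  qed
qed

text \<open>A binary cubic form has four coefficients. Beyond the two axis directions,
  \<open>(1, 1)\<close> and \<open>(1, -1)\<close> separate the parts even and odd in
  \<open>c2\<close>, which carry the indices \<open>1 2\<close> and \<open>2 1\<close>. The primed
  lower-order terms come from the summand \<open>- \<xi>1\<close> in the rate of \<tau>.\<close>

lemma cubic_order_equations:
  fixes A :: "'a::real_inner \<Rightarrow> 'a" and B :: "'a \<Rightarrow> 'a \<Rightarrow> 'a" and C :: "'a \<Rightarrow> 'a \<Rightarrow> 'a \<Rightarrow> 'a"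
    and h h' :: "nat \<Rightarrow> nat \<Rightarrow> 'a"
  assumes A: "linear A" and B: "bilinear B" and sym: "\<And>p q. B p q = B q p"
    and C: "\<And>p. bilinear (C p)" "\<And>q r. linear (\<lambda>p. C p q r)"
    and Csym: "\<And>p q r. C p q r = C q p r" "\<And>p q r. C p q r = C p r q"
    and eq: "\<And>c1 c2. hom3 h' (c1, c2) + (- c1) *\<^sub>R hom2 h' (c1, c2)
        + (\<alpha>20 * c1^2 + \<alpha>02 * c2^2) *\<^sub>R (c1 *\<^sub>R w1 + c2 *\<^sub>R w2) + (\<alpha>30 * c1^3 + \<alpha>12 * c1 * c2^2) *\<^sub>R f
        + (a20 * c1^2 + a02 * c2^2) *\<^sub>R (c1 *\<^sub>R h 2 0 + c2 *\<^sub>R h 1 1) + (a30 * c1^3 + a12 * c1 * c2^2) *\<^sub>R v1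
        + (b11 * c1 * c2) *\<^sub>R (c1 *\<^sub>R h 1 1 + c2 *\<^sub>R h 0 2) + (b21 * c1^2 * c2 + b03 * c2^3) *\<^sub>R v2
      = A (hom3 h (c1, c2)) + B (c1 *\<^sub>R v1 + c2 *\<^sub>R v2) (hom2 h (c1, c2))
        + (1/6) *\<^sub>R C (c1 *\<^sub>R v1 + c2 *\<^sub>R v2) (c1 *\<^sub>R v1 + c2 *\<^sub>R v2) (c1 *\<^sub>R v1 + c2 *\<^sub>R v2)"
  shows "h' 3 0 = A (h 3 0) + C v1 v1 v1 + 3 *\<^sub>R B (h 2 0) v1 - (6 * a20) *\<^sub>R h 2 0 + 3 *\<^sub>R h' 2 0
      - (6 * \<alpha>20) *\<^sub>R w1 - (6 * \<alpha>30) *\<^sub>R f - (6 * a30) *\<^sub>R v1"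
    "h' 2 1 = A (h 2 1) + C v1 v1 v2 + B (h 2 0) v2 + 2 *\<^sub>R B (h 1 1) v1 - (2 * a20) *\<^sub>R h 1 1
      - (2 * b11) *\<^sub>R h 1 1 + 2 *\<^sub>R h' 1 1 - (2 * \<alpha>20) *\<^sub>R w2 - (2 * b21) *\<^sub>R v2"
    "h' 1 2 = A (h 1 2) + C v1 v2 v2 + B (h 0 2) v1 + 2 *\<^sub>R B (h 1 1) v2 - (2 * b11) *\<^sub>R h 0 2
      - (2 * a02) *\<^sub>R h 2 0 + h' 0 2 - (2 * \<alpha>02) *\<^sub>R w1 - (2 * \<alpha>12) *\<^sub>R f - (2 * a12) *\<^sub>R v1"
    "h' 0 3 = A (h 0 3) + C v2 v2 v2 + 3 *\<^sub>R B (h 0 2) v2 - (6 * a02) *\<^sub>R h 1 1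
      - (6 * \<alpha>02) *\<^sub>R w2 - (6 * b03) *\<^sub>R v2"
proof -
  have BB: "z \<bullet> B (c1 *\<^sub>R v1 + c2 *\<^sub>R v2) (hom2 h (c1, c2))
      = c1^3 / 2 * (z \<bullet> B (h 2 0) v1) + c1^2 * c2 * (z \<bullet> B (h 1 1) v1) + c1 * c2^2 / 2 * (z \<bullet> B (h 0 2) v1)
        + c1^2 * c2 / 2 * (z \<bullet> B (h 2 0) v2) + c1 * c2^2 * (z \<bullet> B (h 1 1) v2) + c2^3 / 2 * (z \<bullet> B (h 0 2) v2)"
    for z c1 c2
    by (simp add: sym[of v1 "h _ _"] sym[of v2 "h _ _"] hom2_def bilinear_ladd[OF B] bilinear_radd[OF B] bilinear_lmul[OF B]
        bilinear_rmul[OF B] inner_simps algebra_simps power2_eq_square power3_eq_cube)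
  have s: "C v1 v2 v1 = C v1 v1 v2" "C v2 v1 v1 = C v1 v1 v2" "C v2 v1 v2 = C v1 v2 v2" "C v2 v2 v1 = C v1 v2 v2"
    using Csym by metis+
  have CC: "z \<bullet> C (c1 *\<^sub>R v1 + c2 *\<^sub>R v2) (c1 *\<^sub>R v1 + c2 *\<^sub>R v2) (c1 *\<^sub>R v1 + c2 *\<^sub>R v2)
      = c1^3 * (z \<bullet> C v1 v1 v1) + 3 * (c1^2 * c2 * (z \<bullet> C v1 v1 v2)) + 3 * (c1 * c2^2 * (z \<bullet> C v1 v2 v2))
        + c2^3 * (z \<bullet> C v2 v2 v2)" for z c1 c2
    by (simp add: bilinear_ladd[OF C(1)] bilinear_radd[OF C(1)] bilinear_lmul[OF C(1)] bilinear_rmul[OF C(1)]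
        linear_add[OF C(2)] linear_scale[OF C(2)] s inner_simps algebra_simps power2_eq_square power3_eq_cube)
  have AA: "A (hom3 h c) = hom3 (\<lambda>i j. A (h i j)) c" for c
    by (simp add: hom3_def linear_add[OF A] linear_scale[OF A])
  have E: "z \<bullet> (hom3 h' (c1, c2) + (- c1) *\<^sub>R hom2 h' (c1, c2)
        + (\<alpha>20 * c1^2 + \<alpha>02 * c2^2) *\<^sub>R (c1 *\<^sub>R w1 + c2 *\<^sub>R w2) + (\<alpha>30 * c1^3 + \<alpha>12 * c1 * c2^2) *\<^sub>R f
        + (a20 * c1^2 + a02 * c2^2) *\<^sub>R (c1 *\<^sub>R h 2 0 + c2 *\<^sub>R h 1 1) + (a30 * c1^3 + a12 * c1 * c2^2) *\<^sub>R v1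
        + (b11 * c1 * c2) *\<^sub>R (c1 *\<^sub>R h 1 1 + c2 *\<^sub>R h 0 2) + (b21 * c1^2 * c2 + b03 * c2^3) *\<^sub>R v2)
      = z \<bullet> hom3 (\<lambda>i j. A (h i j)) (c1, c2) + (c1^3 / 2 * (z \<bullet> B (h 2 0) v1) + c1^2 * c2 * (z \<bullet> B (h 1 1) v1)
        + c1 * c2^2 / 2 * (z \<bullet> B (h 0 2) v1)
        + c1^2 * c2 / 2 * (z \<bullet> B (h 2 0) v2) + c1 * c2^2 * (z \<bullet> B (h 1 1) v2) + c2^3 / 2 * (z \<bullet> B (h 0 2) v2))
        + (1/6) * (c1^3 * (z \<bullet> C v1 v1 v1) + 3 * (c1^2 * c2 * (z \<bullet> C v1 v1 v2)) + 3 * (c1 * c2^2 * (z \<bullet> C v1 v2 v2))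
        + c2^3 * (z \<bullet> C v2 v2 v2))" for z c1 c2
    unfolding eq AA[symmetric] BB[symmetric] CC[symmetric] by (simp add: inner_simps)
  note E = E[unfolded hom2_def hom3_def inner_simps]
  \<comment> \<open>The quotient \<open>6 * _ / 36\<close> is the weight 1/6 of
    \<open>A (h 3 0)\<close> in the cubic part.\<close>
  have E10: "6 * (z \<bullet> A (h 3 0)) / 36 + (z \<bullet> B (h 2 0) v1) / 2 + (z \<bullet> C v1 v1 v1) / 6
    = z \<bullet> h' 3 0 / 6 - z \<bullet> h' 2 0 / 2 + \<alpha>20 * (z \<bullet> w1) + \<alpha>30 * (z \<bullet> f) + a20 * (z \<bullet> h 2 0) + a30 * (z \<bullet> v1)" for z
    using E[where z=z and ?c1.0=1 and ?c2.0=0] by (simp add: inner_simps)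
  have E01: "6 * (z \<bullet> A (h 0 3)) / 36 + (z \<bullet> B (h 0 2) v2) / 2 + (z \<bullet> C v2 v2 v2) / 6
    = z \<bullet> h' 0 3 / 6 + \<alpha>02 * (z \<bullet> w2) + a02 * (z \<bullet> h 1 1) + b03 * (z \<bullet> v2)" for z
    using E[where z=z and ?c1.0=0 and ?c2.0=1] by (simp add: inner_simps)
  note E11 = E[where ?c1.0=1 and ?c2.0=1, simplified] and Em = E[where ?c1.0=1 and ?c2.0="-1", simplified]
  show "h' 3 0 = A (h 3 0) + C v1 v1 v1 + 3 *\<^sub>R B (h 2 0) v1 - (6 * a20) *\<^sub>R h 2 0 + 3 *\<^sub>R h' 2 0
      - (6 * \<alpha>20) *\<^sub>R w1 - (6 * \<alpha>30) *\<^sub>R f - (6 * a30) *\<^sub>R v1"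
  proof (rule vector_eq_ldot[THEN iffD1, OF allI])
    fix z show "z \<bullet> h' 3 0 = z \<bullet> (A (h 3 0) + C v1 v1 v1 + 3 *\<^sub>R B (h 2 0) v1 - (6 * a20) *\<^sub>R h 2 0 + 3 *\<^sub>R h' 2 0
      - (6 * \<alpha>20) *\<^sub>R w1 - (6 * \<alpha>30) *\<^sub>R f - (6 * a30) *\<^sub>R v1)"
      using E10[of z] by (simp add: inner_simps)
  qed
  show "h' 0 3 = A (h 0 3) + C v2 v2 v2 + 3 *\<^sub>R B (h 0 2) v2 - (6 * a02) *\<^sub>R h 1 1
      - (6 * \<alpha>02) *\<^sub>R w2 - (6 * b03) *\<^sub>R v2"
  proof (rule vector_eq_ldot[THEN iffD1, OF allI])
    fix z show "z \<bullet> h' 0 3 = z \<bullet> (A (h 0 3) + C v2 v2 v2 + 3 *\<^sub>R B (h 0 2) v2 - (6 * a02) *\<^sub>R h 1 1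
      - (6 * \<alpha>02) *\<^sub>R w2 - (6 * b03) *\<^sub>R v2)"
      using E01[of z] by (simp add: inner_simps)
  qed
  show "h' 2 1 = A (h 2 1) + C v1 v1 v2 + B (h 2 0) v2 + 2 *\<^sub>R B (h 1 1) v1 - (2 * a20) *\<^sub>R h 1 1
      - (2 * b11) *\<^sub>R h 1 1 + 2 *\<^sub>R h' 1 1 - (2 * \<alpha>20) *\<^sub>R w2 - (2 * b21) *\<^sub>R v2"
  proof (rule vector_eq_ldot[THEN iffD1, OF allI])
    fix z show "z \<bullet> h' 2 1 = z \<bullet> (A (h 2 1) + C v1 v1 v2 + B (h 2 0) v2 + 2 *\<^sub>R B (h 1 1) v1 - (2 * a20) *\<^sub>R h 1 1
      - (2 * b11) *\<^sub>R h 1 1 + 2 *\<^sub>R h' 1 1 - (2 * \<alpha>20) *\<^sub>R w2 - (2 * b21) *\<^sub>R v2)"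
      using E01[of z] E11[where z=z] Em[where z=z]
      by (simp add: inner_simps algebra_simps add_divide_distrib diff_divide_distrib; linarith)
  qed
  show "h' 1 2 = A (h 1 2) + C v1 v2 v2 + B (h 0 2) v1 + 2 *\<^sub>R B (h 1 1) v2 - (2 * b11) *\<^sub>R h 0 2
      - (2 * a02) *\<^sub>R h 2 0 + h' 0 2 - (2 * \<alpha>02) *\<^sub>R w1 - (2 * \<alpha>12) *\<^sub>R f - (2 * a12) *\<^sub>R v1"
  proof (rule vector_eq_ldot[THEN iffD1, OF allI])
    fix z show "z \<bullet> h' 1 2 = z \<bullet> (A (h 1 2) + C v1 v2 v2 + B (h 0 2) v1 + 2 *\<^sub>R B (h 1 1) v2 - (2 * b11) *\<^sub>R h 0 2
      - (2 * a02) *\<^sub>R h 2 0 + h' 0 2 - (2 * \<alpha>02) *\<^sub>R w1 - (2 * \<alpha>12) *\<^sub>R f - (2 * a12) *\<^sub>R v1)"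
      using E10[of z] E11[where z=z] Em[where z=z]
      by (simp add: inner_simps algebra_simps add_divide_distrib diff_divide_distrib; linarith)
  qed
qed

section \<open>The homological equation and uniqueness of periodic solutions\<close>

text \<open>With \<open>k\<close> the coefficients one period later, the reflection of the second
  variable becomes the boundary condition: periodic for even second index, antiperiodic for
  odd.\<close>

lemma hom2_eq_reflected:
  assumes "\<And>c. hom2 h c = hom2 k (fst c, - snd c)"
  shows "h 2 0 = k 2 0" "h 1 1 = - k 1 1" "h 0 2 = k 0 2"
proof -
  show 20: "h 2 0 = k 2 0" using assms[of "(1, 0)"] by (simp add: hom2_def)
  show 02: "h 0 2 = k 0 2" using assms[of "(0, 1)"] by (simp add: hom2_def)
  show "h 1 1 = - k 1 1" using assms[of "(1, 1)"] 20 02 by (simp add: hom2_def)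
qed

lemma hom3_eq_reflected:
  assumes "\<And>c. hom3 h c = hom3 k (fst c, - snd c)"
  shows "h 3 0 = k 3 0" "h 2 1 = - k 2 1" "h 1 2 = k 1 2" "h 0 3 = - k 0 3"
proof -
  show 30: "h 3 0 = k 3 0" using assms[of "(1, 0)"] by (simp add: hom3_def)
  have "(1/6) *\<^sub>R h 0 3 = (1/6) *\<^sub>R (- k 0 3)" using assms[of "(0, 1)"] by (simp add: hom3_def)
  then show 03: "h 0 3 = - k 0 3" by (simp only: scaleR_cancel_left) simp
  have p: "(1/2) *\<^sub>R h 2 1 + (1/2) *\<^sub>R h 1 2 = - (1/2) *\<^sub>R k 2 1 + (1/2) *\<^sub>R k 1 2"
    using assms[of "(1, 1)"] 30 03 by (simp add: hom3_def)
  have m: "- (1/2) *\<^sub>R h 2 1 + (1/2) *\<^sub>R h 1 2 = (1/2) *\<^sub>R k 2 1 + (1/2) *\<^sub>R k 1 2"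
    using assms[of "(1, -1)"] 30 03 by (simp add: hom3_def)
  have half: "(1/2) *\<^sub>R x + (1/2) *\<^sub>R x = x" for x :: 'a
    by (simp flip: scaleR_add_left)
  have "h 1 2 = ((1/2) *\<^sub>R h 2 1 + (1/2) *\<^sub>R h 1 2) + (- (1/2) *\<^sub>R h 2 1 + (1/2) *\<^sub>R h 1 2)"
    using half[of "h 1 2"] by simp
  also have "\<dots> = k 1 2" unfolding p m using half[of "k 1 2"] by simp
  finally show "h 1 2 = k 1 2" .
  have "h 2 1 = ((1/2) *\<^sub>R h 2 1 + (1/2) *\<^sub>R h 1 2) - (- (1/2) *\<^sub>R h 2 1 + (1/2) *\<^sub>R h 1 2)"
    using half[of "h 2 1"] by simp
  also have "\<dots> = - k 2 1" unfolding p m using half[of "k 2 1"] by (simp add: algebra_simps)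
  finally show "h 2 1 = - k 2 1" .
qed

text \<open>The restricted system is treated as one field \<open>V\<close> on the product space, so
  that \<open>invariance_equation\<close> applies; \<open>u'\<close> is the total derivative of the
  parametrization. Solutions are confined to a ball around the chosen point because only there a
  Lipschitz constant is available.\<close>

lemma homological_equation:
  fixes u0 v1 v2 :: "real \<Rightarrow> 'a::real_normed_vector" and H :: "real \<Rightarrow> real \<times> real \<Rightarrow> 'a"
    and P Q1 Q2 :: "real \<Rightarrow> real \<times> real \<Rightarrow> real"
  defines "u \<equiv> \<lambda>\<tau> \<xi>. u0 \<tau> + fst \<xi> *\<^sub>R v1 \<tau> + snd \<xi> *\<^sub>R v2 \<tau> + H \<tau> \<xi>"
  assumes u0: "(u0 has_vector_derivative f) (at \<tau>)" and v1: "(v1 has_vector_derivative w1) (at \<tau>)"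
    and v2: "(v2 has_vector_derivative w2) (at \<tau>)" and H: "(case_prod H) differentiable (at (\<tau>, \<xi>))"
    and V: "\<exists>L. L-lipschitz_on (cball (\<tau>, \<xi>) r) (\<lambda>x. (P (fst x) (snd x), Q1 (fst x) (snd x), Q2 (fst x) (snd x)))"
    and r: "r > 0"
    and sol: "\<And>\<theta> \<xi>1 \<xi>2 d. d > 0 \<Longrightarrow> (\<And>t. t \<in> {-d<..<d} \<Longrightarrow> (\<theta> t, \<xi>1 t, \<xi>2 t) \<in> cball (\<tau>, \<xi>) r) \<Longrightarrow>
      (\<And>t. t \<in> {-d<..<d} \<Longrightarrow> (\<theta> has_real_derivative P (\<theta> t) (\<xi>1 t, \<xi>2 t)) (at t)) \<Longrightarrow>
      (\<And>t. t \<in> {-d<..<d} \<Longrightarrow> (\<xi>1 has_real_derivative Q1 (\<theta> t) (\<xi>1 t, \<xi>2 t)) (at t)) \<Longrightarrow>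
      (\<And>t. t \<in> {-d<..<d} \<Longrightarrow> (\<xi>2 has_real_derivative Q2 (\<theta> t) (\<xi>1 t, \<xi>2 t)) (at t)) \<Longrightarrow>
      ((\<lambda>t. u (\<theta> t) (\<xi>1 t, \<xi>2 t)) has_vector_derivative G (u (\<theta> 0) (\<xi>1 0, \<xi>2 0))) (at 0)"
  shows "P \<tau> \<xi> *\<^sub>R (f + (fst \<xi> *\<^sub>R w1 + snd \<xi> *\<^sub>R w2) + dirderiv (case_prod H) (1, 0) (\<tau>, \<xi>))
      + Q1 \<tau> \<xi> *\<^sub>R (v1 \<tau> + dirderiv (case_prod H) (0, (1, 0)) (\<tau>, \<xi>))
      + Q2 \<tau> \<xi> *\<^sub>R (v2 \<tau> + dirderiv (case_prod H) (0, (0, 1)) (\<tau>, \<xi>)) = G (u \<tau> \<xi>)"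
proof -
  define V where "V x = (P (fst x) (snd x), Q1 (fst x) (snd x), Q2 (fst x) (snd x))" for x
  obtain L where L: "L-lipschitz_on (cball (\<tau>, \<xi>) r) V" using V unfolding V_def by blast
  define uc where "uc x = u0 (fst x) + fst (snd x) *\<^sub>R v1 (fst x) + snd (snd x) *\<^sub>R v2 (fst x) + (case_prod H) x" for x
  have uc: "uc x = u (fst x) (snd x)" for x by (simp add: uc_def u_def case_prod_beta)
  define u' where "u' p = fst p *\<^sub>R f + (fst \<xi> *\<^sub>R fst p *\<^sub>R w1 + fst (snd p) *\<^sub>R v1 \<tau>)
      + (snd \<xi> *\<^sub>R fst p *\<^sub>R w2 + snd (snd p) *\<^sub>R v2 \<tau>) + dirderiv (case_prod H) p (\<tau>, \<xi>)" for p :: "real \<times> real \<times> real"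
  have fst': "((\<lambda>x. g (fst x)) has_derivative (\<lambda>p. fst p *\<^sub>R g')) (at (\<tau>, \<xi>))"
    if "(g has_vector_derivative g') (at \<tau>)" for g :: "real \<Rightarrow> 'a" and g'
    using has_derivative_compose[of fst fst "(\<tau>, \<xi>)" UNIV g "\<lambda>h. h *\<^sub>R g'"] that
    by (simp add: has_vector_derivative_def has_derivative_fst[OF has_derivative_ident])
  have "(uc has_derivative u') (at (\<tau>, \<xi>))"
    unfolding uc_def u'_def
    by (intro has_derivative_add fst' u0 has_derivative_dirderiv[OF H]
        has_derivative_eq_rhs[OF has_derivative_scaleR[OF has_derivative_fst[OF has_derivative_snd[OF has_derivative_ident]] fst'[OF v1]]]
        has_derivative_eq_rhs[OF has_derivative_scaleR[OF has_derivative_snd[OF has_derivative_snd[OF has_derivative_ident]] fst'[OF v2]]])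
      auto
  moreover have "((\<lambda>t. uc (\<phi> t)) has_vector_derivative G (uc (\<phi> 0))) (at 0)"
    if \<phi>: "\<And>t. t \<in> {-d<..<d} \<Longrightarrow> \<phi> t \<in> cball (\<tau>, \<xi>) r"
      "\<And>t. t \<in> {-d<..<d} \<Longrightarrow> (\<phi> has_vector_derivative V (\<phi> t)) (at t)" "d > 0" for \<phi> d
  proof -
    have snd: "((\<lambda>t. snd (\<phi> t)) has_vector_derivative snd (V (\<phi> t))) (at t)" if "t \<in> {-d<..<d}" for t
      by (rule bounded_linear.has_vector_derivative[OF bounded_linear_snd \<phi>(2)[OF that]])
    have 1: "((\<lambda>t. fst (\<phi> t)) has_real_derivative P (fst (\<phi> t)) (snd (\<phi> t))) (at t)" if "t \<in> {-d<..<d}" for t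
      using bounded_linear.has_vector_derivative[OF bounded_linear_fst \<phi>(2)[OF that]]
      by (simp add: has_real_derivative_iff_has_vector_derivative V_def)
    have 2: "((\<lambda>t. fst (snd (\<phi> t))) has_real_derivative Q1 (fst (\<phi> t)) (snd (\<phi> t))) (at t)" if "t \<in> {-d<..<d}" for t
      using bounded_linear.has_vector_derivative[OF bounded_linear_fst snd[OF that]]
      by (simp add: has_real_derivative_iff_has_vector_derivative V_def)
    have 3: "((\<lambda>t. snd (snd (\<phi> t))) has_real_derivative Q2 (fst (\<phi> t)) (snd (\<phi> t))) (at t)" if "t \<in> {-d<..<d}" for t
      using bounded_linear.has_vector_derivative[OF bounded_linear_snd snd[OF that]]
      by (simp add: has_real_derivative_iff_has_vector_derivative V_def)
    show ?thesis
      using sol[of d "\<lambda>t. fst (\<phi> t)" "\<lambda>t. fst (snd (\<phi> t))" "\<lambda>t. snd (snd (\<phi> t))"] \<phi>(1,3) 1 2 3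
      by (simp add: uc)
  qed
  ultimately have inv: "u' (V (\<tau>, \<xi>)) = G (uc (\<tau>, \<xi>))"
    by (rule invariance_equation[OF _ L r])
  \<comment> \<open>Splitting along the three coordinate directions separates the time derivative of
    \<open>H\<close> from its spatial ones, whose jets are known individually.\<close>
  have "dirderiv (case_prod H) (a, (b, c)) (\<tau>, \<xi>)
      = a *\<^sub>R dirderiv (case_prod H) (1, 0) (\<tau>, \<xi>) + b *\<^sub>R dirderiv (case_prod H) (0, (1, 0)) (\<tau>, \<xi>) + c *\<^sub>R dirderiv (case_prod H) (0, (0, 1)) (\<tau>, \<xi>)"
    for a b c
  proof -
    note lin = linear_dirderiv[OF H]
    have "(a, (b, c)) = a *\<^sub>R (1, 0) + b *\<^sub>R (0, (1, 0)) + c *\<^sub>R (0, (0, 1))" by (simp add: zero_prod_def)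
    then show ?thesis by (simp only: linear_add[OF lin] linear_scale[OF lin])
  qed
  from this[of "P \<tau> \<xi>" "Q1 \<tau> \<xi>" "Q2 \<tau> \<xi>"] inv show ?thesis
    by (simp add: u'_def V_def uc algebra_simps)
qed

lemma bounded_linear_matrix_vector_left: "bounded_linear (\<lambda>M :: real^'n^'m. M *v x)"
  unfolding linear_conv_bounded_linear[symmetric]
  by (rule linearI) (simp_all add: matrix_vector_mult_add_rdistrib scaleR_matrix_vector_assoc)

text \<open>One argument serves both multipliers: \<open>f = F(u0)\<close> with
  \<open>\<psi> = v1s\<close> for \<open>\<mu> = 1\<close>, and \<open>f = v2\<close> with
  \<open>\<psi> = v2s\<close> for \<open>\<mu> = -1\<close>. Initial values of such solutions are
  eigenvectors of \<open>Y T\<close>.\<close>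

lemma floquet_solution_zero:
  fixes A :: "real \<Rightarrow> real^'n^'n" and \<mu> :: real
  assumes T: "T > 0" and bound: "\<And>t w. t \<in> {0..T} \<Longrightarrow> norm (A t *v w) \<le> M * norm w"
    and Y: "\<And>t. (Y has_vector_derivative A t ** Y t) (at t)" "Y 0 = mat 1"
    and geom: "geom_mult (Y T) (of_real \<mu>) \<le> 1"
    and f: "\<And>t. t \<in> {0..T} \<Longrightarrow> (f has_vector_derivative A t *v f t) (at t within {0..T})" "f T = \<mu> *\<^sub>R f 0"
    and z: "\<And>t. t \<in> {0..T} \<Longrightarrow> (z has_vector_derivative A t *v z t) (at t within {0..T})" "z T = \<mu> *\<^sub>R z 0"
    and \<psi>f: "((\<lambda>t. \<psi> t \<bullet> f t) has_integral 1) {0..T}" and \<psi>z: "integral {0..T} (\<lambda>t. \<psi> t \<bullet> z t) = 0"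
    and t: "t \<in> {0..T}"
  shows "z t = 0"
proof -
  have unique: "x t = y t"
    if x: "\<And>t. t \<in> {0..T} \<Longrightarrow> (x has_vector_derivative A t *v x t) (at t within {0..T})"
      and y: "\<And>t. t \<in> {0..T} \<Longrightarrow> (y has_vector_derivative A t *v y t) (at t within {0..T})"
      and "x 0 = y 0" and t: "t \<in> {0..T}" for x y t
  proof -
    have "x t - y t = 0"
    proof (rule ode_zero_of_linear_bound[where z="\<lambda>t. x t - y t", OF _ _ _ t])
      show "((\<lambda>t. x t - y t) has_vector_derivative A t *v (x t - y t)) (at t within {0..T})" if "t \<in> {0..T}" for t
        using has_vector_derivative_diff[OF x[OF that] y[OF that]] by (simp add: matrix_vector_mult_diff_distrib)
      show "norm (A t *v (x t - y t)) \<le> M * norm (x t - y t)" if "t \<in> {0..T}" for t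
        by (rule bound[OF that])
    qed (use \<open>x 0 = y 0\<close> in simp)
    then show ?thesis by simp
  qed
  have flow: "x t = Y t *v x 0"
    if x: "\<And>t. t \<in> {0..T} \<Longrightarrow> (x has_vector_derivative A t *v x t) (at t within {0..T})" and t: "t \<in> {0..T}" for x t
  proof (rule unique[OF x _ _ t])
    fix t
    have "((\<lambda>t. Y t *v x 0) has_vector_derivative (A t ** Y t) *v x 0) (at t)"
      by (rule bounded_linear.has_vector_derivative[OF bounded_linear_matrix_vector_left Y(1)])
    then show "((\<lambda>t. Y t *v x 0) has_vector_derivative A t *v (Y t *v x 0)) (at t within {0..T})"
      by (simp add: matrix_vector_mul_assoc has_vector_derivative_at_within)
  qed (simp_all add: Y(2))
  \<comment> \<open>Otherwise \<open>f\<close> would vanish identically, against its pairing 1 with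
    \<open>\<psi>\<close>; only a nonzero vector spans the eigenspace.\<close>
  have f0: "f 0 \<noteq> 0"
  proof
    assume "f 0 = 0"
    then have "f t = 0" if "t \<in> {0..T}" for t using flow[OF f(1) that] by simp
    then have "((\<lambda>t. \<psi> t \<bullet> f t) has_integral 0) {0..T}" by (intro has_integral_is_0) simp
    then show False using has_integral_unique[OF \<psi>f, of 0] by simp
  qed
  have Yf: "Y T *v f 0 = \<mu> *\<^sub>R f 0" using flow[OF f(1), of T] f(2) T by simp
  have Yz: "Y T *v z 0 = \<mu> *\<^sub>R z 0" using flow[OF z(1), of T] z(2) T by simp
  obtain c where c: "z 0 = c *\<^sub>R f 0"
    by (rule eigenvector_unique_if_geom_mult_le_1[OF geom Yf f0 Yz])
  have zf: "z t = c *\<^sub>R f t" if "t \<in> {0..T}" for t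
    using flow[OF z(1) that] flow[OF f(1) that] by (simp add: c matrix_vector_mult_scaleR)
  have "((\<lambda>t. c * (\<psi> t \<bullet> f t)) has_integral c * 1) {0..T}"
    by (rule has_integral_mult_right[OF \<psi>f])
  then have "((\<lambda>t. \<psi> t \<bullet> z t) has_integral c) {0..T}"
    by (rule has_integral_eq[rotated, THEN has_integral_eq_rhs]) (simp_all add: zf)
  then have "c = 0" using \<psi>z by (simp add: integral_unique)
  then show ?thesis using zf[OF t] by simp
qed

lemma floquet_solution_unique:
  fixes A :: "real \<Rightarrow> real^'n^'n" and \<mu> :: real
  assumes "T > 0" and "\<And>t w. t \<in> {0..T} \<Longrightarrow> norm (A t *v w) \<le> M * norm w"
    and "\<And>t. (Y has_vector_derivative A t ** Y t) (at t)" "Y 0 = mat 1"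
    and "geom_mult (Y T) (of_real \<mu>) \<le> 1"
    and "\<And>t. t \<in> {0..T} \<Longrightarrow> (f has_vector_derivative A t *v f t) (at t within {0..T})" "f T = \<mu> *\<^sub>R f 0"
    and \<psi>f: "((\<lambda>t. \<psi> t \<bullet> f t) has_integral 1) {0..T}" and \<psi>: "continuous_on {0..T} \<psi>"
    and g: "\<And>t. t \<in> {0..T} \<Longrightarrow> (g has_vector_derivative g' t) (at t within {0..T})"
    and k: "\<And>t. t \<in> {0..T} \<Longrightarrow> (k has_vector_derivative k' t) (at t within {0..T})"
    and diff: "\<And>t. t \<in> {0..T} \<Longrightarrow> g' t - k' t = A t *v g t - A t *v k t"
    and bc: "g T - k T = \<mu> *\<^sub>R (g 0 - k 0)"
    and int: "integral {0..T} (\<lambda>t. \<psi> t \<bullet> g t) = 0" "integral {0..T} (\<lambda>t. \<psi> t \<bullet> k t) = 0"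
    and t: "t \<in> {0..T}"
  shows "g t = k t"
proof -
  \<comment> \<open>Each normalization concerns one function; the integral of the difference splits
    only once both integrands are known to be integrable, which continuity provides.\<close>
  have "(\<lambda>t. \<psi> t \<bullet> x t) integrable_on {0..T}"
    if "\<And>t. t \<in> {0..T} \<Longrightarrow> (x has_vector_derivative x' t) (at t within {0..T})" for x x'
    using continuous_on_vector_derivative[OF that] \<psi> by (intro integrable_continuous_real continuous_on_inner)
  from this[OF g] this[OF k] have int0: "integral {0..T} (\<lambda>t. \<psi> t \<bullet> (g t - k t)) = 0"
    unfolding inner_diff_right by (subst Henstock_Kurzweil_Integration.integral_diff) (simp_all add: int)
  have "g t - k t = 0"
  proof (rule floquet_solution_zero[where z="\<lambda>t. g t - k t", OF assms(1-7) _ bc \<psi>f int0 t])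
    fix s assume s: "s \<in> {0..T}"
    show "((\<lambda>t. g t - k t) has_vector_derivative A s *v (g s - k s)) (at s within {0..T})"
      using has_vector_derivative_diff[OF g[OF s] k[OF s]] diff[OF s]
      by (simp add: matrix_vector_mult_diff_distrib)
  qed
  then show ?thesis by simp
qed

text \<open>Evaluates a solvability condition: \<open>g\<close> is a forcing with pairing 0,
  \<open>X\<close> the integrand of the claimed formula. They differ by \<open>p\<close> times the
  normalized direction and by a multiple of a direction the pairing annihilates, so the integral is
  \<open>p\<close>.\<close>

lemma has_integral_inner_combination:
  fixes \<phi> g v f X :: "real \<Rightarrow> 'a::real_inner"
  assumes "((\<lambda>t. \<phi> t \<bullet> g t) has_integral 0) S" "((\<lambda>t. \<phi> t \<bullet> v t) has_integral 1) S"
    "((\<lambda>t. \<phi> t \<bullet> f t) has_integral 0) S"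
    and X: "\<And>t. t \<in> S \<Longrightarrow> X t = g t + p *\<^sub>R v t + q *\<^sub>R f t"
  shows "integral S (\<lambda>t. \<phi> t \<bullet> X t) = p"
proof -
  have "((\<lambda>t. \<phi> t \<bullet> g t + p * (\<phi> t \<bullet> v t) + q * (\<phi> t \<bullet> f t)) has_integral 0 + p * 1 + q * 0) S"
    by (intro has_integral_add has_integral_mult_right assms(1-3))
  moreover have "\<phi> t \<bullet> g t + p * (\<phi> t \<bullet> v t) + q * (\<phi> t \<bullet> f t) = \<phi> t \<bullet> X t" if "t \<in> S" for t
    by (simp add: X[OF that] inner_add_right)
  ultimately have "((\<lambda>t. \<phi> t \<bullet> X t) has_integral 0 + p * 1 + q * 0) S"
    by (rule has_integral_eq[rotated])
  then show ?thesis by (simp add: integral_unique)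
qed

text \<open>A function that is not integrable has \<open>integral\<close> 0 by convention, so a
  nonzero value certifies integrability.\<close>

lemma has_integral_of_integral_nonzero:
  "integral S f = c \<Longrightarrow> c \<noteq> 0 \<Longrightarrow> (f has_integral c) S"
  using not_integrable_integral integrable_integral by metis

section \<open>The normal form coefficients\<close>

theorem mainTheorem8:
  fixes F :: "real^'n \<Rightarrow> real^'n"
    and u0 v1 v2 \<phi>s v1s v2s :: "real \<Rightarrow> real^'n"
    and Y :: "real \<Rightarrow> real^'n^'n"
    and T \<epsilon> :: real
    and H :: "real \<Rightarrow> real \<times> real \<Rightarrow> real^'n"
    and h :: "nat \<Rightarrow> nat \<Rightarrow> real \<Rightarrow> real^'n"
    and R0 R1 R2 :: "real \<Rightarrow> real \<times> real \<Rightarrow> real"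
    and \<alpha>20 \<alpha>02 \<alpha>30 \<alpha>12 a20 a02 a30 a12 b11 b21 b03 :: real
  defines "A \<equiv> \<lambda>\<tau>. jacobian F (at (u0 \<tau>))"
    and "B \<equiv> \<lambda>\<tau>. D2 F (u0 \<tau>)"
    and "C \<equiv> \<lambda>\<tau>. D3 F (u0 \<tau>)"
    and "u \<equiv> \<lambda>\<tau> \<xi>. u0 \<tau> + fst \<xi> *\<^sub>R v1 \<tau> + snd \<xi> *\<^sub>R v2 \<tau> + H \<tau> \<xi>"
  assumes F_smooth: "C_k_on 4 F UNIV"
    \<comment> \<open>the limit cycle and its multipliers\<close>
    and u0_solution: "\<And>t. (u0 has_vector_derivative F (u0 t)) (at t)"
    and u0_nonconstant: "\<not> u0 constant_on UNIV"
    and u0_period: "minimal_period u0 T"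
    and Y_solution: "\<And>\<tau>. (Y has_vector_derivative A \<tau> ** Y \<tau>) (at \<tau>)"
    and Y_init: "Y 0 = mat 1"
    and LPPD: "LPPD_monodromy (Y T)"
    \<comment> \<open>the (generalized) eigenfunctions and adjoint eigenfunctions\<close>
    and v1_ode: "\<And>\<tau>. \<tau> \<in> {0..T} \<Longrightarrow>
          (v1 has_vector_derivative A \<tau> *v v1 \<tau> + F (u0 \<tau>)) (at \<tau> within {0..T})"
    and v1_periodic: "\<And>\<tau>. v1 (\<tau> + T) = v1 \<tau>"
    and v1_norm: "integral {0..T} (\<lambda>\<tau>. v1 \<tau> \<bullet> F (u0 \<tau>)) = 0"
    and v2_ode: "\<And>\<tau>. \<tau> \<in> {0..T} \<Longrightarrow>
          (v2 has_vector_derivative A \<tau> *v v2 \<tau>) (at \<tau> within {0..T})"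
    and v2_antiperiodic: "\<And>\<tau>. v2 (\<tau> + T) = - v2 \<tau>"
    and v2_norm: "integral {0..T} (\<lambda>\<tau>. v2 \<tau> \<bullet> v2 \<tau>) = 1"
    and \<phi>s_ode: "\<And>\<tau>. \<tau> \<in> {0..T} \<Longrightarrow>
          (\<phi>s has_vector_derivative - (transpose (A \<tau>) *v \<phi>s \<tau>)) (at \<tau> within {0..T})"
    and \<phi>s_bc: "\<phi>s T = \<phi>s 0"
    and \<phi>s_norm: "integral {0..T} (\<lambda>\<tau>. \<phi>s \<tau> \<bullet> v1 \<tau>) = 1"
    and v1s_ode: "\<And>\<tau>. \<tau> \<in> {0..T} \<Longrightarrow>
          (v1s has_vector_derivative - (transpose (A \<tau>) *v v1s \<tau>) - \<phi>s \<tau>) (at \<tau> within {0..T})"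
    and v1s_bc: "v1s T = v1s 0"
    and v1s_norm: "integral {0..T} (\<lambda>\<tau>. v1s \<tau> \<bullet> v1 \<tau>) = 0"
    and v2s_ode: "\<And>\<tau>. \<tau> \<in> {0..T} \<Longrightarrow>
          (v2s has_vector_derivative - (transpose (A \<tau>) *v v2s \<tau>)) (at \<tau> within {0..T})"
    and v2s_bc: "v2s T = - v2s 0"
    and v2s_norm: "integral {0..T} (\<lambda>\<tau>. v2s \<tau> \<bullet> v2 \<tau>) = 1"
    \<comment> \<open>the parametrization of the critical center manifold; its tangent space at \<open>u0 \<tau>\<close> is the
        critical eigenspace spanned by \<open>F (u0 \<tau>)\<close>, \<open>v1 \<tau>\<close>, \<open>v2 \<tau>\<close>\<close>
    and \<epsilon>_pos: "\<epsilon> > 0"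
    and H_smooth: "C_k_on 4 (\<lambda>(\<tau>, \<xi>). H \<tau> \<xi>) (UNIV \<times> ball 0 \<epsilon>)"
    and H_periodic: "\<And>\<tau> \<xi>. \<xi> \<in> ball 0 \<epsilon> \<Longrightarrow> H (\<tau> + 2 * T) \<xi> = H \<tau> \<xi>"
    and H_expansion: "\<And>\<tau>.
          (\<lambda>\<xi>. norm (H \<tau> \<xi> - (\<Sum>(i, j)\<in>{(i, j). 2 \<le> i + j \<and> i + j \<le> 3}.
              (1 / (fact i * fact j) * fst \<xi> ^ i * snd \<xi> ^ j) *\<^sub>R h i j \<tau>)))
          \<in> O[nhds 0](\<lambda>\<xi>. norm \<xi> ^ 4)"
    and u_symmetry: "\<And>\<tau> \<xi>1 \<xi>2. (\<xi>1, \<xi>2) \<in> ball 0 \<epsilon> \<Longrightarrow> u \<tau> (\<xi>1, \<xi>2) = u (\<tau> + T) (\<xi>1, - \<xi>2)"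
    and h20_norm: "integral {0..T} (\<lambda>\<tau>. v1s \<tau> \<bullet> h 2 0 \<tau>) = 0"
    and h11_norm: "integral {0..T} (\<lambda>\<tau>. v2s \<tau> \<bullet> h 1 1 \<tau>) = 0"
    and h02_norm: "integral {0..T} (\<lambda>\<tau>. v1s \<tau> \<bullet> h 0 2 \<tau>) = 0"
    \<comment> \<open>the restricted dynamics: the LPPD periodic normal form\<close>
    and R_smooth: "\<And>R. R \<in> {R0, R1, R2} \<Longrightarrow> C_k_on 1 (\<lambda>(\<tau>, \<xi>). R \<tau> \<xi>) (UNIV \<times> ball 0 \<epsilon>)"
    and R_periodic: "\<And>R \<tau> \<xi>. R \<in> {R0, R1, R2} \<Longrightarrow> \<xi> \<in> ball 0 \<epsilon> \<Longrightarrow> R (\<tau> + 2 * T) \<xi> = R \<tau> \<xi>"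
    and R_order: "\<And>R \<tau>. R \<in> {R0, R1, R2} \<Longrightarrow> R \<tau> \<in> O[nhds 0](\<lambda>\<xi>. norm \<xi> ^ 4)"
    and restricted_dynamics: "\<And>(\<tau> :: real \<Rightarrow> real) (\<xi>1 :: real \<Rightarrow> real) (\<xi>2 :: real \<Rightarrow> real) r s.
          (\<And>t. t \<in> {r<..<s} \<Longrightarrow> (\<xi>1 t, \<xi>2 t) \<in> ball 0 \<epsilon>) \<Longrightarrow>
          (\<And>t. t \<in> {r<..<s} \<Longrightarrow> (\<tau> has_real_derivative
             1 - \<xi>1 t + \<alpha>20 * \<xi>1 t ^ 2 + \<alpha>02 * \<xi>2 t ^ 2 + \<alpha>30 * \<xi>1 t ^ 3 + \<alpha>12 * \<xi>1 t * \<xi>2 t ^ 2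
               + R0 (\<tau> t) (\<xi>1 t, \<xi>2 t)) (at t)) \<Longrightarrow>
          (\<And>t. t \<in> {r<..<s} \<Longrightarrow> (\<xi>1 has_real_derivative
             a20 * \<xi>1 t ^ 2 + a02 * \<xi>2 t ^ 2 + a30 * \<xi>1 t ^ 3 + a12 * \<xi>1 t * \<xi>2 t ^ 2
               + R1 (\<tau> t) (\<xi>1 t, \<xi>2 t)) (at t)) \<Longrightarrow>
          (\<And>t. t \<in> {r<..<s} \<Longrightarrow> (\<xi>2 has_real_derivative
             b11 * \<xi>1 t * \<xi>2 t + b21 * \<xi>1 t ^ 2 * \<xi>2 t + b03 * \<xi>2 t ^ 3
               + R2 (\<tau> t) (\<xi>1 t, \<xi>2 t)) (at t)) \<Longrightarrow>
          (\<And>t. t \<in> {r<..<s} \<Longrightarrow> ((\<lambda>t. u (\<tau> t) (\<xi>1 t, \<xi>2 t)) has_vector_derivative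
             F (u (\<tau> t) (\<xi>1 t, \<xi>2 t))) (at t))"
  shows
    "a20 = 1/2 * integral {0..T} (\<lambda>\<tau>. \<phi>s \<tau> \<bullet> (B \<tau> (v1 \<tau>) (v1 \<tau>) + 2 *\<^sub>R (A \<tau> *v v1 \<tau>)))
   \<and> b11 = integral {0..T} (\<lambda>\<tau>. v2s \<tau> \<bullet> (B \<tau> (v1 \<tau>) (v2 \<tau>) + A \<tau> *v v2 \<tau>))
   \<and> a02 = 1/2 * integral {0..T} (\<lambda>\<tau>. \<phi>s \<tau> \<bullet> B \<tau> (v2 \<tau>) (v2 \<tau>))
   \<and> unique_solution_on {0..T} (\<lambda>g.
        (\<forall>\<tau>\<in>{0..T}. (g has_vector_derivative
           A \<tau> *v g \<tau> + B \<tau> (v1 \<tau>) (v1 \<tau>) - (2 * a20) *\<^sub>R v1 \<tau> - (2 * \<alpha>20) *\<^sub>R F (u0 \<tau>)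
             + 2 *\<^sub>R (A \<tau> *v v1 \<tau>) + 2 *\<^sub>R F (u0 \<tau>)) (at \<tau> within {0..T}))
        \<and> g T - g 0 = 0 \<and> integral {0..T} (\<lambda>\<tau>. v1s \<tau> \<bullet> g \<tau>) = 0) (h 2 0)
   \<and> unique_solution_on {0..T} (\<lambda>g.
        (\<forall>\<tau>\<in>{0..T}. (g has_vector_derivative
           A \<tau> *v g \<tau> + B \<tau> (v1 \<tau>) (v2 \<tau>) - b11 *\<^sub>R v2 \<tau> + A \<tau> *v v2 \<tau>) (at \<tau> within {0..T}))
        \<and> g T + g 0 = 0 \<and> integral {0..T} (\<lambda>\<tau>. v2s \<tau> \<bullet> g \<tau>) = 0) (h 1 1)
   \<and> unique_solution_on {0..T} (\<lambda>g.
        (\<forall>\<tau>\<in>{0..T}. (g has_vector_derivative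
           A \<tau> *v g \<tau> + B \<tau> (v2 \<tau>) (v2 \<tau>) - (2 * a02) *\<^sub>R v1 \<tau> - (2 * \<alpha>02) *\<^sub>R F (u0 \<tau>))
             (at \<tau> within {0..T}))
        \<and> g T - g 0 = 0 \<and> integral {0..T} (\<lambda>\<tau>. v1s \<tau> \<bullet> g \<tau>) = 0) (h 0 2)
   \<and> a30 = 1/6 * integral {0..T} (\<lambda>\<tau>. \<phi>s \<tau> \<bullet>
          (C \<tau> (v1 \<tau>) (v1 \<tau>) (v1 \<tau>) + 3 *\<^sub>R B \<tau> (h 2 0 \<tau>) (v1 \<tau>) - (6 * a20) *\<^sub>R h 2 0 \<tau>
           + 3 *\<^sub>R (A \<tau> *v h 2 0 \<tau> + B \<tau> (v1 \<tau>) (v1 \<tau>)) + (6 * (1 - \<alpha>20)) *\<^sub>R (A \<tau> *v v1 \<tau>)))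
        - a20
   \<and> b21 = 1/2 * integral {0..T} (\<lambda>\<tau>. v2s \<tau> \<bullet>
          (C \<tau> (v1 \<tau>) (v1 \<tau>) (v2 \<tau>) + B \<tau> (h 2 0 \<tau>) (v2 \<tau>) + 2 *\<^sub>R B \<tau> (h 1 1 \<tau>) (v1 \<tau>)
           - (2 * a20) *\<^sub>R h 1 1 \<tau> - (2 * b11) *\<^sub>R h 1 1 \<tau>
           + 2 *\<^sub>R (A \<tau> *v h 1 1 \<tau> + B \<tau> (v1 \<tau>) (v2 \<tau>)) + (2 * (1 - \<alpha>20)) *\<^sub>R (A \<tau> *v v2 \<tau>)))
        - b11
   \<and> a12 = 1/2 * integral {0..T} (\<lambda>\<tau>. \<phi>s \<tau> \<bullet>
          (C \<tau> (v1 \<tau>) (v2 \<tau>) (v2 \<tau>) + B \<tau> (h 0 2 \<tau>) (v1 \<tau>) + 2 *\<^sub>R B \<tau> (h 1 1 \<tau>) (v2 \<tau>)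
           - (2 * b11) *\<^sub>R h 0 2 \<tau> - (2 * a02) *\<^sub>R h 2 0 \<tau>
           + A \<tau> *v h 0 2 \<tau> + B \<tau> (v2 \<tau>) (v2 \<tau>) - (2 * \<alpha>02) *\<^sub>R (A \<tau> *v v1 \<tau>)))
        - a02
   \<and> b03 = 1/6 * integral {0..T} (\<lambda>\<tau>. v2s \<tau> \<bullet>
          (C \<tau> (v2 \<tau>) (v2 \<tau>) (v2 \<tau>) + 3 *\<^sub>R B \<tau> (h 0 2 \<tau>) (v2 \<tau>)
           - (6 * a02) *\<^sub>R h 1 1 \<tau> - (6 * \<alpha>02) *\<^sub>R (A \<tau> *v v2 \<tau>)))"
proof -

  \<comment> \<open>Variational data along the cycle: periodicity, multilinear forms, two-sided
    derivatives\<close>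
  let ?f = "\<lambda>\<tau>. F (u0 \<tau>)" and ?w1 = "\<lambda>\<tau>. A \<tau> *v v1 \<tau> + F (u0 \<tau>)"
  have Tpos: "T > 0" and u0_per: "u0 (t + T) = u0 t" for t
    using u0_period by (auto simp: minimal_period_def)
  have F3: "C_k_on 3 F UNIV" and F2: "C_k_on 2 F UNIV" and F1: "C_k_on (Suc 0) F UNIV"
    using F_smooth by (auto intro: C_k_on_mono simp del: C_k_on.simps)
  have Fd: "F differentiable (at x)" for x
    by (rule C_k_on_differentiable[OF F_smooth]) simp_all
  have A: "A \<tau> *v w = dirderiv F w (u0 \<tau>)" for \<tau> w
    unfolding A_def by (rule jacobian_mult_eq_dirderiv[OF Fd])
  have A_per: "A (\<tau> + T) = A \<tau>" for \<tau> by (simp add: A_def u0_per)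
  have B_bil: "bilinear (B \<tau>)" and B_sym: "B \<tau> p q = B \<tau> q p" for \<tau> p q
    unfolding B_def using bilinear_D2[OF F2 open_UNIV UNIV_I] D2_commute[OF open_UNIV UNIV_I F2] by auto
  have C_tri: "bilinear (C \<tau> p)" "linear (\<lambda>p. C \<tau> p q r)" for \<tau> p q r
    unfolding C_def by (rule trilinear_D3[OF open_UNIV UNIV_I F3])+
  have C_sym: "C \<tau> p q r = C \<tau> q p r" "C \<tau> p q r = C \<tau> p r q" for \<tau> p q r
    unfolding C_def by (rule D3_commute[OF open_UNIV UNIV_I F3])+
  have f_ode: "(?f has_vector_derivative A \<tau> *v ?f \<tau>) (at \<tau>)" for \<tau>
    using vector_derivative_diff_chain_within[OF u0_solution
        has_derivative_at_withinI[OF has_derivative_dirderiv[OF Fd]]]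
    by (simp add: o_def A)
  have f_per: "?f T = ?f 0" using u0_per[of 0] by simp
  \<comment> \<open>Solutions of the restricted system through a point with \<tau> = 0 or \<tau> = T
    leave \<open>{0..T}\<close>, so the chain rule there takes the derivative from both
    sides.\<close>
  have v1_at: "(v1 has_vector_derivative ?w1 \<tau>) (at \<tau>)" if "\<tau> \<in> {0..T}" for \<tau>
    by (rule has_vector_derivative_glue_periodic[where \<sigma>=1, OF Tpos _ _ _ v1_ode that])
      (simp_all add: v1_periodic A_per u0_per)
  have v2_at: "(v2 has_vector_derivative A \<tau> *v v2 \<tau>) (at \<tau>)" if "\<tau> \<in> {0..T}" for \<tau>
  proof (rule has_vector_derivative_glue_periodic[where \<sigma>="-1", OF Tpos _ _ _ v2_ode that])
    show "A (t + T) *v v2 (t + T) = - 1 *\<^sub>R (A t *v v2 t)" for t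
      using matrix_vector_mult_scaleR[of "A t" "-1" "v2 t"] by (simp add: v2_antiperiodic A_per)
  qed (simp_all add: v2_antiperiodic)
  \<comment> \<open>Compactness of this arc bounds \<open>A\<close> uniformly, as the Gronwall
    argument requires.\<close>
  have "continuous_on {0..T} u0"
    using u0_solution by (intro continuous_at_imp_continuous_on ballI) (rule has_vector_derivative_continuous)
  then have "compact (u0 ` {0..T})" by (intro compact_continuous_image) auto
  from dirderiv_bounded_on_compact[OF F1 this subset_UNIV]
  obtain M where "\<forall>x\<in>u0 ` {0..T}. \<forall>v. norm (dirderiv F v x) \<le> M * norm v" by blast
  then have M: "norm (A t *v w) \<le> M * norm w" if "t \<in> {0..T}" for t w
    using that by (simp add: A)

  \<comment> \<open>Time derivatives and parity of the coefficients of the parametrization\<close>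
  define h' where "h' i j \<tau> = vector_derivative (h i j) (at \<tau>)" for i j \<tau>
  note H_assms = \<epsilon>_pos H_smooth H_expansion
  have h': "(h i j has_vector_derivative h' i j \<tau>) (at \<tau>)"
    if "(i, j) \<in> {(2,0), (1,1), (0,2), (3,0), (2,1), (1,2), (0,3)}" for i j \<tau>
    unfolding h'_def by (rule coefficient_has_vector_derivative[OF H_assms that])
  have ray: "\<forall>\<^sub>F s in at 0. s *\<^sub>R c \<in> ball 0 \<epsilon>" for c :: "real \<times> real"
  proof -
    have "((\<lambda>s. s *\<^sub>R c) \<longlongrightarrow> 0 *\<^sub>R c) (at 0)" by (intro tendsto_intros)
    then show ?thesis using \<epsilon>_pos by (intro topological_tendstoD) auto
  qed
  \<comment> \<open>The linear part obeys the symmetry by itself: the sign from the antiperiodicity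
    of \<open>v2\<close> cancels that of the reflected \<xi>2.\<close>
  have H_sym: "H \<tau> (\<xi>1, \<xi>2) = H (\<tau> + T) (\<xi>1, - \<xi>2)" if "(\<xi>1, \<xi>2) \<in> ball 0 \<epsilon>" for \<tau> \<xi>1 \<xi>2
    using u_symmetry[OF that, of \<tau>] by (simp add: u_def u0_per v1_periodic v2_antiperiodic)
  have parity: "hom2 (\<lambda>i j. h i j \<tau>) c = hom2 (\<lambda>i j. h i j (\<tau> + T)) (fst c, - snd c)"
    "hom3 (\<lambda>i j. h i j \<tau>) c = hom3 (\<lambda>i j. h i j (\<tau> + T)) (fst c, - snd c)" for \<tau> c
  proof -
    have "\<forall>\<^sub>F s in at 0. H \<tau> (s *\<^sub>R c) = H (\<tau> + T) (s *\<^sub>R (fst c, - snd c))"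
      using ray[of c] by eventually_elim (use H_sym[of "_ * fst c" "_ * snd c"] in \<open>cases c, simp\<close>)
    note jet3_unique[OF jet3_cong[OF jet3_H[OF H_assms] this] jet3_H[OF H_assms]]
    then show "hom2 (\<lambda>i j. h i j \<tau>) c = hom2 (\<lambda>i j. h i j (\<tau> + T)) (fst c, - snd c)"
      "hom3 (\<lambda>i j. h i j \<tau>) c = hom3 (\<lambda>i j. h i j (\<tau> + T)) (fst c, - snd c)" by blast+
  qed
  \<comment> \<open>Times 0 and \<open>T\<close> are compared, which gives the boundary conditions
    on \<open>{0..T}\<close>.\<close>
  note h_bc2 = hom2_eq_reflected[OF parity(1)[of 0], simplified add_0]
    and h_bc3 = hom3_eq_reflected[OF parity(2)[of 0], simplified add_0]

  \<comment> \<open>The homological equation at every point of the domain\<close>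
  define P where "P \<tau> \<xi> = 1 - fst \<xi> + \<alpha>20 * fst \<xi> ^ 2 + \<alpha>02 * snd \<xi> ^ 2 + \<alpha>30 * fst \<xi> ^ 3
      + \<alpha>12 * fst \<xi> * snd \<xi> ^ 2 + R0 \<tau> \<xi>" for \<tau> \<xi>
  define Q1 where "Q1 \<tau> \<xi> = a20 * fst \<xi> ^ 2 + a02 * snd \<xi> ^ 2 + a30 * fst \<xi> ^ 3
      + a12 * fst \<xi> * snd \<xi> ^ 2 + R1 \<tau> \<xi>" for \<tau> \<xi>
  define Q2 where "Q2 \<tau> \<xi> = b11 * fst \<xi> * snd \<xi> + b21 * fst \<xi> ^ 2 * snd \<xi> + b03 * snd \<xi> ^ 3 + R2 \<tau> \<xi>" for \<tau> \<xi>
  have homological: "P \<tau> \<xi> *\<^sub>R (?f \<tau> + (fst \<xi> *\<^sub>R ?w1 \<tau> + snd \<xi> *\<^sub>R (A \<tau> *v v2 \<tau>)) + dirderiv (case_prod H) (1, 0) (\<tau>, \<xi>))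
      + Q1 \<tau> \<xi> *\<^sub>R (v1 \<tau> + dirderiv (case_prod H) (0, (1, 0)) (\<tau>, \<xi>))
      + Q2 \<tau> \<xi> *\<^sub>R (v2 \<tau> + dirderiv (case_prod H) (0, (0, 1)) (\<tau>, \<xi>)) = F (u \<tau> \<xi>)"
    if \<tau>: "\<tau> \<in> {0..T}" and \<xi>: "\<xi> \<in> ball 0 \<epsilon>" for \<tau> \<xi>
  proof -
    \<comment> \<open>A closed ball inside the domain is compact, so the remainders, being C^1, are
      Lipschitz on it.\<close>
    obtain r where r: "r > 0" "cball \<xi> r \<subseteq> ball 0 \<epsilon>" using \<xi> open_ball open_contains_cball by blast
    let ?X = "cball (\<tau>, \<xi>) r"
    have snd_ball: "snd x \<in> ball 0 \<epsilon>" if "x \<in> ?X" for x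
    proof -
      have "snd x \<in> cball \<xi> r"
        using that dist_snd_le[of "(\<tau>, \<xi>)" x] by (simp only: mem_cball snd_conv)
      then show ?thesis using r(2) by blast
    qed
    have sub: "?X \<subseteq> UNIV \<times> ball 0 \<epsilon>"
    proof
      fix x assume "x \<in> ?X"
      from snd_ball[OF this] show "x \<in> UNIV \<times> ball 0 \<epsilon>" by (cases x) simp
    qed
    have R: "\<exists>L. L-lipschitz_on ?X (\<lambda>x. R (fst x) (snd x))" if "R \<in> {R0, R1, R2}" for R
      using C_k_on_1_lipschitz_cball[OF R_smooth[OF that, unfolded One_nat_def] sub] by (simp add: case_prod_unfold)
    have lin: "\<exists>L. L-lipschitz_on ?X (\<lambda>x. fst (snd x))" "\<exists>L. L-lipschitz_on ?X (\<lambda>x. snd (snd x))"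
      by (intro ex_lipschitz_bounded_linear bounded_linear_compose[OF bounded_linear_fst bounded_linear_snd]
          bounded_linear_compose[OF bounded_linear_snd bounded_linear_snd])+
    have lip: "\<exists>L. L-lipschitz_on ?X (\<lambda>x. (P (fst x) (snd x), Q1 (fst x) (snd x), Q2 (fst x) (snd x)))"
      unfolding P_def Q1_def Q2_def power2_eq_square power3_eq_cube
      by (intro ex_lipschitz_Pair ex_lipschitz_add ex_lipschitz_diff ex_lipschitz_mult[OF compact_cball]
          ex_lipschitz_const lin R) auto
    have Hd: "case_prod H differentiable (at (\<tau>, \<xi>))"
      by (rule C_k_on_differentiable[OF H_smooth]) (use \<xi> in auto)
    show ?thesis unfolding u_def
    proof (rule homological_equation[where G=F, OF u0_solution v1_at[OF \<tau>] v2_at[OF \<tau>] Hd lip r(1)])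
      fix \<theta> \<xi>1 \<xi>2 :: "real \<Rightarrow> real" and d :: real
      assume d: "d > 0" and in_X: "\<And>t. t \<in> {-d<..<d} \<Longrightarrow> (\<theta> t, \<xi>1 t, \<xi>2 t) \<in> ?X"
        and \<theta>: "\<And>t. t \<in> {-d<..<d} \<Longrightarrow> (\<theta> has_real_derivative P (\<theta> t) (\<xi>1 t, \<xi>2 t)) (at t)"
        and \<xi>1: "\<And>t. t \<in> {-d<..<d} \<Longrightarrow> (\<xi>1 has_real_derivative Q1 (\<theta> t) (\<xi>1 t, \<xi>2 t)) (at t)"
        and \<xi>2: "\<And>t. t \<in> {-d<..<d} \<Longrightarrow> (\<xi>2 has_real_derivative Q2 (\<theta> t) (\<xi>1 t, \<xi>2 t)) (at t)"
      have "(\<xi>1 t, \<xi>2 t) \<in> ball 0 \<epsilon>" if "t \<in> {-d<..<d}" for t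
        using snd_ball[OF in_X[OF that]] by simp
      then have "((\<lambda>t. u (\<theta> t) (\<xi>1 t, \<xi>2 t)) has_vector_derivative F (u (\<theta> 0) (\<xi>1 0, \<xi>2 0))) (at 0)"
        by (rule restricted_dynamics[where r="-d" and s=d])
          (use d \<theta> \<xi>1 \<xi>2 in \<open>simp_all add: P_def Q1_def Q2_def\<close>)
      then show "((\<lambda>t. u0 (\<theta> t) + fst (\<xi>1 t, \<xi>2 t) *\<^sub>R v1 (\<theta> t) + snd (\<xi>1 t, \<xi>2 t) *\<^sub>R v2 (\<theta> t)
          + H (\<theta> t) (\<xi>1 t, \<xi>2 t)) has_vector_derivative
          F (u0 (\<theta> 0) + fst (\<xi>1 0, \<xi>2 0) *\<^sub>R v1 (\<theta> 0) + snd (\<xi>1 0, \<xi>2 0) *\<^sub>R v2 (\<theta> 0)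
          + H (\<theta> 0) (\<xi>1 0, \<xi>2 0))) (at 0)"
        unfolding u_def .
    qed
  qed

  \<comment> \<open>Its quadratic and cubic orders, and the equations for the coefficients\<close>
  have R_jet: "jet3 (\<lambda>s. R \<tau> (s *\<^sub>R c)) 0 0 0 0" if "R \<in> {R0, R1, R2}" for R \<tau> c
    by (rule jet3_bigo_4) (use R_order[OF that, of \<tau>] in simp)
  have orders:
    "hom2 (\<lambda>i j. h' i j \<tau>) (c1, c2) + (- c1) *\<^sub>R (c1 *\<^sub>R ?w1 \<tau> + c2 *\<^sub>R (A \<tau> *v v2 \<tau>)) + (\<alpha>20 * c1^2 + \<alpha>02 * c2^2) *\<^sub>R ?f \<tau>
        + (a20 * c1^2 + a02 * c2^2) *\<^sub>R v1 \<tau> + (b11 * c1 * c2) *\<^sub>R v2 \<tau>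
      = A \<tau> *v (hom2 (\<lambda>i j. h i j \<tau>) (c1, c2))
        + (1/2) *\<^sub>R B \<tau> (c1 *\<^sub>R v1 \<tau> + c2 *\<^sub>R v2 \<tau>) (c1 *\<^sub>R v1 \<tau> + c2 *\<^sub>R v2 \<tau>)" (is ?O2)
    "hom3 (\<lambda>i j. h' i j \<tau>) (c1, c2) + (- c1) *\<^sub>R hom2 (\<lambda>i j. h' i j \<tau>) (c1, c2)
        + (\<alpha>20 * c1^2 + \<alpha>02 * c2^2) *\<^sub>R (c1 *\<^sub>R ?w1 \<tau> + c2 *\<^sub>R (A \<tau> *v v2 \<tau>))
        + (\<alpha>30 * c1^3 + \<alpha>12 * c1 * c2^2) *\<^sub>R ?f \<tau>
        + (a20 * c1^2 + a02 * c2^2) *\<^sub>R (c1 *\<^sub>R h 2 0 \<tau> + c2 *\<^sub>R h 1 1 \<tau>) + (a30 * c1^3 + a12 * c1 * c2^2) *\<^sub>R v1 \<tau>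
        + (b11 * c1 * c2) *\<^sub>R (c1 *\<^sub>R h 1 1 \<tau> + c2 *\<^sub>R h 0 2 \<tau>) + (b21 * c1^2 * c2 + b03 * c2^3) *\<^sub>R v2 \<tau>
      = A \<tau> *v (hom3 (\<lambda>i j. h i j \<tau>) (c1, c2)) + B \<tau> (c1 *\<^sub>R v1 \<tau> + c2 *\<^sub>R v2 \<tau>) (hom2 (\<lambda>i j. h i j \<tau>) (c1, c2))
        + (1/6) *\<^sub>R C \<tau> (c1 *\<^sub>R v1 \<tau> + c2 *\<^sub>R v2 \<tau>) (c1 *\<^sub>R v1 \<tau> + c2 *\<^sub>R v2 \<tau>) (c1 *\<^sub>R v1 \<tau> + c2 *\<^sub>R v2 \<tau>)" (is ?O3)
    if \<tau>: "\<tau> \<in> {0..T}" for \<tau> c1 c2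
  proof -
    define c where "c = (c1, c2)"
    \<comment> \<open>On a ray each rate is a cubic polynomial in \<open>s\<close> plus a remainder
      with zero jet.\<close>
    have "jet3 (\<lambda>s. (1 + s *\<^sub>R (- c1) + s^2 *\<^sub>R (\<alpha>20 * c1^2 + \<alpha>02 * c2^2) + s^3 *\<^sub>R (\<alpha>30 * c1^3 + \<alpha>12 * c1 * c2^2))
        + R0 \<tau> (s *\<^sub>R c)) (1 + 0) (- c1 + 0) (\<alpha>20 * c1^2 + \<alpha>02 * c2^2 + 0) (\<alpha>30 * c1^3 + \<alpha>12 * c1 * c2^2 + 0)"
      by (rule jet3_add[OF jet3_poly R_jet]) simp
    then have P: "jet3 (\<lambda>s. P \<tau> (s *\<^sub>R c)) 1 (- c1) (\<alpha>20 * c1^2 + \<alpha>02 * c2^2) (\<alpha>30 * c1^3 + \<alpha>12 * c1 * c2^2)"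
      unfolding add_0_right
      by (rule jet3_cong) (simp add: P_def c_def power2_eq_square power3_eq_cube algebra_simps)
    have "jet3 (\<lambda>s. (0 + s *\<^sub>R 0 + s^2 *\<^sub>R (a20 * c1^2 + a02 * c2^2) + s^3 *\<^sub>R (a30 * c1^3 + a12 * c1 * c2^2))
        + R1 \<tau> (s *\<^sub>R c)) (0 + 0) (0 + 0) (a20 * c1^2 + a02 * c2^2 + 0) (a30 * c1^3 + a12 * c1 * c2^2 + 0)"
      by (rule jet3_add[OF jet3_poly R_jet]) simp
    then have Q1: "jet3 (\<lambda>s. Q1 \<tau> (s *\<^sub>R c)) 0 0 (a20 * c1^2 + a02 * c2^2) (a30 * c1^3 + a12 * c1 * c2^2)"
      unfolding add_0_right
      by (rule jet3_cong) (simp add: Q1_def c_def power2_eq_square power3_eq_cube algebra_simps)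
    have "jet3 (\<lambda>s. (0 + s *\<^sub>R 0 + s^2 *\<^sub>R (b11 * c1 * c2) + s^3 *\<^sub>R (b21 * c1^2 * c2 + b03 * c2^3))
        + R2 \<tau> (s *\<^sub>R c)) (0 + 0) (0 + 0) (b11 * c1 * c2 + 0) (b21 * c1^2 * c2 + b03 * c2^3 + 0)"
      by (rule jet3_add[OF jet3_poly R_jet]) simp
    then have Q2: "jet3 (\<lambda>s. Q2 \<tau> (s *\<^sub>R c)) 0 0 (b11 * c1 * c2) (b21 * c1^2 * c2 + b03 * c2^3)"
      unfolding add_0_right
      by (rule jet3_cong) (simp add: Q2_def c_def power2_eq_square power3_eq_cube algebra_simps)
    have "\<forall>\<^sub>F s in at 0. P \<tau> (s *\<^sub>R c) *\<^sub>R (?f \<tau> + s *\<^sub>R (c1 *\<^sub>R ?w1 \<tau> + c2 *\<^sub>R (A \<tau> *v v2 \<tau>))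
          + dirderiv (case_prod H) (1, 0) (\<tau>, s *\<^sub>R c))
        + Q1 \<tau> (s *\<^sub>R c) *\<^sub>R (v1 \<tau> + dirderiv (case_prod H) (0, (1, 0)) (\<tau>, s *\<^sub>R c))
        + Q2 \<tau> (s *\<^sub>R c) *\<^sub>R (v2 \<tau> + dirderiv (case_prod H) (0, (0, 1)) (\<tau>, s *\<^sub>R c))
        = F (u0 \<tau> + (s *\<^sub>R (c1 *\<^sub>R v1 \<tau> + c2 *\<^sub>R v2 \<tau>) + H \<tau> (s *\<^sub>R c)))"
      using ray[of c]
    proof eventually_elim
      case (elim s)
      have lin: "fst (s *\<^sub>R c) *\<^sub>R x + snd (s *\<^sub>R c) *\<^sub>R y = s *\<^sub>R (c1 *\<^sub>R x + c2 *\<^sub>R y)" for x y :: "real^'n"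
        by (simp add: c_def scaleR_add_right)
      have "u \<tau> (s *\<^sub>R c) = u0 \<tau> + (s *\<^sub>R (c1 *\<^sub>R v1 \<tau> + c2 *\<^sub>R v2 \<tau>) + H \<tau> (s *\<^sub>R c))"
        unfolding u_def lin[symmetric] by (simp only: add.assoc)
      with homological[OF \<tau> elim] show ?case by (simp only: lin)
    qed
    note O = invariance_orders[OF F3 this P Q1 Q2 jet3_dirderiv_time[OF H_assms, of \<tau> c]
        jet3_dirderiv_space(1)[OF H_assms, of \<tau> c] jet3_dirderiv_space(2)[OF H_assms, of \<tau> c]
        jet3_H[OF H_assms, of \<tau> c], folded h'_def A]
    show ?O2 using O(1) unfolding c_def B_def .
    show ?O3 using O(2) unfolding c_def B_def C_def fst_conv snd_conv .
  qed
  have eq2: "h' 2 0 \<tau> = A \<tau> *v h 2 0 \<tau> + B \<tau> (v1 \<tau>) (v1 \<tau>) - (2 * a20) *\<^sub>R v1 \<tau> - (2 * \<alpha>20) *\<^sub>R ?f \<tau> + 2 *\<^sub>R ?w1 \<tau>"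
    "h' 1 1 \<tau> = A \<tau> *v h 1 1 \<tau> + B \<tau> (v1 \<tau>) (v2 \<tau>) - b11 *\<^sub>R v2 \<tau> + A \<tau> *v v2 \<tau>"
    "h' 0 2 \<tau> = A \<tau> *v h 0 2 \<tau> + B \<tau> (v2 \<tau>) (v2 \<tau>) - (2 * a02) *\<^sub>R v1 \<tau> - (2 * \<alpha>02) *\<^sub>R ?f \<tau>"
    if "\<tau> \<in> {0..T}" for \<tau>
    using quadratic_order_equations[where h="\<lambda>i j. h i j \<tau>" and h'="\<lambda>i j. h' i j \<tau>",
        OF matrix_vector_mul_linear B_bil B_sym orders(1)[OF that]] .
  have eq3: "h' 3 0 \<tau> = A \<tau> *v h 3 0 \<tau> + C \<tau> (v1 \<tau>) (v1 \<tau>) (v1 \<tau>) + 3 *\<^sub>R B \<tau> (h 2 0 \<tau>) (v1 \<tau>)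
      - (6 * a20) *\<^sub>R h 2 0 \<tau> + 3 *\<^sub>R h' 2 0 \<tau> - (6 * \<alpha>20) *\<^sub>R ?w1 \<tau> - (6 * \<alpha>30) *\<^sub>R ?f \<tau> - (6 * a30) *\<^sub>R v1 \<tau>"
    "h' 2 1 \<tau> = A \<tau> *v h 2 1 \<tau> + C \<tau> (v1 \<tau>) (v1 \<tau>) (v2 \<tau>) + B \<tau> (h 2 0 \<tau>) (v2 \<tau>)
      + 2 *\<^sub>R B \<tau> (h 1 1 \<tau>) (v1 \<tau>) - (2 * a20) *\<^sub>R h 1 1 \<tau> - (2 * b11) *\<^sub>R h 1 1 \<tau>
      + 2 *\<^sub>R h' 1 1 \<tau> - (2 * \<alpha>20) *\<^sub>R (A \<tau> *v v2 \<tau>) - (2 * b21) *\<^sub>R v2 \<tau>"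
    "h' 1 2 \<tau> = A \<tau> *v h 1 2 \<tau> + C \<tau> (v1 \<tau>) (v2 \<tau>) (v2 \<tau>) + B \<tau> (h 0 2 \<tau>) (v1 \<tau>)
      + 2 *\<^sub>R B \<tau> (h 1 1 \<tau>) (v2 \<tau>) - (2 * b11) *\<^sub>R h 0 2 \<tau> - (2 * a02) *\<^sub>R h 2 0 \<tau>
      + h' 0 2 \<tau> - (2 * \<alpha>02) *\<^sub>R ?w1 \<tau> - (2 * \<alpha>12) *\<^sub>R ?f \<tau> - (2 * a12) *\<^sub>R v1 \<tau>"
    "h' 0 3 \<tau> = A \<tau> *v h 0 3 \<tau> + C \<tau> (v2 \<tau>) (v2 \<tau>) (v2 \<tau>) + 3 *\<^sub>R B \<tau> (h 0 2 \<tau>) (v2 \<tau>)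
      - (6 * a02) *\<^sub>R h 1 1 \<tau> - (6 * \<alpha>02) *\<^sub>R (A \<tau> *v v2 \<tau>) - (6 * b03) *\<^sub>R v2 \<tau>"
    if "\<tau> \<in> {0..T}" for \<tau>
    using cubic_order_equations[where h="\<lambda>i j. h i j \<tau>" and h'="\<lambda>i j. h' i j \<tau>",
        OF matrix_vector_mul_linear B_bil B_sym C_tri C_sym orders(2)[OF that]] .

  \<comment> \<open>Pairings with the adjoint eigenfunctions\<close>
  have within: "(h i j has_vector_derivative d) (at \<tau> within {0..T})"
    if "(i, j) \<in> {(2,0), (1,1), (0,2), (3,0), (2,1), (1,2), (0,3)}" "h' i j \<tau> = d" for i j \<tau> d
    using h'[OF that(1), of \<tau>] that(2) by (simp add: has_vector_derivative_at_within)
  have \<phi>s_ode': "(\<phi>s has_vector_derivative - (transpose (A \<tau>) *v \<phi>s \<tau>) - 0) (at \<tau> within {0..T})"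
    and v2s_ode': "(v2s has_vector_derivative - (transpose (A \<tau>) *v v2s \<tau>) - 0) (at \<tau> within {0..T})"
    if "\<tau> \<in> {0..T}" for \<tau> using \<phi>s_ode[OF that] v2s_ode[OF that] by simp_all
  have \<phi>s_int: "((\<lambda>\<tau>. \<phi>s \<tau> \<bullet> g \<tau>) has_integral 0) {0..T}"
    if "\<And>\<tau>. \<tau> \<in> {0..T} \<Longrightarrow> (w has_vector_derivative A \<tau> *v w \<tau> + g \<tau>) (at \<tau> within {0..T})" "w 0 = w T" for w g
    using adjoint_has_integral[OF _ \<phi>s_ode' that(1)] Tpos \<phi>s_bc that(2) by simp
  have v2s_int: "((\<lambda>\<tau>. v2s \<tau> \<bullet> g \<tau>) has_integral 0) {0..T}"
    if "\<And>\<tau>. \<tau> \<in> {0..T} \<Longrightarrow> (w has_vector_derivative A \<tau> *v w \<tau> + g \<tau>) (at \<tau> within {0..T})" "w 0 = - w T" for w g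
    using adjoint_has_integral[OF _ v2s_ode' that(1)] Tpos v2s_bc that(2) by simp
  have v1_bc: "v1 0 = v1 T" using v1_periodic[of 0] by simp
  have \<phi>s_v1: "((\<lambda>\<tau>. \<phi>s \<tau> \<bullet> v1 \<tau>) has_integral 1) {0..T}"
    by (rule has_integral_of_integral_nonzero[OF \<phi>s_norm]) simp
  have v2s_v2: "((\<lambda>\<tau>. v2s \<tau> \<bullet> v2 \<tau>) has_integral 1) {0..T}"
    by (rule has_integral_of_integral_nonzero[OF v2s_norm]) simp
  \<comment> \<open>The equation of \<open>v1\<close> itself has forcing \<open>F(u0)\<close> and a
    periodic solution, so its pairing with \<open>\<phi>s\<close> vanishes.\<close>
  have \<phi>s_f: "((\<lambda>\<tau>. \<phi>s \<tau> \<bullet> ?f \<tau>) has_integral 0) {0..T}"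
    by (rule \<phi>s_int[OF v1_ode v1_bc])
  \<comment> \<open>For the simple multiplier -1 there is no further direction to discard; the zero
    function fills that slot.\<close>
  have v2s_0: "((\<lambda>\<tau>. v2s \<tau> \<bullet> 0) has_integral 0) {0..T}" by simp
  \<comment> \<open>Pairing the equation of \<open>v1\<close> with \<open>v1s\<close> leaves the
    difference of the two pairings, with integral 0 by periodicity; the pairing of
    \<open>\<phi>s\<close> with \<open>v1\<close> is 1.\<close>
  have v1s_f: "((\<lambda>\<tau>. v1s \<tau> \<bullet> ?f \<tau>) has_integral 1) {0..T}"
    using has_integral_add[OF adjoint_has_integral[OF _ v1s_ode v1_ode] \<phi>s_v1] Tpos v1s_bc v1_bc by simp
  note \<phi>s_comb = has_integral_inner_combination[OF _ \<phi>s_v1 \<phi>s_f]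
    and v2s_comb = has_integral_inner_combination[OF _ v2s_v2 v2s_0]

  \<comment> \<open>One-dimensional eigenspaces and the two uniqueness rules\<close>
  have geom1: "geom_mult (Y T) (of_real 1) \<le> 1" and geom2: "geom_mult (Y T) (of_real (-1)) \<le> 1"
    using LPPD geom_mult_le_alg_mult[of "Y T" 1] geom_mult_le_alg_mult[of "Y T" "-1"]
    by (auto simp: LPPD_monodromy_def semisimple_def)
  have v1s_cont: "continuous_on {0..T} v1s" and v2s_cont: "continuous_on {0..T} v2s"
    by (rule continuous_on_vector_derivative, rule v1s_ode v2s_ode, assumption)+
  have f_ode': "(?f has_vector_derivative A \<tau> *v ?f \<tau>) (at \<tau> within {0..T})" for \<tau>
    using f_ode by (rule has_vector_derivative_at_within)
  have f_per': "?f T = 1 *\<^sub>R ?f 0" using f_per by simp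
  have v2_bc: "v2 T = (-1) *\<^sub>R v2 0" using v2_antiperiodic[of 0] by simp
  note unique1 = floquet_solution_unique[OF Tpos M Y_solution Y_init geom1 f_ode' f_per' v1s_f v1s_cont]
    and unique2 = floquet_solution_unique[OF Tpos M Y_solution Y_init geom2 v2_ode v2_bc v2s_v2 v2s_cont]

  \<comment> \<open>Equations on one period and the resulting solvability conditions\<close>
  have ode20: "(h 2 0 has_vector_derivative A \<tau> *v h 2 0 \<tau> + B \<tau> (v1 \<tau>) (v1 \<tau>) - (2 * a20) *\<^sub>R v1 \<tau>
      - (2 * \<alpha>20) *\<^sub>R F (u0 \<tau>) + 2 *\<^sub>R (A \<tau> *v v1 \<tau>) + 2 *\<^sub>R F (u0 \<tau>)) (at \<tau> within {0..T})"
    if "\<tau> \<in> {0..T}" for \<tau>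
    by (rule within) (use eq2(1)[OF that] in \<open>simp_all add: scaleR_add_right\<close>)
  have ode11: "(h 1 1 has_vector_derivative A \<tau> *v h 1 1 \<tau> + B \<tau> (v1 \<tau>) (v2 \<tau>) - b11 *\<^sub>R v2 \<tau>
      + A \<tau> *v v2 \<tau>) (at \<tau> within {0..T})"
    if "\<tau> \<in> {0..T}" for \<tau>
    by (rule within) (use eq2(2)[OF that] in simp_all)
  have ode02: "(h 0 2 has_vector_derivative A \<tau> *v h 0 2 \<tau> + B \<tau> (v2 \<tau>) (v2 \<tau>) - (2 * a02) *\<^sub>R v1 \<tau>
      - (2 * \<alpha>02) *\<^sub>R F (u0 \<tau>)) (at \<tau> within {0..T})"
    if "\<tau> \<in> {0..T}" for \<tau>
    by (rule within) (use eq2(3)[OF that] in simp_all)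
  \<comment> \<open>In each of these conditions the forcing is the right-hand side stripped of its
    term \<open>A \<tau> *v h i j \<tau>\<close>.\<close>
  have int20: "((\<lambda>\<tau>. \<phi>s \<tau> \<bullet> (B \<tau> (v1 \<tau>) (v1 \<tau>) - (2 * a20) *\<^sub>R v1 \<tau> - (2 * \<alpha>20) *\<^sub>R ?f \<tau> + 2 *\<^sub>R ?w1 \<tau>)) has_integral 0) {0..T}"
    by (rule \<phi>s_int[of "h 2 0"], rule within) (use eq2(1) h_bc2 in \<open>simp_all add: algebra_simps\<close>)
  have int11: "((\<lambda>\<tau>. v2s \<tau> \<bullet> (B \<tau> (v1 \<tau>) (v2 \<tau>) - b11 *\<^sub>R v2 \<tau> + A \<tau> *v v2 \<tau>)) has_integral 0) {0..T}"
    by (rule v2s_int[of "h 1 1"], rule within) (use eq2(2) h_bc2 in \<open>simp_all add: algebra_simps\<close>)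
  have int02: "((\<lambda>\<tau>. \<phi>s \<tau> \<bullet> (B \<tau> (v2 \<tau>) (v2 \<tau>) - (2 * a02) *\<^sub>R v1 \<tau> - (2 * \<alpha>02) *\<^sub>R ?f \<tau>)) has_integral 0) {0..T}"
    by (rule \<phi>s_int[of "h 0 2"], rule within) (use eq2(3) h_bc2 in \<open>simp_all add: algebra_simps\<close>)
  have int30: "((\<lambda>\<tau>. \<phi>s \<tau> \<bullet> (C \<tau> (v1 \<tau>) (v1 \<tau>) (v1 \<tau>) + 3 *\<^sub>R B \<tau> (h 2 0 \<tau>) (v1 \<tau>) - (6 * a20) *\<^sub>R h 2 0 \<tau>
      + 3 *\<^sub>R h' 2 0 \<tau> - (6 * \<alpha>20) *\<^sub>R ?w1 \<tau> - (6 * \<alpha>30) *\<^sub>R ?f \<tau> - (6 * a30) *\<^sub>R v1 \<tau>)) has_integral 0) {0..T}"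
    by (rule \<phi>s_int[of "h 3 0"], rule within) (use eq3(1) h_bc3 in \<open>simp_all add: algebra_simps\<close>)
  have int21: "((\<lambda>\<tau>. v2s \<tau> \<bullet> (C \<tau> (v1 \<tau>) (v1 \<tau>) (v2 \<tau>) + B \<tau> (h 2 0 \<tau>) (v2 \<tau>) + 2 *\<^sub>R B \<tau> (h 1 1 \<tau>) (v1 \<tau>)
      - (2 * a20) *\<^sub>R h 1 1 \<tau> - (2 * b11) *\<^sub>R h 1 1 \<tau> + 2 *\<^sub>R h' 1 1 \<tau> - (2 * \<alpha>20) *\<^sub>R (A \<tau> *v v2 \<tau>)
      - (2 * b21) *\<^sub>R v2 \<tau>)) has_integral 0) {0..T}"
    by (rule v2s_int[of "h 2 1"], rule within) (use eq3(2) h_bc3 in \<open>simp_all add: algebra_simps\<close>)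
  have int12: "((\<lambda>\<tau>. \<phi>s \<tau> \<bullet> (C \<tau> (v1 \<tau>) (v2 \<tau>) (v2 \<tau>) + B \<tau> (h 0 2 \<tau>) (v1 \<tau>) + 2 *\<^sub>R B \<tau> (h 1 1 \<tau>) (v2 \<tau>)
      - (2 * b11) *\<^sub>R h 0 2 \<tau> - (2 * a02) *\<^sub>R h 2 0 \<tau> + h' 0 2 \<tau> - (2 * \<alpha>02) *\<^sub>R ?w1 \<tau> - (2 * \<alpha>12) *\<^sub>R ?f \<tau>
      - (2 * a12) *\<^sub>R v1 \<tau>)) has_integral 0) {0..T}"
    by (rule \<phi>s_int[of "h 1 2"], rule within) (use eq3(3) h_bc3 in \<open>simp_all add: algebra_simps\<close>)
  have int03: "((\<lambda>\<tau>. v2s \<tau> \<bullet> (C \<tau> (v2 \<tau>) (v2 \<tau>) (v2 \<tau>) + 3 *\<^sub>R B \<tau> (h 0 2 \<tau>) (v2 \<tau>) - (6 * a02) *\<^sub>R h 1 1 \<tau>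
      - (6 * \<alpha>02) *\<^sub>R (A \<tau> *v v2 \<tau>) - (6 * b03) *\<^sub>R v2 \<tau>)) has_integral 0) {0..T}"
    by (rule v2s_int[of "h 0 3"], rule within) (use eq3(4) h_bc3 in \<open>simp_all add: algebra_simps\<close>)

  \<comment> \<open>Reading off the normal form coefficients\<close>
  have I20: "integral {0..T} (\<lambda>\<tau>. \<phi>s \<tau> \<bullet> (B \<tau> (v1 \<tau>) (v1 \<tau>) + 2 *\<^sub>R (A \<tau> *v v1 \<tau>))) = 2 * a20"
    \<comment> \<open>The multiple \<open>q\<close> of \<open>F(u0)\<close> joins the term with
      \<open>\<alpha>20\<close> and the part of \<open>2 *\<^sub>R ?w1 \<tau>\<close> that is not
      \<open>A \<tau> *v v1 \<tau>\<close>.\<close>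
    by (rule \<phi>s_comb[OF int20, where q="2 * \<alpha>20 - 2"]) (simp add: algebra_simps)
  have I11: "integral {0..T} (\<lambda>\<tau>. v2s \<tau> \<bullet> (B \<tau> (v1 \<tau>) (v2 \<tau>) + A \<tau> *v v2 \<tau>)) = b11"
    by (rule v2s_comb[OF int11]) simp
  have I02: "integral {0..T} (\<lambda>\<tau>. \<phi>s \<tau> \<bullet> B \<tau> (v2 \<tau>) (v2 \<tau>)) = 2 * a02"
    by (rule \<phi>s_comb[OF int02, where q="2 * \<alpha>02"]) simp
  \<comment> \<open>Replacing \<open>h' 2 0\<close> by its equation brings in
    \<open>- (6 * a20) *\<^sub>R v1 \<tau>\<close>: this is the origin of \<open>6 * a20\<close>
    here and of the final \<open>- a20\<close> in the formula. The terms with \<open>b11\<close> and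
    \<open>a02\<close> below arise alike.\<close>
  have I30: "integral {0..T} (\<lambda>\<tau>. \<phi>s \<tau> \<bullet>
          (C \<tau> (v1 \<tau>) (v1 \<tau>) (v1 \<tau>) + 3 *\<^sub>R B \<tau> (h 2 0 \<tau>) (v1 \<tau>) - (6 * a20) *\<^sub>R h 2 0 \<tau>
           + 3 *\<^sub>R (A \<tau> *v h 2 0 \<tau> + B \<tau> (v1 \<tau>) (v1 \<tau>)) + (6 * (1 - \<alpha>20)) *\<^sub>R (A \<tau> *v v1 \<tau>))) = 6 * a20 + 6 * a30"
    by (rule \<phi>s_comb[OF int30, where q="12 * \<alpha>20 + 6 * \<alpha>30 - 6"]) (simp add: eq2(1) vec_eq_iff algebra_simps)
  have I21: "integral {0..T} (\<lambda>\<tau>. v2s \<tau> \<bullet>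
          (C \<tau> (v1 \<tau>) (v1 \<tau>) (v2 \<tau>) + B \<tau> (h 2 0 \<tau>) (v2 \<tau>) + 2 *\<^sub>R B \<tau> (h 1 1 \<tau>) (v1 \<tau>)
           - (2 * a20) *\<^sub>R h 1 1 \<tau> - (2 * b11) *\<^sub>R h 1 1 \<tau>
           + 2 *\<^sub>R (A \<tau> *v h 1 1 \<tau> + B \<tau> (v1 \<tau>) (v2 \<tau>)) + (2 * (1 - \<alpha>20)) *\<^sub>R (A \<tau> *v v2 \<tau>))) = 2 * b11 + 2 * b21"
    by (rule v2s_comb[OF int21]) (simp add: eq2(2)[simplified] vec_eq_iff algebra_simps)
  \<comment> \<open>In the multiple \<open>4 * \<alpha>02\<close> of \<open>F(u0)\<close>, one half
    comes from \<open>h' 0 2\<close> and the other from \<open>?w1\<close>.\<close>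
  have I12: "integral {0..T} (\<lambda>\<tau>. \<phi>s \<tau> \<bullet>
          (C \<tau> (v1 \<tau>) (v2 \<tau>) (v2 \<tau>) + B \<tau> (h 0 2 \<tau>) (v1 \<tau>) + 2 *\<^sub>R B \<tau> (h 1 1 \<tau>) (v2 \<tau>)
           - (2 * b11) *\<^sub>R h 0 2 \<tau> - (2 * a02) *\<^sub>R h 2 0 \<tau>
           + A \<tau> *v h 0 2 \<tau> + B \<tau> (v2 \<tau>) (v2 \<tau>) - (2 * \<alpha>02) *\<^sub>R (A \<tau> *v v1 \<tau>))) = 2 * a02 + 2 * a12"
    by (rule \<phi>s_comb[OF int12, where q="4 * \<alpha>02 + 2 * \<alpha>12"]) (simp add: eq2(3) vec_eq_iff algebra_simps)
  have I03: "integral {0..T} (\<lambda>\<tau>. v2s \<tau> \<bullet>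
          (C \<tau> (v2 \<tau>) (v2 \<tau>) (v2 \<tau>) + 3 *\<^sub>R B \<tau> (h 0 2 \<tau>) (v2 \<tau>)
           - (6 * a02) *\<^sub>R h 1 1 \<tau> - (6 * \<alpha>02) *\<^sub>R (A \<tau> *v v2 \<tau>))) = 6 * b03"
    by (rule v2s_comb[OF int03]) simp

  \<comment> \<open>Unique solvability of the three boundary value problems\<close>
  have U20: "unique_solution_on {0..T} (\<lambda>g.
        (\<forall>\<tau>\<in>{0..T}. (g has_vector_derivative
           A \<tau> *v g \<tau> + B \<tau> (v1 \<tau>) (v1 \<tau>) - (2 * a20) *\<^sub>R v1 \<tau> - (2 * \<alpha>20) *\<^sub>R F (u0 \<tau>)
             + 2 *\<^sub>R (A \<tau> *v v1 \<tau>) + 2 *\<^sub>R F (u0 \<tau>)) (at \<tau> within {0..T}))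
        \<and> g T - g 0 = 0 \<and> integral {0..T} (\<lambda>\<tau>. v1s \<tau> \<bullet> g \<tau>) = 0) (h 2 0)"
    unfolding unique_solution_on_def
  proof (intro conjI allI impI ballI)
    fix g t assume g: "(\<forall>\<tau>\<in>{0..T}. (g has_vector_derivative
           A \<tau> *v g \<tau> + B \<tau> (v1 \<tau>) (v1 \<tau>) - (2 * a20) *\<^sub>R v1 \<tau> - (2 * \<alpha>20) *\<^sub>R F (u0 \<tau>)
             + 2 *\<^sub>R (A \<tau> *v v1 \<tau>) + 2 *\<^sub>R F (u0 \<tau>)) (at \<tau> within {0..T}))
        \<and> g T - g 0 = 0 \<and> integral {0..T} (\<lambda>\<tau>. v1s \<tau> \<bullet> g \<tau>) = 0" and t: "t \<in> {0..T}"
    show "g t = h 2 0 t"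
      by (rule unique1[OF _ g[THEN conjunct1, rule_format] ode20 _ _ _ h20_norm t]) (use g h_bc2 in simp_all)
  qed (use ode20 h_bc2 h20_norm in auto)
  have U11: "unique_solution_on {0..T} (\<lambda>g.
        (\<forall>\<tau>\<in>{0..T}. (g has_vector_derivative
           A \<tau> *v g \<tau> + B \<tau> (v1 \<tau>) (v2 \<tau>) - b11 *\<^sub>R v2 \<tau> + A \<tau> *v v2 \<tau>) (at \<tau> within {0..T}))
        \<and> g T + g 0 = 0 \<and> integral {0..T} (\<lambda>\<tau>. v2s \<tau> \<bullet> g \<tau>) = 0) (h 1 1)"
    unfolding unique_solution_on_def
  proof (intro conjI allI impI ballI)
    fix g t assume g: "(\<forall>\<tau>\<in>{0..T}. (g has_vector_derivative
           A \<tau> *v g \<tau> + B \<tau> (v1 \<tau>) (v2 \<tau>) - b11 *\<^sub>R v2 \<tau> + A \<tau> *v v2 \<tau>) (at \<tau> within {0..T}))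
        \<and> g T + g 0 = 0 \<and> integral {0..T} (\<lambda>\<tau>. v2s \<tau> \<bullet> g \<tau>) = 0" and t: "t \<in> {0..T}"
    \<comment> \<open>The boundary condition is put in the form of the multiplier -1, so that the
      difference with \<open>h 1 1\<close> satisfies the antiperiodic condition of
      \<open>unique2\<close>.\<close>
    have "g T = - g 0" using g by (simp add: eq_neg_iff_add_eq_0)
    then show "g t = h 1 1 t"
      by (intro unique2[OF _ _ g[THEN conjunct1, rule_format] ode11 _ _ _ h11_norm t]) (use g h_bc2 in simp_all)
  qed (use ode11 h_bc2 h11_norm in auto)
  have U02: "unique_solution_on {0..T} (\<lambda>g.
        (\<forall>\<tau>\<in>{0..T}. (g has_vector_derivative
           A \<tau> *v g \<tau> + B \<tau> (v2 \<tau>) (v2 \<tau>) - (2 * a02) *\<^sub>R v1 \<tau> - (2 * \<alpha>02) *\<^sub>R F (u0 \<tau>))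
             (at \<tau> within {0..T}))
        \<and> g T - g 0 = 0 \<and> integral {0..T} (\<lambda>\<tau>. v1s \<tau> \<bullet> g \<tau>) = 0) (h 0 2)"
    unfolding unique_solution_on_def
  proof (intro conjI allI impI ballI)
    fix g t assume g: "(\<forall>\<tau>\<in>{0..T}. (g has_vector_derivative
           A \<tau> *v g \<tau> + B \<tau> (v2 \<tau>) (v2 \<tau>) - (2 * a02) *\<^sub>R v1 \<tau> - (2 * \<alpha>02) *\<^sub>R F (u0 \<tau>))
             (at \<tau> within {0..T}))
        \<and> g T - g 0 = 0 \<and> integral {0..T} (\<lambda>\<tau>. v1s \<tau> \<bullet> g \<tau>) = 0" and t: "t \<in> {0..T}"
    show "g t = h 0 2 t"
      by (rule unique1[OF _ g[THEN conjunct1, rule_format] ode02 _ _ _ h02_norm t]) (use g h_bc2 in simp_all)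
  qed (use ode02 h_bc2 h02_norm in auto)
  show ?thesis
    by (intro conjI U20 U11 U02) (simp_all only: I20 I11 I02 I30 I21 I12 I03, simp_all add: add_divide_distrib)
qed

end
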